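(* Let $Q$ be a smooth manifold, $N\subset Q$ a submanifold, and $\Gamma$ a SODE on $TN$. Then $\Gamma$ is variational for the inverse problem of the calculus of variations without constraints (on $TN$) if and only if it is variational along the submanifold $TN$ of $TQ$ in the inverse problem for constrained systems.
   Context: Everything is smooth. $\tau_Q:TQ\to Q$, $\tau_N:TN\to N$, $\pi_Q:T^*Q\to Q$ are the canonical projections; $(q^a)$ are coordinates on $N$ and $(q^a,\dot q^a)$ the induced ones on $TN$. Existence statements in the definitions below are understood locally, i.e. on an open neighbourhood of each point of $TN$. SODE on $TN$: a vector field $\Gamma=\dot q^a\frac{\partial}{\partial q^a}+\Gamma^a(q,\dot q)\frac{\partial}{\partial\dot q^a}$ on $TN$. Variational without constraints (on $TN$): there is a locally defined function $l$ on $TN$ that is regular (the matrix $\left(\frac{\partial^2l}{\partial\dot q^a\partial\dot q^b}\right)$ is invertible) and satisfies $\frac{\partial^2l}{\partial\dot q^a\partial\dot q^b}(\ddot q^b-\Gamma^b(q,\dot q))=\frac{d}{dt}\left(\frac{\partial l}{\partial\dot q^a}\right)-\frac{\partial l}{\partial q^a}$ for all $a$. Let $\mathrm i_{TN}:TN\to TQ$ be the inclusion, $T^*_NQ=\{p\in T^*Q:\pi_Q(p)\in N\}$, and let $\mathrm i_{TN}^*:T^*_NQ\to T^*N$ be its transpose: $\langle\mathrm i_{TN}^*(p),v\rangle=\langle p,\mathrm i_{TN}(v)\rangle$ for $p\in T^*_NQ$ and $v\in T_{\pi_Q(p)}N$. Tulczyjew isomorphism: $\alpha_Q:TT^*Q\to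 T^*TQ$, in induced coordinates $\alpha_Q(q^i,p_i,\dot q^i,\dot p_i)=(q^i,\dot q^i,\dot p_i,p_i)$, i.e. the covector $\dot p_i\,dq^i+p_i\,d\dot q^i$ at $(q^i,\dot q^i)\in TQ$. $\omega_{TQ}$ is the canonical symplectic form on $T^*TQ$; a submanifold is isotropic if $\omega_{TQ}$ pulls back to zero on it. Variational along $TN$ in the inverse problem for constrained systems: there exists a map $F:TN\to T^*Q$ over the inclusion $N\subset Q$ (i.e. $\pi_Q(F(v))=\tau_N(v)\in N\subset Q$ for all $v$, so $F$ takes values in $T^*_NQ$) such that $\mathrm i_{TN}^*\circ F:TN\to T^*N$ is an immersion and $\mathrm{Im}(\alpha_Q\circ TF\circ\Gamma)$ is an isotropic submanifold of $(T^*TQ,\omega_{TQ})$. *)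

theory Defs
  imports "HOL-Analysis.Analysis"
begin

section \<open>Smooth functions on coordinate spaces\<close>

text \<open>
  The coordinate space of dimension \<open>n\<close> is \<open>span B\<close> for a set \<open>B\<close> of \<open>n\<close> standard basis vectors of
  an ambient Euclidean space.  The coordinates of a point \<open>y\<close> are the numbers \<open>y \<bullet> b\<close> with
  \<open>b \<in> B\<close>.  In this way all dimensions, zero included, and the coordinate subspaces needed for
  submanifolds live in one type.
\<close>

text \<open>
  The derivative of \<open>f\<close> at \<open>y\<close> in the direction \<open>u\<close>.  It is only used for \<open>y, u \<in> span B\<close> and \<open>f\<close>
  differentiable on a relatively open neighbourhood of \<open>y\<close> in \<open>span B\<close>; there it is unique.
\<close>

definition pd :: "'e::euclidean_space set \<Rightarrow> ('e \<Rightarrow> 'f::real_normed_vector) \<Rightarrow> 'e \<Rightarrow> 'e \<Rightarrow> 'f" where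
  "pd B f u y = frechet_derivative f (at y within span B) u"

primrec Ck_on :: "nat \<Rightarrow> 'e::euclidean_space set \<Rightarrow> 'e set \<Rightarrow> ('e \<Rightarrow> 'f::real_normed_vector) \<Rightarrow> bool" where
  "Ck_on 0 B S f \<longleftrightarrow> continuous_on S f"
| "Ck_on (Suc k) B S f \<longleftrightarrow>
     (\<forall>y\<in>S. f differentiable (at y within span B)) \<and> (\<forall>b\<in>B. Ck_on k B S (pd B f b))"

definition smooth_on :: "'e::euclidean_space set \<Rightarrow> 'e set \<Rightarrow> ('e \<Rightarrow> 'f::real_normed_vector) \<Rightarrow> bool" where
  "smooth_on B S f \<longleftrightarrow> (\<forall>k. Ck_on k B S f)"

section \<open>Smooth manifolds\<close>

type_synonym ('a, 'e) chart = "'a set \<times> ('a \<Rightarrow> 'e)"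

record ('a, 'e) mfd =
  model :: "'e set"
  atlas :: "('a, 'e) chart set"

definition is_chart :: "'e::euclidean_space set \<Rightarrow> ('a, 'e) chart \<Rightarrow> bool" where
  "is_chart B c \<longleftrightarrow> inj_on (snd c) (fst c) \<and> openin (top_of_set (span B)) (snd c ` fst c)"

definition local_rep :: "('a, 'e) chart \<Rightarrow> ('b, 'f) chart \<Rightarrow> ('a \<Rightarrow> 'b) \<Rightarrow> 'e \<Rightarrow> 'f" where
  "local_rep c d f = snd d \<circ> f \<circ> inv_into (fst c) (snd c)"

definition compatible :: "'e::euclidean_space set \<Rightarrow> ('a, 'e) chart \<Rightarrow> ('a, 'e) chart \<Rightarrow> bool" where
  "compatible B c d \<longleftrightarrow>
     openin (top_of_set (span B)) (snd c ` (fst c \<inter> fst d)) \<and>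
     openin (top_of_set (span B)) (snd d ` (fst c \<inter> fst d)) \<and>
     smooth_on B (snd c ` (fst c \<inter> fst d)) (local_rep c d id) \<and>
     smooth_on B (snd d ` (fst c \<inter> fst d)) (local_rep d c id)"

definition smooth_atlas :: "'e::euclidean_space set \<Rightarrow> ('a, 'e) chart set \<Rightarrow> bool" where
  "smooth_atlas B A \<longleftrightarrow> B \<subseteq> Basis \<and> (\<forall>c\<in>A. is_chart B c) \<and> (\<forall>c\<in>A. \<forall>d\<in>A. compatible B c d)"

definition carrier :: "('a, 'e) mfd \<Rightarrow> 'a set" where
  "carrier M = (\<Union>c\<in>atlas M. fst c)"

definition mtop :: "('a, 'e::euclidean_space) mfd \<Rightarrow> 'a topology" where
  "mtop M = topology (\<lambda>W. W \<subseteq> carrier M \<and>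
     (\<forall>c\<in>atlas M. openin (top_of_set (span (model M))) (snd c ` (fst c \<inter> W))))"

definition smooth_manifold :: "('a, 'e::euclidean_space) mfd \<Rightarrow> bool" where
  "smooth_manifold M \<longleftrightarrow>
     smooth_atlas (model M) (atlas M) \<and> Hausdorff_space (mtop M) \<and> second_countable (mtop M)"

text \<open>The maximal atlas; ``chart of \<open>M\<close>'' always means a member of it.\<close>

definition charts :: "('a, 'e::euclidean_space) mfd \<Rightarrow> ('a, 'e) chart set" where
  "charts M = {c. fst c \<subseteq> carrier M \<and> is_chart (model M) c \<and>
                  (\<forall>d\<in>atlas M. compatible (model M) c d)}"

definition charts_at :: "('a, 'e::euclidean_space) mfd \<Rightarrow> 'a \<Rightarrow> ('a, 'e) chart set" where
  "charts_at M x = {c \<in> charts M. x \<in> fst c}"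

text \<open>Smoothness of a map, respectively of a real function, on an open subset \<open>W\<close> of \<open>M\<close>.\<close>

definition smooth_map ::
  "('a, 'e::euclidean_space) mfd \<Rightarrow> 'a set \<Rightarrow> ('b, 'f::euclidean_space) mfd \<Rightarrow> ('a \<Rightarrow> 'b) \<Rightarrow> bool" where
  "smooth_map M W M' f \<longleftrightarrow>
     (\<forall>x\<in>W. \<exists>c\<in>charts_at M x. \<exists>d\<in>charts_at M' (f x).
        fst c \<subseteq> W \<and> f ` fst c \<subseteq> fst d \<and> smooth_on (model M) (snd c ` fst c) (local_rep c d f))"

definition smooth_fun :: "('a, 'e::euclidean_space) mfd \<Rightarrow> 'a set \<Rightarrow> ('a \<Rightarrow> real) \<Rightarrow> bool" where
  "smooth_fun M W f \<longleftrightarrow>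
     (\<forall>x\<in>W. \<exists>c\<in>charts_at M x.
        fst c \<subseteq> W \<and> smooth_on (model M) (snd c ` fst c) (f \<circ> inv_into (fst c) (snd c)))"

section \<open>Submanifolds\<close>

text \<open>
  Embedded submanifolds, given by slice charts: in suitable charts \<open>S\<close> is the locus where the
  coordinates with indices outside \<open>C\<close> vanish.  The dimension of \<open>S\<close> is \<open>card C\<close>.
\<close>

definition slice_charts :: "('a, 'e::euclidean_space) mfd \<Rightarrow> 'e set \<Rightarrow> 'a set \<Rightarrow> ('a, 'e) chart set" where
  "slice_charts M C S = {c \<in> charts M. snd c ` (fst c \<inter> S) = snd c ` fst c \<inter> span C}"

definition submanifold :: "('a, 'e::euclidean_space) mfd \<Rightarrow> 'e set \<Rightarrow> 'a set \<Rightarrow> bool" where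
  "submanifold M C S \<longleftrightarrow>
     C \<subseteq> model M \<and> S \<subseteq> carrier M \<and> (\<forall>x\<in>S. \<exists>c\<in>slice_charts M C S. x \<in> fst c)"

definition submfd :: "('a, 'e::euclidean_space) mfd \<Rightarrow> 'e set \<Rightarrow> 'a set \<Rightarrow> ('a, 'e) mfd" where
  "submfd M C S = \<lparr>model = C, atlas = (\<lambda>c. (fst c \<inter> S, snd c)) ` slice_charts M C S\<rparr>"

section \<open>Tangent and cotangent bundles\<close>

text \<open>
  A tangent vector is a base point together with the family of its components in all charts
  around that point, which transform by the Jacobians of the coordinate changes; the components are
  set to \<open>0\<close> for all other charts, so that equal tangent vectors are equal as HOL values.
\<close>

type_synonym ('a, 'e) tvec = "'a \<times> (('a, 'e) chart \<Rightarrow> 'e)"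

definition tangent_at :: "('a, 'e::euclidean_space) mfd \<Rightarrow> 'a \<Rightarrow> ('a, 'e) tvec set" where
  "tangent_at M x = {v. fst v = x \<and>
     (\<forall>c. if c \<in> charts_at M x then snd v c \<in> span (model M) else snd v c = 0) \<and>
     (\<forall>c\<in>charts_at M x. \<forall>d\<in>charts_at M x.
        snd v d = pd (model M) (local_rep c d id) (snd v c) (snd c x))}"

definition tadd :: "('a, 'e::euclidean_space) tvec \<Rightarrow> ('a, 'e) tvec \<Rightarrow> ('a, 'e) tvec" where
  "tadd v w = (fst v, \<lambda>c. snd v c + snd w c)"

definition tscale :: "real \<Rightarrow> ('a, 'e::euclidean_space) tvec \<Rightarrow> ('a, 'e) tvec" where
  "tscale r v = (fst v, \<lambda>c. r *\<^sub>R snd v c)"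

definition bundle_model :: "'e::euclidean_space set \<Rightarrow> ('e \<times> 'e) set" where
  "bundle_model B = (\<lambda>b. (b, 0)) ` B \<union> (\<lambda>b. (0, b)) ` B"

definition tchart ::
  "('a, 'e::euclidean_space) mfd \<Rightarrow> ('a, 'e) chart \<Rightarrow> (('a, 'e) tvec, 'e \<times> 'e) chart" where
  "tchart M c = (\<Union>x\<in>fst c. tangent_at M x, \<lambda>v. (snd c (fst v), snd v c))"

definition tangent_bundle :: "('a, 'e::euclidean_space) mfd \<Rightarrow> (('a, 'e) tvec, 'e \<times> 'e) mfd" where
  "tangent_bundle M = \<lparr>model = bundle_model (model M), atlas = tchart M ` charts M\<rparr>"

text \<open>The tangent map \<open>Tf\<close>; the chart at the source is arbitrary, the result does not depend on it.\<close>

definition tangent_map ::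
  "('a, 'e::euclidean_space) mfd \<Rightarrow> ('b, 'f::euclidean_space) mfd \<Rightarrow> ('a \<Rightarrow> 'b) \<Rightarrow>
   ('a, 'e) tvec \<Rightarrow> ('b, 'f) tvec" where
  "tangent_map M M' f v =
     (let x = fst v; c = (SOME c. c \<in> charts_at M x) in
      (f x, \<lambda>d. if d \<in> charts_at M' (f x)
                then pd (model M) (local_rep c d f) (snd v c) (snd c x) else 0))"

definition immersion ::
  "('a, 'e::euclidean_space) mfd \<Rightarrow> 'a set \<Rightarrow> ('b, 'f::euclidean_space) mfd \<Rightarrow> ('a \<Rightarrow> 'b) \<Rightarrow> bool" where
  "immersion M W M' f \<longleftrightarrow>
     smooth_map M W M' f \<and> (\<forall>x\<in>W. inj_on (tangent_map M M' f) (tangent_at M x))"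

text \<open>Covectors at \<open>x\<close> are the linear functionals on the tangent space (\<open>0\<close> outside of it).\<close>

type_synonym ('a, 'e) cvec = "'a \<times> (('a, 'e) tvec \<Rightarrow> real)"

definition cotangent_at :: "('a, 'e::euclidean_space) mfd \<Rightarrow> 'a \<Rightarrow> ('a, 'e) cvec set" where
  "cotangent_at M x = {p. fst p = x \<and>
     (\<forall>v\<in>tangent_at M x. \<forall>w\<in>tangent_at M x. snd p (tadd v w) = snd p v + snd p w) \<and>
     (\<forall>r. \<forall>v\<in>tangent_at M x. snd p (tscale r v) = r * snd p v) \<and>
     (\<forall>v. v \<notin> tangent_at M x \<longrightarrow> snd p v = 0)}"

text \<open>The tangent vector at \<open>x\<close> with components \<open>u\<close> in the chart \<open>c\<close>, i.e. \<open>u\<^sup>i \<partial>/\<partial>q\<^sup>i\<close>.\<close>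

definition cvector :: "('a, 'e::euclidean_space) mfd \<Rightarrow> ('a, 'e) chart \<Rightarrow> 'a \<Rightarrow> 'e \<Rightarrow> ('a, 'e) tvec" where
  "cvector M c x u =
     (x, \<lambda>d. if d \<in> charts_at M x then pd (model M) (local_rep c d id) u (snd c x) else 0)"

definition cchart ::
  "('a, 'e::euclidean_space) mfd \<Rightarrow> ('a, 'e) chart \<Rightarrow> (('a, 'e) cvec, 'e \<times> 'e) chart" where
  "cchart M c = (\<Union>x\<in>fst c. cotangent_at M x,
     \<lambda>p. (snd c (fst p), \<Sum>b\<in>model M. snd p (cvector M c (fst p) b) *\<^sub>R b))"

definition cotangent_bundle :: "('a, 'e::euclidean_space) mfd \<Rightarrow> (('a, 'e) cvec, 'e \<times> 'e) mfd" where
  "cotangent_bundle M = \<lparr>model = bundle_model (model M), atlas = cchart M ` charts M\<rparr>"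

section \<open>Symplectic geometry\<close>

text \<open>
  The canonical symplectic form \<open>dq\<^sup>i \<and> dp\<^sub>i\<close> of \<open>T\<^sup>*M\<close>, evaluated on two tangent vectors of \<open>T\<^sup>*M\<close>
  at the same point, in an arbitrary induced chart.
\<close>

definition omega ::
  "('a, 'e::euclidean_space) mfd \<Rightarrow> (('a, 'e) cvec, 'e \<times> 'e) tvec \<Rightarrow> (('a, 'e) cvec, 'e \<times> 'e) tvec \<Rightarrow> real" where
  "omega M X Y =
     (let c = (SOME c. c \<in> charts_at M (fst (fst X)));
          (dqX, dpX) = snd X (cchart M c);
          (dqY, dpY) = snd Y (cchart M c)
      in \<Sum>b\<in>model M. (dqX \<bullet> b) * (dpY \<bullet> b) - (dqY \<bullet> b) * (dpX \<bullet> b))"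

definition isotropic_submanifold :: "('a, 'e::euclidean_space) mfd \<Rightarrow> ('a, 'e) cvec set \<Rightarrow> bool" where
  "isotropic_submanifold M S \<longleftrightarrow>
     (\<exists>C. submanifold (cotangent_bundle M) C S \<and>
       (let S' = submfd (cotangent_bundle M) C S;
            Ti = tangent_map S' (cotangent_bundle M) id
        in \<forall>z\<in>S. \<forall>X\<in>tangent_at S' z. \<forall>Y\<in>tangent_at S' z. omega M (Ti X) (Ti Y) = 0))"

text \<open>
  The Tulczyjew isomorphism \<open>TT\<^sup>*Q \<rightarrow> T\<^sup>*TQ\<close>, \<open>(q, p, q', p') \<mapsto> (q, q', p', p)\<close> in the coordinates
  induced by an arbitrary chart of \<open>Q\<close>.
\<close>

definition tulczyjew ::
  "('a, 'e::euclidean_space) mfd \<Rightarrow> (('a, 'e) cvec, 'e \<times> 'e) tvec \<Rightarrow> (('a, 'e) tvec, 'e \<times> 'e) cvec" where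
  "tulczyjew Q w =
     (let c = (SOME c. c \<in> charts_at Q (fst (fst w)));
          ((q, p), (q', p')) = snd (tchart (cotangent_bundle Q) (cchart Q c)) w;
          d = cchart (tangent_bundle Q) (tchart Q c)
      in inv_into (fst d) (snd d) ((q, q'), (p', p)))"

section \<open>The inverse problem without constraints\<close>

definition sode ::
  "('a, 'e::euclidean_space) mfd \<Rightarrow> (('a, 'e) tvec \<Rightarrow> (('a, 'e) tvec, 'e \<times> 'e) tvec) \<Rightarrow> bool" where
  "sode N \<Gamma> \<longleftrightarrow>
     (let TN = tangent_bundle N in
      smooth_map TN (carrier TN) (tangent_bundle TN) \<Gamma> \<and>
      (\<forall>v\<in>carrier TN. \<Gamma> v \<in> tangent_at TN v \<and>
         (\<forall>c\<in>charts_at N (fst v). fst (snd (\<Gamma> v) (tchart N c)) = snd v c)))"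

text \<open>The coefficients \<open>\<Gamma>\<^sup>a\<close> at \<open>v\<close> in the coordinates induced by \<open>c\<close>.\<close>

definition sode_coeff ::
  "('a, 'e::euclidean_space) mfd \<Rightarrow> (('a, 'e) tvec \<Rightarrow> (('a, 'e) tvec, 'e \<times> 'e) tvec) \<Rightarrow>
   ('a, 'e) chart \<Rightarrow> ('a, 'e) tvec \<Rightarrow> 'e \<Rightarrow> real" where
  "sode_coeff N \<Gamma> c v a = snd (snd (\<Gamma> v) (tchart N c)) \<bullet> a"

text \<open>For \<open>L\<close> a function of \<open>(q, q')\<close>: the partial derivatives with respect to \<open>q\<^sup>a\<close> and \<open>q'\<^sup>a\<close>.\<close>

definition dq :: "'e::euclidean_space set \<Rightarrow> 'e \<Rightarrow> ('e \<times> 'e \<Rightarrow> real) \<Rightarrow> 'e \<times> 'e \<Rightarrow> real" where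
  "dq B a L = pd (bundle_model B) L (a, 0)"

definition dv :: "'e::euclidean_space set \<Rightarrow> 'e \<Rightarrow> ('e \<times> 'e \<Rightarrow> real) \<Rightarrow> 'e \<times> 'e \<Rightarrow> real" where
  "dv B a L = pd (bundle_model B) L (0, a)"

text \<open>The total time derivative \<open>q'\<^sup>b \<partial>f/\<partial>q\<^sup>b + q''\<^sup>b \<partial>f/\<partial>q'\<^sup>b\<close> at \<open>y = (q, q')\<close>, with acceleration \<open>q'' = A\<close>.\<close>

definition ddt :: "'e::euclidean_space set \<Rightarrow> ('e \<times> 'e \<Rightarrow> real) \<Rightarrow> 'e \<times> 'e \<Rightarrow> 'e \<Rightarrow> real" where
  "ddt B f y A = (\<Sum>b\<in>B. (snd y \<bullet> b) * dq B b f y + (A \<bullet> b) * dv B b f y)"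

definition invertible_on :: "'i set \<Rightarrow> ('i \<Rightarrow> 'i \<Rightarrow> real) \<Rightarrow> bool" where
  "invertible_on I H \<longleftrightarrow> (\<exists>K. \<forall>a\<in>I. \<forall>b\<in>I.
     (\<Sum>j\<in>I. H a j * K j b) = (if a = b then 1 else 0) \<and>
     (\<Sum>j\<in>I. K a j * H j b) = (if a = b then 1 else 0))"

definition variational ::
  "('a, 'e::euclidean_space) mfd \<Rightarrow> (('a, 'e) tvec \<Rightarrow> (('a, 'e) tvec, 'e \<times> 'e) tvec) \<Rightarrow> bool" where
  "variational N \<Gamma> \<longleftrightarrow>
     (let TN = tangent_bundle N; B = model N in
      \<forall>v\<in>carrier TN. \<exists>W l. openin (mtop TN) W \<and> v \<in> W \<and> smooth_fun TN W l \<and>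
        (\<forall>w\<in>W. \<forall>c\<in>charts_at N (fst w).
           let t = tchart N c; L = l \<circ> inv_into (fst t) (snd t); y = snd t w in
           invertible_on B (\<lambda>a b. dv B b (dv B a L) y) \<and>
           (\<forall>A\<in>span B. \<forall>a\<in>B.
              (\<Sum>b\<in>B. dv B b (dv B a L) y * (A \<bullet> b - sode_coeff N \<Gamma> c w b)) =
              ddt B (dv B a L) y A - dq B a L y)))"

section \<open>The inverse problem for constrained systems\<close>

text \<open>
  In the following \<open>submfd Q C N\<close> is the submanifold \<open>N\<close> with its manifold structure; the inclusion
  of \<open>TN\<close> into \<open>TQ\<close> is the tangent map of the inclusion of \<open>N\<close> into \<open>Q\<close>.
\<close>

definition i_TN :: "('a, 'e::euclidean_space) mfd \<Rightarrow> 'e set \<Rightarrow> 'a set \<Rightarrow> ('a, 'e) tvec \<Rightarrow> ('a, 'e) tvec" where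
  "i_TN Q C N = tangent_map (submfd Q C N) Q id"

definition i_TN_transpose ::
  "('a, 'e::euclidean_space) mfd \<Rightarrow> 'e set \<Rightarrow> 'a set \<Rightarrow> ('a, 'e) cvec \<Rightarrow> ('a, 'e) cvec" where
  "i_TN_transpose Q C N p =
     (fst p, \<lambda>v. if v \<in> tangent_at (submfd Q C N) (fst p) then snd p (i_TN Q C N v) else 0)"

definition variational_along ::
  "('a, 'e::euclidean_space) mfd \<Rightarrow> 'e set \<Rightarrow> 'a set \<Rightarrow>
   (('a, 'e) tvec \<Rightarrow> (('a, 'e) tvec, 'e \<times> 'e) tvec) \<Rightarrow> bool" where
  "variational_along Q C N \<Gamma> \<longleftrightarrow>
     (let TN = tangent_bundle (submfd Q C N);
          T'N = cotangent_bundle (submfd Q C N);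
          T'Q = cotangent_bundle Q in
      \<forall>v\<in>carrier TN. \<exists>W F. openin (mtop TN) W \<and> v \<in> W \<and>
        smooth_map TN W T'Q F \<and> (\<forall>w\<in>W. fst (F w) = fst w) \<and>
        immersion TN W T'N (i_TN_transpose Q C N \<circ> F) \<and>
        isotropic_submanifold (tangent_bundle Q)
          ((tulczyjew Q \<circ> tangent_map TN T'Q F \<circ> \<Gamma>) ` W))"

end

theory Submission
  imports Defs
begin

text \<open>
  Write \<open>F = (q\<^sup>a, F\<^sub>a, F\<^sub>\<alpha>)\<close> in a slice chart, where \<open>N\<close> is the locus \<open>q\<^sup>\<alpha> = 0\<close>.  Since \<open>dq\<^sup>\<alpha> = 0\<close> on \<open>TN\<close>, the
  canonical one-form of \<open>T\<^sup>*TQ\<close> pulls back along \<open>\<alpha>\<^sub>Q \<circ> TF \<circ> \<Gamma>\<close> to \<open>\<Gamma>(F\<^sub>a) dq\<^sup>a + F\<^sub>a dq'\<^sup>a\<close> on \<open>TN\<close>.  The image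
  is isotropic iff this form is closed, that is, by the Poincare lemma, locally equal to some \<open>dL\<close>.  This
  means \<open>F\<^sub>a = \<partial>L/\<partial>q'\<^sup>a\<close> and \<open>\<Gamma>(\<partial>L/\<partial>q'\<^sup>a) = \<partial>L/\<partial>q\<^sup>a\<close>, the Euler-Lagrange equations along \<open>\<Gamma>\<close>, and the transpose of \<open>F\<close>
  is the Legendre map of \<open>L\<close>, an immersion iff \<open>L\<close> is regular.  Conversely, a Lagrangian \<open>L\<close> defines \<open>F\<close> by
  \<open>F\<^sub>a = \<partial>L/\<partial>q'\<^sup>a\<close> and \<open>F\<^sub>\<alpha> = 0\<close>; the image is then the graph of \<open>dL\<close> over an open part of \<open>TN\<close>, which is an
  embedded submanifold of \<open>T\<^sup>*TQ\<close>.
\<close>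

section \<open>Calculus on coordinate subspaces\<close>

text \<open>Neither notion can be handled in one convenient chart from the start.
  \<open>variational\<close> quantifies over all charts of \<open>N\<close>, whereas
  \<open>tulczyjew\<close> and \<open>omega\<close> compute in charts picked by \<open>SOME\<close>.
  The computations are therefore first made independent of these choices and then carried out in
  slice charts. A Lagrangian found in a slice chart is moved to the other charts through the formula
  for dL recorded in \<open>Legendre\<close>, not by transforming the Euler-Lagrange equations. The
  normal components F_\<alpha> of a given \<open>F\<close> are arbitrary. They stay in the covector
  \<open>Phi F w\<close>, but pair only with directions normal to TN, so they drop out once the
  covector is tested on vectors tangent to TN. The image is treated differently in the two
  directions. If its isotropy is given, the map is corestricted to the embedded submanifold and
  vectors of TN are pushed forward. In the converse the submanifold itself has to be constructed,
  and \<open>W\<close> is first shrunk into one slice chart, because the prescription F_\<alpha> = 0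
  has a meaning only relative to such a chart.\<close>

abbreviation opn :: "'e::euclidean_space set \<Rightarrow> 'e set \<Rightarrow> bool" where
  "opn B \<equiv> openin (top_of_set (span B))"

lemma opn_span: "opn B S \<Longrightarrow> y \<in> S \<Longrightarrow> y \<in> span B"
  using openin_imp_subset by blast

lemma at_within_opn:
  assumes "opn B S" "y \<in> S"
  shows "at y within S = at y within span B"
proof -
  obtain T where "open T" "S = span B \<inter> T" using assms(1) by (auto simp: openin_open)
  then show ?thesis using assms(2) by (intro at_within_nhd[of _ T]) auto
qed

lemma pd_works:
  assumes "f differentiable (at y within span B)"
  shows "(f has_derivative (\<lambda>u. pd B f u y)) (at y within span B)"
  using assms unfolding pd_def frechet_derivative_works by (simp add: eta_contract_eq)

text \<open>A derivative within \<open>span B\<close> is determined only in the directions of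
  \<open>span B\<close>. Restriction to a line in such a direction gives a one-variable derivative,
  for which uniqueness holds.\<close>

lemma has_derivative_along_line:
  assumes "(f has_derivative f') (at y within span B)" "y \<in> span B" "u \<in> span B"
  shows "((\<lambda>t. f (y + t *\<^sub>R u)) has_vector_derivative f' u) (at 0)"
proof -
  have "((\<lambda>t. y + t *\<^sub>R u) has_derivative (\<lambda>t. t *\<^sub>R u)) (at 0)"
    by (auto intro!: derivative_eq_intros)
  moreover have "(f has_derivative f') (at (y + 0 *\<^sub>R u) within range (\<lambda>t. y + t *\<^sub>R u))"
    using assms by (auto intro!: has_derivative_subset[of _ _ _ "span B"] span_add span_scale)
  ultimately have "(f \<circ> (\<lambda>t. y + t *\<^sub>R u) has_derivative f' \<circ> (\<lambda>t. t *\<^sub>R u)) (at 0)"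
    using diff_chain_within by blast
  moreover have "f' (t *\<^sub>R u) = t *\<^sub>R f' u" for t
    using assms(1) by (simp add: has_derivative_bounded_linear linear_cmul bounded_linear.linear)
  ultimately show ?thesis by (simp add: has_vector_derivative_def o_def)
qed

text \<open>Two derivatives within \<open>span B\<close> agree along every line inside
  \<open>span B\<close>. Off the span nothing fixes the value that \<open>frechet_derivative\<close>
  selects, hence the conditions on \<open>y\<close> and \<open>u\<close>.\<close>

lemma pd_eqI:
  assumes "(f has_derivative f') (at y within span B)" "y \<in> span B" "u \<in> span B"
  shows "pd B f u y = f' u"
proof -
  have "f differentiable (at y within span B)" using assms(1) by (auto simp: differentiable_def)
  from has_derivative_along_line[OF pd_works[OF this] assms(2,3)]
    has_derivative_along_line[OF assms] show ?thesis
    by (rule vector_derivative_unique_at)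
qed

lemma has_derivative_opn_cong:
  assumes "opn B S" "y \<in> S" "\<And>z. z \<in> S \<Longrightarrow> f z = g z"
  shows "(f has_derivative f') (at y within span B) \<longleftrightarrow> (g has_derivative f') (at y within span B)"
proof -
  obtain T where T: "open T" "S = span B \<inter> T" using assms(1) by (auto simp: openin_open)
  then obtain e where e: "e > 0" "ball y e \<subseteq> T" using assms(2) openE by blast
  have *: "f z = g z" if "z \<in> span B" "dist z y < e" for z
    using that e T assms(3)[of z] by (auto simp: dist_commute)
  show ?thesis
    using has_derivative_transform_within[of f f' y "span B" e g]
      has_derivative_transform_within[of g f' y "span B" e f] e(1) * opn_span[OF assms(1,2)]
    by metis
qed

lemma pd_cong:
  assumes "opn B S" "y \<in> S" "\<And>z. z \<in> S \<Longrightarrow> f z = g z"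
  shows "pd B f u y = pd B g u y"
  unfolding pd_def frechet_derivative_def using has_derivative_opn_cong[OF assms] by simp

lemma differentiable_cong:
  assumes "opn B S" "y \<in> S" "\<And>z. z \<in> S \<Longrightarrow> f z = g z"
  shows "f differentiable (at y within span B) \<longleftrightarrow> g differentiable (at y within span B)"
  unfolding differentiable_def using has_derivative_opn_cong[OF assms] by simp

lemma pd_linear:
  assumes "f differentiable (at y within span B)"
  shows "linear (\<lambda>u. pd B f u y)"
  by (rule bounded_linear.linear[OF has_derivative_bounded_linear[OF pd_works[OF assms]]])

lemma pd_scale:
  "f differentiable (at y within span B) \<Longrightarrow> pd B f (r *\<^sub>R u) y = r *\<^sub>R pd B f u y"
  using linear_cmul[OF pd_linear] .

lemma pd_add_dir:
  "f differentiable (at y within span B) \<Longrightarrow> pd B f (u + v) y = pd B f u y + pd B f v y"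
  using linear_add[OF pd_linear] .

section \<open>Coordinates in the span of standard basis vectors\<close>

lemma span_expand:
  assumes "B \<subseteq> Basis" "u \<in> span B"
  shows "(\<Sum>b\<in>B. (u \<bullet> b) *\<^sub>R b) = u"
proof -
  have fin: "finite B" by (rule finite_subset[OF assms(1) finite_Basis])
  have "(\<Sum>b\<in>Basis. (u \<bullet> b) *\<^sub>R b) = (\<Sum>b\<in>B. (u \<bullet> b) *\<^sub>R b)"
    using assms by (intro sum.mono_neutral_right) (auto simp: span_substd_basis[OF assms(1)])
  then show ?thesis unfolding euclidean_representation by (rule sym)
qed

lemma span_Basis_iff: "B \<subseteq> Basis \<Longrightarrow> u \<in> span B \<longleftrightarrow> (\<forall>b\<in>Basis. b \<notin> B \<longrightarrow> u \<bullet> b = 0)"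
  by (simp add: span_substd_basis)

lemma span_eqI:
  assumes "B \<subseteq> Basis" "u \<in> span B" "v \<in> span B" "\<And>b. b \<in> B \<Longrightarrow> u \<bullet> b = v \<bullet> b"
  shows "u = v"
  using span_expand[OF assms(1,2)] span_expand[OF assms(1,3)] assms(4) by (metis (no_types, lifting) sum.cong)

lemma inner_sum_Basis:
  assumes "B \<subseteq> Basis" "b \<in> B"
  shows "(\<Sum>c\<in>B. f c *\<^sub>R c) \<bullet> b = f b"
proof -
  have "finite B" by (rule finite_subset[OF assms(1) finite_Basis])
  have "(\<Sum>c\<in>B. f c *\<^sub>R c) \<bullet> b = (\<Sum>c\<in>B. f c * (c \<bullet> b))" by (simp add: inner_sum_left)
  also have "\<dots> = (\<Sum>c\<in>B. if c = b then f c else 0)"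
    using assms by (intro sum.cong) (auto simp: inner_Basis subset_iff)
  also have "\<dots> = f b" using assms(2) \<open>finite B\<close> by simp
  finally show ?thesis .
qed

lemma sum_Basis_in_span: "(\<Sum>c\<in>B. f c *\<^sub>R c) \<in> span B"
  by (intro span_sum span_scale span_base)

lemma inner_span_expand:
  assumes "B \<subseteq> Basis" "u \<in> span B"
  shows "p \<bullet> u = (\<Sum>b\<in>B. (p \<bullet> b) * (u \<bullet> b))"
  by (subst span_expand[OF assms, symmetric]) (simp add: inner_sum_right mult.commute)

lemma pd_expand:
  assumes "f differentiable (at y within span B)" "B \<subseteq> Basis" "u \<in> span B"
  shows "pd B f u y = (\<Sum>b\<in>B. (u \<bullet> b) *\<^sub>R pd B f b y)"
proof -
  interpret linear "\<lambda>u. pd B f u y" using pd_linear[OF assms(1)] .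
  have "pd B f u y = pd B f (\<Sum>b\<in>B. (u \<bullet> b) *\<^sub>R b) y" by (simp add: span_expand[OF assms(2,3)])
  then show ?thesis by (simp add: sum scale)
qed

section \<open>Chain rule, product rule and linear images\<close>

text \<open>The inner map has to send a whole relative neighbourhood into \<open>span C\<close>,
  since \<open>g\<close> is differentiable only within that subspace.\<close>

lemma has_derivative_compose_opn:
  assumes "opn B S" "y \<in> S" "\<And>z. z \<in> S \<Longrightarrow> f z \<in> span C"
    and "(f has_derivative f') (at y within span B)" "(g has_derivative g') (at (f y) within span C)"
  shows "((\<lambda>z. g (f z)) has_derivative (\<lambda>u. g' (f' u))) (at y within span B)"
proof -
  have "(f has_derivative f') (at y within S)" using assms by (simp add: at_within_opn)
  moreover have "(g has_derivative g') (at (f y) within f ` S)"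
    using assms(3,5) by (auto intro: has_derivative_subset)
  ultimately have "(g \<circ> f has_derivative g' \<circ> f') (at y within S)" by (rule diff_chain_within)
  then show ?thesis using assms by (simp add: at_within_opn o_def)
qed

lemma pd_compose:
  assumes "opn B S" "y \<in> S" "\<And>z. z \<in> S \<Longrightarrow> f z \<in> span C"
    and "f differentiable (at y within span B)" "g differentiable (at (f y) within span C)"
    and "u \<in> span B"
  shows "pd B (\<lambda>z. g (f z)) u y = pd C g (pd B f u y) (f y)"
  using pd_eqI[OF has_derivative_compose_opn[OF assms(1-3) pd_works[OF assms(4)] pd_works[OF assms(5)]]]
    opn_span assms by blast

lemma differentiable_compose_opn:
  fixes C :: "'f::euclidean_space set"
  assumes "opn B S" "y \<in> S" "\<And>z. z \<in> S \<Longrightarrow> f z \<in> span C"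
    and "f differentiable (at y within span B)" "g differentiable (at (f y) within span C)"
  shows "(\<lambda>z. g (f z)) differentiable (at y within span B)"
  using has_derivative_compose_opn[OF assms(1-3) pd_works[OF assms(4)] pd_works[OF assms(5)]]
  by (auto simp: differentiable_def)

lemma has_derivative_bilinear_opn:
  assumes "bounded_bilinear h" "f differentiable (at y within span B)" "g differentiable (at y within span B)"
  shows "((\<lambda>z. h (f z) (g z)) has_derivative (\<lambda>u. h (f y) (pd B g u y) + h (pd B f u y) (g y)))
    (at y within span B)"
  using bounded_bilinear.FDERIV[OF assms(1) pd_works[OF assms(2)] pd_works[OF assms(3)]] .

lemma pd_bilinear:
  assumes "bounded_bilinear h" "f differentiable (at y within span B)" "g differentiable (at y within span B)"
    and "y \<in> span B" "u \<in> span B"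
  shows "pd B (\<lambda>z. h (f z) (g z)) u y = h (f y) (pd B g u y) + h (pd B f u y) (g y)"
  by (rule pd_eqI[OF has_derivative_bilinear_opn[OF assms(1-3)] assms(4,5)])

lemmas pd_inner = pd_bilinear[OF bounded_bilinear_inner]

lemma pd_linear_image:
  assumes "bounded_linear h" "f differentiable (at y within span B)" "y \<in> span B" "u \<in> span B"
  shows "pd B (\<lambda>z. h (f z)) u y = h (pd B f u y)"
  by (rule pd_eqI[OF bounded_linear.has_derivative[OF assms(1) pd_works[OF assms(2)]] assms(3,4)])

lemma pd_const: "y \<in> span B \<Longrightarrow> u \<in> span B \<Longrightarrow> pd B (\<lambda>z. c) u y = 0"
  using pd_eqI[OF has_derivative_const] .

text \<open>The coordinates with indices outside \<open>C\<close> vanish identically along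
  \<open>f\<close>, hence so do their derivatives.\<close>

lemma pd_in_span:
  fixes C :: "'f::euclidean_space set"
  assumes "opn B S" "y \<in> S" "\<And>z. z \<in> S \<Longrightarrow> f z \<in> span C" "C \<subseteq> Basis"
    and "f differentiable (at y within span B)" "u \<in> span B"
  shows "pd B f u y \<in> span C"
  unfolding span_Basis_iff[OF assms(4)]
proof (intro ballI impI)
  fix i :: 'f assume i: "i \<in> Basis" "i \<notin> C"
  have y: "y \<in> span B" using assms opn_span by blast
  have "pd B f u y \<bullet> i = pd B (\<lambda>z. f z \<bullet> i) u y"
    using pd_linear_image[OF bounded_linear_inner_left assms(5) y assms(6)] by simp
  also have "\<dots> = pd B (\<lambda>z. 0) u y"
    using assms(3) i by (intro pd_cong[OF assms(1,2)]) (auto simp: span_Basis_iff[OF assms(4)])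
  finally show "pd B f u y \<bullet> i = 0" using pd_const[OF y assms(6)] by simp
qed

lemma pd_bounded_linear:
  assumes "bounded_linear h" "y \<in> span B" "u \<in> span B"
  shows "pd B h u y = h u"
  by (rule pd_eqI[OF bounded_linear_imp_has_derivative[OF assms(1)] assms(2,3)])

lemma pd_add:
  assumes "f differentiable (at y within span B)" "g differentiable (at y within span B)"
    and "y \<in> span B" "u \<in> span B"
  shows "pd B (\<lambda>z. f z + g z) u y = pd B f u y + pd B g u y"
  by (rule pd_eqI[OF has_derivative_add[OF pd_works[OF assms(1)] pd_works[OF assms(2)]] assms(3,4)])

section \<open>Closure properties of smooth functions\<close>

lemma Ck_on_subset: "S' \<subseteq> S \<Longrightarrow> Ck_on k B S f \<Longrightarrow> Ck_on k B S' f"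
  by (induction k arbitrary: f) (auto intro: continuous_on_subset)

lemma Ck_on_cong:
  assumes "opn B S" "\<And>y. y \<in> S \<Longrightarrow> f y = g y"
  shows "Ck_on k B S f \<longleftrightarrow> Ck_on k B S g"
  using assms(2)
proof (induction k arbitrary: f g)
  case 0
  then show ?case by (simp cong: continuous_on_cong)
next
  case (Suc k)
  have "Ck_on k B S (pd B f b) \<longleftrightarrow> Ck_on k B S (pd B g b)" for b
    using Suc.prems pd_cong[OF assms(1)] by (intro Suc.IH) blast
  moreover have "f differentiable (at y within span B) \<longleftrightarrow> g differentiable (at y within span B)"
    if "y \<in> S" for y using differentiable_cong[OF assms(1) that] Suc.prems by blast
  ultimately show ?case by simp
qed

lemma Ck_on_congI:
  "opn B S \<Longrightarrow> Ck_on k B S f \<Longrightarrow> (\<And>y. y \<in> S \<Longrightarrow> f y = g y) \<Longrightarrow> Ck_on k B S g"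
  using Ck_on_cong by blast

text \<open>The base case is that differentiability implies continuity; the higher cases pass to the
  directional derivatives.\<close>

lemma Ck_on_SucD:
  assumes "opn B S"
  shows "Ck_on (Suc k) B S f \<Longrightarrow> Ck_on k B S f"
proof (induction k arbitrary: f)
  case 0
  have "continuous (at y within S) f" if "y \<in> S" for y
    using 0 that differentiable_imp_continuous_within[of f y "span B"]
    by (simp add: at_within_opn[OF assms that])
  then show ?case by (simp add: continuous_on_eq_continuous_within)
next
  case (Suc k)
  then show ?case by (metis Ck_on.simps(2))
qed

lemma Ck_on_local:
  assumes "\<And>y. y \<in> S \<Longrightarrow> \<exists>S'. opn B S' \<and> y \<in> S' \<and> Ck_on k B S' f" "S \<subseteq> span B"
  shows "Ck_on k B S f"
  using assms(1)
proof (induction k arbitrary: f)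
  case 0
  have "continuous (at y within S) f" if "y \<in> S" for y
  proof -
    obtain S' where "opn B S'" "y \<in> S'" "continuous_on S' f" using 0 \<open>y \<in> S\<close> by auto
    then have "continuous (at y within span B) f"
      by (metis at_within_opn continuous_on_eq_continuous_within)
    then show ?thesis using assms(2) continuous_within_subset by blast
  qed
  then show ?case by (simp add: continuous_on_eq_continuous_within)
next
  case (Suc k)
  have "f differentiable (at y within span B)" if "y \<in> S" for y using Suc.prems[OF that] by auto
  moreover have "Ck_on k B S (pd B f b)" if "b \<in> B" for b
    using Suc.prems that by (intro Suc.IH) fastforce
  ultimately show ?case by simp
qed

lemma Ck_on_const:
  assumes "opn B S" "B \<subseteq> Basis"
  shows "Ck_on k B S (\<lambda>y. c)"
proof (induction k arbitrary: c)
  case (Suc k)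
  have "Ck_on k B S (pd B (\<lambda>y. c) b)" if "b \<in> B" for b
    using Suc[of 0] Ck_on_cong[OF assms(1), of "pd B (\<lambda>y. c) b" "\<lambda>y. 0"]
      pd_const opn_span[OF assms(1)] span_base[OF that] by blast
  then show ?case by simp
qed simp

lemma Ck_on_linear_image:
  assumes "opn B S" "bounded_linear h"
  shows "Ck_on k B S f \<Longrightarrow> Ck_on k B S (\<lambda>y. h (f y))"
proof (induction k arbitrary: f)
  case 0
  then show ?case using bounded_linear.continuous_on[OF assms(2)] by auto
next
  case (Suc k)
  have "Ck_on k B S (pd B (\<lambda>y. h (f y)) b)" if "b \<in> B" for b
  proof -
    have "Ck_on k B S (\<lambda>y. h (pd B f b y))" using Suc that by auto
    moreover have "h (pd B f b y) = pd B (\<lambda>y. h (f y)) b y" if "y \<in> S" for y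
      using pd_linear_image[OF assms(2), of f y B b] Suc.prems that opn_span[OF assms(1)]
        span_base[OF \<open>b \<in> B\<close>] by auto
    ultimately show ?thesis by (rule Ck_on_congI[OF assms(1)])
  qed
  moreover have "(\<lambda>y. h (f y)) differentiable (at y within span B)" if "y \<in> S" for y
    by (rule differentiableI[OF bounded_linear.has_derivative[OF assms(2) pd_works]]) (use Suc.prems that in auto)
  ultimately show ?case by simp
qed

lemma Ck_on_add:
  assumes "opn B S"
  shows "Ck_on k B S f \<Longrightarrow> Ck_on k B S g \<Longrightarrow> Ck_on k B S (\<lambda>y. f y + g y)"
proof (induction k arbitrary: f g)
  case 0
  then show ?case by (auto intro: continuous_on_add)
next
  case (Suc k)
  have "Ck_on k B S (pd B (\<lambda>y. f y + g y) b)" if "b \<in> B" for b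
  proof -
    have "Ck_on k B S (\<lambda>y. pd B f b y + pd B g b y)" using Suc that by auto
    moreover have "pd B f b y + pd B g b y = pd B (\<lambda>y. f y + g y) b y" if "y \<in> S" for y
      using pd_add[of f y B g b] Suc.prems that opn_span[OF assms(1)]
        span_base[OF \<open>b \<in> B\<close>] by auto
    ultimately show ?thesis by (rule Ck_on_congI[OF assms(1)])
  qed
  then show ?case using Suc.prems by auto
qed

lemma Ck_on_sum:
  assumes "opn B S" "B \<subseteq> Basis" "\<And>i. i \<in> I \<Longrightarrow> Ck_on k B S (f i)"
  shows "Ck_on k B S (\<lambda>y. \<Sum>i\<in>I. f i y)"
  using assms(3)
  by (induction I rule: infinite_finite_induct)
    (auto intro: Ck_on_const[OF assms(1,2)] Ck_on_add[OF assms(1)])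

lemma Ck_on_bilinear:
  assumes "opn B S" "bounded_bilinear h"
  shows "Ck_on k B S f \<Longrightarrow> Ck_on k B S g \<Longrightarrow> Ck_on k B S (\<lambda>y. h (f y) (g y))"
proof (induction k arbitrary: f g)
  case 0
  then show ?case using bounded_bilinear.continuous_on[OF assms(2)] by auto
next
  case (Suc k)
  have "Ck_on k B S (pd B (\<lambda>y. h (f y) (g y)) b)" if "b \<in> B" for b
  proof -
    \<comment> \<open>The product rule brings back \<open>f\<close> and \<open>g\<close>
      undifferentiated, now at order \<open>k\<close>; this is why their order is lowered by
      \<open>Ck_on_SucD\<close>.\<close>
    have "Ck_on k B S (\<lambda>y. h (f y) (pd B g b y) + h (pd B f b y) (g y))"
      using Suc.prems that Ck_on_SucD[OF assms(1) Suc.prems(1)] Ck_on_SucD[OF assms(1) Suc.prems(2)]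
      by (intro Ck_on_add[OF assms(1)] Suc.IH) auto
    moreover have "h (f y) (pd B g b y) + h (pd B f b y) (g y) = pd B (\<lambda>y. h (f y) (g y)) b y"
      if "y \<in> S" for y
      using pd_bilinear[OF assms(2), of f y B g b] Suc.prems that opn_span[OF assms(1)]
        span_base[OF \<open>b \<in> B\<close>] by auto
    ultimately show ?thesis by (rule Ck_on_congI[OF assms(1)])
  qed
  moreover have "(\<lambda>y. h (f y) (g y)) differentiable (at y within span B)" if "y \<in> S" for y
    by (rule differentiableI[OF has_derivative_bilinear_opn[OF assms(2)]]) (use Suc.prems that in auto)
  ultimately show ?case by simp
qed

section \<open>Smoothness of all orders\<close>

lemma smooth_on_subset: "smooth_on B S f \<Longrightarrow> S' \<subseteq> S \<Longrightarrow> smooth_on B S' f"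
  by (auto simp: smooth_on_def intro: Ck_on_subset)

lemma smooth_on_cong:
  "opn B S \<Longrightarrow> (\<And>y. y \<in> S \<Longrightarrow> f y = g y) \<Longrightarrow> smooth_on B S f \<longleftrightarrow> smooth_on B S g"
  by (simp add: smooth_on_def Ck_on_cong[of B S f g])

lemma smooth_on_congI:
  "opn B S \<Longrightarrow> smooth_on B S f \<Longrightarrow> (\<And>y. y \<in> S \<Longrightarrow> f y = g y) \<Longrightarrow> smooth_on B S g"
  using smooth_on_cong by blast

lemma smooth_on_local:
  assumes "\<And>y. y \<in> S \<Longrightarrow> \<exists>S'. opn B S' \<and> y \<in> S' \<and> smooth_on B S' f" "S \<subseteq> span B"
  shows "smooth_on B S f"
  unfolding smooth_on_def using assms by (auto simp: smooth_on_def intro!: Ck_on_local) blast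

lemma smooth_on_differentiable:
  "smooth_on B S f \<Longrightarrow> y \<in> S \<Longrightarrow> f differentiable (at y within span B)"
  unfolding smooth_on_def by (drule spec[of _ "Suc 0"]) simp

lemma smooth_on_continuous: "smooth_on B S f \<Longrightarrow> continuous_on S f"
  unfolding smooth_on_def by (drule spec[of _ 0]) simp

lemma smooth_on_pd_Basis: "smooth_on B S f \<Longrightarrow> b \<in> B \<Longrightarrow> smooth_on B S (pd B f b)"
  unfolding smooth_on_def by (metis Ck_on.simps(2))

lemma smooth_onI:
  assumes "opn B S" "\<And>y. y \<in> S \<Longrightarrow> f differentiable (at y within span B)"
    and "\<And>b. b \<in> B \<Longrightarrow> smooth_on B S (pd B f b)"
  shows "smooth_on B S f"
  unfolding smooth_on_def
proof
  fix k
  have "Ck_on (Suc k) B S f" using assms by (auto simp: smooth_on_def)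
  then show "Ck_on k B S f" by (rule Ck_on_SucD[OF assms(1)])
qed

lemma smooth_on_const: "opn B S \<Longrightarrow> B \<subseteq> Basis \<Longrightarrow> smooth_on B S (\<lambda>y. c)"
  by (simp add: smooth_on_def Ck_on_const)

lemma smooth_on_linear_image:
  "bounded_linear h \<Longrightarrow> opn B S \<Longrightarrow> smooth_on B S f \<Longrightarrow> smooth_on B S (\<lambda>y. h (f y))"
  by (simp add: smooth_on_def Ck_on_linear_image)

lemma smooth_on_linear:
  assumes "bounded_linear h" "opn B S" "B \<subseteq> Basis"
  shows "smooth_on B S h"
proof (rule smooth_onI[OF assms(2)])
  show "h differentiable (at y within span B)" for y
    using assms(1) bounded_linear_imp_differentiable by blast
  show "smooth_on B S (pd B h b)" if "b \<in> B" for b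
    using pd_bounded_linear[OF assms(1)] opn_span[OF assms(2)] span_base[OF that]
    by (intro smooth_on_congI[OF assms(2) smooth_on_const[OF assms(2,3), of "h b"]]) auto
qed

lemma smooth_on_ident: "opn B S \<Longrightarrow> B \<subseteq> Basis \<Longrightarrow> smooth_on B S (\<lambda>y. y)"
  by (rule smooth_on_linear[OF bounded_linear_ident])

lemma smooth_on_add:
  "opn B S \<Longrightarrow> smooth_on B S f \<Longrightarrow> smooth_on B S g \<Longrightarrow> smooth_on B S (\<lambda>y. f y + g y)"
  by (simp add: smooth_on_def Ck_on_add)

lemma smooth_on_bilinear:
  "bounded_bilinear h \<Longrightarrow> opn B S \<Longrightarrow> smooth_on B S f \<Longrightarrow> smooth_on B S g \<Longrightarrow> smooth_on B S (\<lambda>y. h (f y) (g y))"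
  by (simp add: smooth_on_def Ck_on_bilinear)

lemmas smooth_on_scaleR = smooth_on_bilinear[OF bounded_bilinear_scaleR]
lemmas smooth_on_inner = smooth_on_bilinear[OF bounded_bilinear_inner]
lemmas smooth_on_fst = smooth_on_linear_image[OF bounded_linear_fst]
lemmas smooth_on_snd = smooth_on_linear_image[OF bounded_linear_snd]
lemmas smooth_on_minus = smooth_on_linear_image[OF bounded_linear_minus[OF bounded_linear_ident]]

lemma smooth_on_diff:
  fixes f g :: "_ \<Rightarrow> _::real_normed_vector"
  shows "opn B S \<Longrightarrow> smooth_on B S f \<Longrightarrow> smooth_on B S g \<Longrightarrow> smooth_on B S (\<lambda>y. f y - g y)"
  using smooth_on_add[of B S f "\<lambda>y. - g y"] smooth_on_minus[of B S g] by simp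

lemma bounded_linear_Pair_0: "bounded_linear (\<lambda>x. (x, 0))" "bounded_linear (\<lambda>x. (0, x))"
  by (auto intro!: bounded_linear_Pair bounded_linear_ident bounded_linear_zero)

lemma smooth_on_Pair:
  assumes "opn B S" "smooth_on B S f" "smooth_on B S g"
  shows "smooth_on B S (\<lambda>y. (f y, g y))"
  using smooth_on_add[OF assms(1) smooth_on_linear_image[OF bounded_linear_Pair_0(1) assms(1,2)]
      smooth_on_linear_image[OF bounded_linear_Pair_0(2) assms(1,3)]]
  by simp

lemma smooth_on_sum:
  assumes "opn B S" "B \<subseteq> Basis" "\<And>i. i \<in> I \<Longrightarrow> smooth_on B S (f i)"
  shows "smooth_on B S (\<lambda>y. \<Sum>i\<in>I. f i y)"
  using assms(3) unfolding smooth_on_def by (intro allI Ck_on_sum[OF assms(1,2)]) blast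

text \<open>Induction on the order with \<open>g\<close> arbitrary and \<open>f\<close> fixed. The
  chain rule writes a derivative of the composition as a finite sum of coordinates of
  \<open>pd B f b\<close> times \<open>pd C g c\<close> composed with \<open>f\<close>, and the
  induction hypothesis applies to the latter factor.\<close>

lemma smooth_on_compose:
  assumes B: "B \<subseteq> Basis" and C: "C \<subseteq> Basis" and S: "opn B S" and T: "T \<subseteq> span C"
    and g: "smooth_on C T g" and f: "smooth_on B S f" and fST: "\<And>y. y \<in> S \<Longrightarrow> f y \<in> T"
  shows "smooth_on B S (\<lambda>y. g (f y))"
proof -
  have fC: "\<And>y. y \<in> S \<Longrightarrow> f y \<in> span C" using fST T by blast
  have "Ck_on k B S (\<lambda>y. g (f y))" for k
    using g
  proof (induction k arbitrary: g)
    case 0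
    then show ?case using smooth_on_continuous[OF 0] smooth_on_continuous[OF f] fST
      by (auto intro!: continuous_on_compose2[of T g S f])
  next
    case (Suc k)
    have d: "g differentiable (at (f y) within span C)" "f differentiable (at y within span B)"
      if "y \<in> S" for y using smooth_on_differentiable Suc.prems f fST that by blast+
    have "Ck_on k B S (pd B (\<lambda>y. g (f y)) b)" if b: "b \<in> B" for b
    proof -
      have "Ck_on k B S (\<lambda>y. (pd B f b y \<bullet> c) *\<^sub>R pd C g c (f y))" if "c \<in> C" for c
      proof (rule Ck_on_bilinear[OF S bounded_bilinear_scaleR])
        show "Ck_on k B S (\<lambda>y. pd B f b y \<bullet> c)"
          using smooth_on_pd_Basis[OF f b] unfolding smooth_on_def
          by (auto intro!: Ck_on_linear_image[OF S bounded_linear_inner_left])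
        show "Ck_on k B S (\<lambda>y. pd C g c (f y))"
          by (rule Suc.IH) (rule smooth_on_pd_Basis[OF Suc.prems that])
      qed
      then have "Ck_on k B S (\<lambda>y. \<Sum>c\<in>C. (pd B f b y \<bullet> c) *\<^sub>R pd C g c (f y))"
        by (rule Ck_on_sum[OF S B])
      moreover have "(\<Sum>c\<in>C. (pd B f b y \<bullet> c) *\<^sub>R pd C g c (f y)) = pd B (\<lambda>y. g (f y)) b y"
        if y: "y \<in> S" for y
        using pd_compose[OF S y fC d(2)[OF y] d(1)[OF y] span_base[OF b]]
          pd_expand[OF d(1)[OF y] C pd_in_span[OF S y fC C d(2)[OF y] span_base[OF b]]] by simp
      ultimately show ?thesis by (rule Ck_on_congI[OF S])
    qed
    then show ?case using differentiable_compose_opn[OF S _ fC d(2) d(1)] by simp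
  qed
  then show ?thesis by (simp add: smooth_on_def)
qed

lemma smooth_on_pd_along:
  assumes "opn B S" "B \<subseteq> Basis" "smooth_on B S f" "smooth_on B S u" "\<And>y. y \<in> S \<Longrightarrow> u y \<in> span B"
  shows "smooth_on B S (\<lambda>y. pd B f (u y) y)"
proof -
  have "smooth_on B S (\<lambda>y. \<Sum>b\<in>B. (u y \<bullet> b) *\<^sub>R pd B f b y)"
    using assms by (intro smooth_on_sum smooth_on_scaleR smooth_on_linear_image[OF bounded_linear_inner_left]
        smooth_on_pd_Basis) auto
  then show ?thesis
    by (rule smooth_on_congI[OF assms(1)])
      (simp add: pd_expand[OF smooth_on_differentiable[OF assms(3)] assms(2,5)])
qed

lemma smooth_on_pd:
  assumes "opn B S" "B \<subseteq> Basis" "smooth_on B S f" "u \<in> span B"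
  shows "smooth_on B S (pd B f u)"
  using smooth_on_pd_along[OF assms(1-3) smooth_on_const[OF assms(1,2)]] assms(4) .

lemma openin_preimage_smooth:
  assumes "opn B S" "smooth_on B S f" "\<And>y. y \<in> S \<Longrightarrow> f y \<in> span C" "opn C T"
  shows "opn B {y \<in> S. f y \<in> T}"
proof -
  have "openin (top_of_set S) (S \<inter> f -` T)"
    using assms smooth_on_continuous by (intro continuous_openin_preimage[of S f "span C"]) auto
  then have "opn B (S \<inter> f -` T)" using assms(1) openin_trans by blast
  then show ?thesis by (simp add: vimage_def Int_def)
qed

section \<open>Symmetry of second derivatives\<close>

lemma pd_mean_value:
  fixes f :: "'e::euclidean_space \<Rightarrow> real"
  assumes "\<And>t. t \<in> {0..1} \<Longrightarrow> y + t *\<^sub>R u \<in> S" "opn B S" "smooth_on B S f" "u \<in> span B"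
  shows "\<exists>t\<in>{0<..<1}. f (y + u) - f y = pd B f u (y + t *\<^sub>R u)"
proof -
  have "\<exists>t\<in>{0<..<1}. f (y + 1 *\<^sub>R u) - f (y + 0 *\<^sub>R u) = (\<lambda>h. h * pd B f u (y + t *\<^sub>R u)) (1 - 0)"
  proof (rule mvt_simple)
    fix t :: real assume t: "0 \<le> t" "t \<le> 1"
    let ?z = "y + t *\<^sub>R u"
    have z: "?z \<in> S" using assms(1) t by simp
    have "((\<lambda>r. f (?z + r *\<^sub>R u)) has_vector_derivative pd B f u ?z) (at 0)"
      using has_derivative_along_line[OF pd_works[OF smooth_on_differentiable[OF assms(3) z]]
          opn_span[OF assms(2) z] assms(4)] .
    then have "((\<lambda>r. f (y + (t + r) *\<^sub>R u)) has_vector_derivative pd B f u ?z) (at 0)"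
      by (simp add: scaleR_add_left add.assoc)
    \<comment> \<open>The parameter is shifted from 0 at \<open>?z\<close> to \<open>t\<close> at
      \<open>y\<close>, the form that the one-variable mean value theorem asks for.\<close>
    then have "((\<lambda>r. f (y + r *\<^sub>R u)) has_real_derivative pd B f u ?z) (at t)"
      using DERIV_shift[of "\<lambda>r. f (y + r *\<^sub>R u)" _ 0 t]
      by (simp add: has_real_derivative_iff_has_vector_derivative[symmetric] add.commute)
    moreover have "(*) (pd B f u ?z) = (\<lambda>h. h * pd B f u ?z)" by (simp add: fun_eq_iff)
    ultimately show "((\<lambda>r. f (y + r *\<^sub>R u)) has_derivative (\<lambda>h. h * pd B f u ?z)) (at t within {0..1})"
      by (simp add: has_field_derivative_def has_derivative_at_withinI)
  qed simp
  then show ?thesis by simp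
qed

text \<open>Schwarz's argument with the second difference \<open>D\<close> of \<open>f\<close> over
  a small parallelogram with sides \<open>s *\<^sub>R u\<close> and \<open>s *\<^sub>R v\<close>.
  Two mean value steps make \<open>D\<close> equal to \<open>s * s\<close> times a mixed derivative
  at some point of the parallelogram, and this in either order of differentiation. If the two mixed
  derivatives differed at \<open>y\<close>, continuity would keep them apart nearby.\<close>

lemma pd_symmetric_real:
  fixes f :: "'e::euclidean_space \<Rightarrow> real"
  assumes S: "opn B S" and B: "B \<subseteq> Basis" and f: "smooth_on B S f" and y: "y \<in> S"
    and u: "u \<in> span B" and v: "v \<in> span B"
  shows "pd B (pd B f u) v y = pd B (pd B f v) u y"
proof (rule ccontr)
  define A where "A = pd B (pd B f u) v"
  define A' where "A' = pd B (pd B f v) u"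
  assume "\<not> ?thesis"
  then have ne: "A y \<noteq> A' y" by (simp add: A_def A'_def)
  \<comment> \<open>Half of the gap: a number cannot be closer than \<open>e\<close> to both
    \<open>A y\<close> and \<open>A' y\<close>.\<close>
  define e where "e = \<bar>A y - A' y\<bar> / 2"
  have e: "e > 0" using ne by (simp add: e_def)
  have sm: "smooth_on B S (pd B f u)" "smooth_on B S (pd B f v)" "smooth_on B S A" "smooth_on B S A'"
    using smooth_on_pd[OF S B] f u v by (auto simp: A_def A'_def)
  have ySpan: "y \<in> span B" using opn_span[OF S y] .
  obtain T where T: "open T" "S = span B \<inter> T" using S by (auto simp: openin_open)
  obtain d0 where d0: "d0 > 0" "ball y d0 \<subseteq> T" using T y openE by blast
  obtain d1 where d1: "d1 > 0" "\<And>z. z \<in> S \<Longrightarrow> dist z y < d1 \<Longrightarrow> dist (A z) (A y) < e"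
    using smooth_on_continuous[OF sm(3)] y e unfolding continuous_on_iff by metis
  obtain d2 where d2: "d2 > 0" "\<And>z. z \<in> S \<Longrightarrow> dist z y < d2 \<Longrightarrow> dist (A' z) (A' y) < e"
    using smooth_on_continuous[OF sm(4)] y e unfolding continuous_on_iff by metis
  define d where "d = min d0 (min d1 d2)"
  have d: "d > 0" using d0 d1 d2 by (simp add: d_def)
  \<comment> \<open>The summand 1 keeps the denominator positive when \<open>u\<close> and
    \<open>v\<close> vanish; the factor 2 makes the bound \<open>sd\<close> strict.\<close>
  define s where "s = d / (2 * (norm u + norm v + 1))"
  have s: "s > 0" using d by (simp add: s_def add_nonneg_pos)
  have sd: "s * (norm u + norm v) < d"
  proof -
    have "s * (norm u + norm v) \<le> s * (norm u + norm v + 1)" using s by simp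
    also have "\<dots> = d / 2"
      using add_nonneg_pos[of "norm u + norm v" 1] by (simp add: s_def field_simps)
    finally show ?thesis using d by simp
  qed
  define p where "p a b = y + (a * s) *\<^sub>R u + (b * s) *\<^sub>R v" for a b
  have p: "p a b \<in> S \<and> dist (p a b) y < d" if "a \<in> {0..1}" "b \<in> {0..1}" for a b
  proof -
    have "dist (p a b) y \<le> norm ((a * s) *\<^sub>R u) + norm ((b * s) *\<^sub>R v)"
      by (simp add: p_def dist_norm norm_triangle_ineq del: norm_scaleR)
    also have "\<dots> \<le> s * norm u + s * norm v"
      using that s by (auto simp: abs_mult intro!: add_mono mult_right_mono)
    also have "\<dots> < d" using sd by (simp add: algebra_simps)
    finally have *: "dist (p a b) y < d" .
    moreover have "p a b \<in> span B" using ySpan u v by (simp add: p_def span_add span_scale)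
    moreover have "p a b \<in> T" using * d0 by (auto simp: d_def dist_commute)
    ultimately show ?thesis using T by simp
  qed
  \<comment> \<open>Stated for an arbitrary pair of sides, because it is applied to
    \<open>u, v\<close> and then to \<open>v, u\<close>.\<close>
  have mv: "\<exists>a\<in>{0<..<1}. \<exists>b\<in>{0<..<1}. D = s * s * pd B (pd B f w) w' (y + (a * s) *\<^sub>R w + (b * s) *\<^sub>R w')"
    if "D = f (y + s *\<^sub>R w + s *\<^sub>R w') - f (y + s *\<^sub>R w) - (f (y + s *\<^sub>R w') - f y)"
      and q: "\<And>a b. a \<in> {0..1} \<Longrightarrow> b \<in> {0..1} \<Longrightarrow> y + (a * s) *\<^sub>R w + (b * s) *\<^sub>R w' \<in> S"
      and w: "w \<in> span B" "w' \<in> span B" for D w w'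
  proof -
    \<comment> \<open>Here both \<open>f\<close> and its translate by \<open>s *\<^sub>R w'\<close>
      are available; the first mean value step is applied to their difference, the second to
      \<open>pd B f w\<close>.\<close>
    define S2 where "S2 = {z \<in> S. z + s *\<^sub>R w' \<in> S}"
    have aff: "smooth_on B S (\<lambda>z. z + s *\<^sub>R w')"
      by (intro smooth_on_add smooth_on_ident smooth_on_const S B)
    have S2: "opn B S2"
      unfolding S2_def
      by (rule openin_preimage_smooth[OF S aff _ S]) (use w opn_span[OF S] in \<open>auto intro!: span_add span_scale\<close>)
    have f1: "smooth_on B S2 f" by (rule smooth_on_subset[OF f]) (auto simp: S2_def)
    have aff2: "smooth_on B S2 (\<lambda>z. z + s *\<^sub>R w')" by (rule smooth_on_subset[OF aff]) (auto simp: S2_def)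
    have f2: "smooth_on B S2 (\<lambda>z. f (z + s *\<^sub>R w'))"
      by (rule smooth_on_compose[OF B B S2 _ f]) (use openin_imp_subset[OF S] aff2 in \<open>auto simp: S2_def\<close>)
    have S2I: "y + t *\<^sub>R (s *\<^sub>R w) \<in> S2" if "t \<in> {0..1}" for t
      using q[OF that, of 0] q[OF that, of 1] by (simp add: S2_def)
    obtain a where a: "a \<in> {0<..<1}"
      "(f (y + s *\<^sub>R w + s *\<^sub>R w') - f (y + s *\<^sub>R w)) - (f (y + s *\<^sub>R w') - f y)
        = pd B (\<lambda>z. f (z + s *\<^sub>R w') - f z) (s *\<^sub>R w) (y + a *\<^sub>R (s *\<^sub>R w))"
      using pd_mean_value[OF S2I S2 smooth_on_diff[OF S2 f2 f1] span_scale[OF w(1)]] by auto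
    define z where "z = y + (a * s) *\<^sub>R w"
    have z: "z \<in> S2" using S2I[of a] a by (simp add: z_def)
    have zS: "z \<in> S" "z + s *\<^sub>R w' \<in> S" using z by (auto simp: S2_def)
    have "pd B (\<lambda>z. f (z + s *\<^sub>R w') - f z) (s *\<^sub>R w) z
        = pd B f (s *\<^sub>R w) (z + s *\<^sub>R w') - pd B f (s *\<^sub>R w) z"
    proof (rule pd_eqI)
      have "((\<lambda>z. f (z + s *\<^sub>R w')) has_derivative (\<lambda>u. pd B f u (z + s *\<^sub>R w'))) (at z within span B)"
        by (rule has_derivative_compose_opn[where S = S2 and f' = "\<lambda>u. u" and C = B])
          (use S2 z zS w smooth_on_differentiable[OF f] opn_span[OF S]
            in \<open>auto simp: S2_def intro!: pd_works derivative_eq_intros span_add span_scale\<close>)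
      then show "((\<lambda>z. f (z + s *\<^sub>R w') - f z) has_derivative
          (\<lambda>u. pd B f u (z + s *\<^sub>R w') - pd B f u z)) (at z within span B)"
        using zS smooth_on_differentiable[OF f] by (intro has_derivative_diff pd_works) auto
    qed (use zS opn_span[OF S] w in \<open>auto intro: span_scale\<close>)
    also have "\<dots> = s * (pd B f w (z + s *\<^sub>R w') - pd B f w z)"
      using pd_scale[OF smooth_on_differentiable[OF f]] zS by (simp add: right_diff_distrib)
    finally have D: "D = s * (pd B f w (z + s *\<^sub>R w') - pd B f w z)"
      using a that(1) by (simp add: z_def)
    have "\<exists>b\<in>{0<..<1}. pd B f w (z + s *\<^sub>R w') - pd B f w z = pd B (pd B f w) (s *\<^sub>R w') (z + b *\<^sub>R (s *\<^sub>R w'))"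
      by (rule pd_mean_value[OF _ S smooth_on_pd[OF S B f]])
        (use q[of a] a w in \<open>auto simp: z_def intro: span_scale\<close>)
    then obtain b where b: "b \<in> {0<..<1}"
      "pd B f w (z + s *\<^sub>R w') - pd B f w z = pd B (pd B f w) (s *\<^sub>R w') (z + b *\<^sub>R (s *\<^sub>R w'))" by blast
    have "z + (b * s) *\<^sub>R w' \<in> S" using q[of a b] a b by (simp add: z_def)
    then have "pd B (pd B f w) (s *\<^sub>R w') (z + (b * s) *\<^sub>R w') = s * pd B (pd B f w) w' (z + (b * s) *\<^sub>R w')"
      using pd_scale[OF smooth_on_differentiable[OF smooth_on_pd[OF S B f w(1)]]] by simp
    then have "D = s * s * pd B (pd B f w) w' (y + (a * s) *\<^sub>R w + (b * s) *\<^sub>R w')"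
      using D b(2) by (simp add: z_def)
    then show ?thesis using a(1) b(1) by blast
  qed
  define D where "D = f (y + s *\<^sub>R u + s *\<^sub>R v) - f (y + s *\<^sub>R u) - (f (y + s *\<^sub>R v) - f y)"
  obtain a b where ab: "a \<in> {0<..<1}" "b \<in> {0<..<1}" "D = s * s * A (p a b)"
    using mv[OF D_def _ u v] p by (auto simp: p_def A_def)
  \<comment> \<open>The second difference is symmetric in its two sides, so the same number is
    reached in the other order.\<close>
  have "D = f (y + s *\<^sub>R v + s *\<^sub>R u) - f (y + s *\<^sub>R v) - (f (y + s *\<^sub>R u) - f y)"
    by (simp add: D_def algebra_simps)
  moreover have "y + (b * s) *\<^sub>R v + (a * s) *\<^sub>R u \<in> S" if "b \<in> {0..1}" "a \<in> {0..1}" for a b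
    using p[OF that(2,1)] by (simp add: p_def algebra_simps)
  ultimately obtain a' b' where ab': "a' \<in> {0<..<1}" "b' \<in> {0<..<1}" "D = s * s * A' (p a' b')"
    using mv[of D v u] u v by (fastforce simp: p_def A'_def add_ac)
  have "A (p a b) = A' (p a' b')" using ab(3) ab'(3) s by simp
  moreover have "dist (A (p a b)) (A y) < e"
    using p[of a b] ab d1 by (auto simp: d_def)
  moreover have "dist (A' (p a' b')) (A' y) < e"
    using p[of a' b'] ab' d2 by (auto simp: d_def)
  ultimately show False by (auto simp: e_def dist_real_def abs_if split: if_splits)
qed

lemma pd_symmetric:
  fixes f :: "'e::euclidean_space \<Rightarrow> 'f::euclidean_space"
  assumes S: "opn B S" and B: "B \<subseteq> Basis" and f: "smooth_on B S f" and y: "y \<in> S"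
    and u: "u \<in> span B" and v: "v \<in> span B"
  shows "pd B (pd B f u) v y = pd B (pd B f v) u y"
proof (rule euclidean_eqI)
  fix i :: 'f
  have inner: "pd B g w z \<bullet> i = pd B (\<lambda>y. g y \<bullet> i) w z" if "smooth_on B S g" "z \<in> S" "w \<in> span B" for g w z
    using pd_linear_image[OF bounded_linear_inner_left smooth_on_differentiable[OF that(1,2)]
        opn_span[OF S that(2)] that(3)] by simp
  have *: "pd B (pd B f w) w' y \<bullet> i = pd B (pd B (\<lambda>y. f y \<bullet> i) w) w' y" if "w \<in> span B" "w' \<in> span B" for w w'
    using inner[OF smooth_on_pd[OF S B f that(1)] y that(2)] inner[OF f _ that(1)]
    by (auto intro: pd_cong[OF S y])
  show "pd B (pd B f u) v y \<bullet> i = pd B (pd B f v) u y \<bullet> i"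
    using *[OF u v] *[OF v u] pd_symmetric_real[OF S B smooth_on_linear_image[OF bounded_linear_inner_left S f] y u v]
    by simp
qed

section \<open>Charts and smooth maps\<close>

abbreviation satlas :: "('a, 'e::euclidean_space) mfd \<Rightarrow> bool" where
  "satlas M \<equiv> smooth_atlas (model M) (atlas M)"

lemma satlas_Basis: "satlas M \<Longrightarrow> model M \<subseteq> Basis"
  by (simp add: smooth_atlas_def)

lemma local_rep_apply: "inj_on (snd c) (fst c) \<Longrightarrow> x \<in> fst c \<Longrightarrow> local_rep c d f (snd c x) = snd d (f x)"
  by (simp add: local_rep_def)

lemma is_chart_inj: "is_chart B c \<Longrightarrow> inj_on (snd c) (fst c)"
  by (simp add: is_chart_def)

lemma charts_inj: "c \<in> charts M \<Longrightarrow> inj_on (snd c) (fst c)"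
  by (simp add: charts_def is_chart_def)

lemma charts_opn: "c \<in> charts M \<Longrightarrow> opn (model M) (snd c ` fst c)"
  by (simp add: charts_def is_chart_def)

lemma charts_carrier: "c \<in> charts M \<Longrightarrow> fst c \<subseteq> carrier M"
  by (simp add: charts_def)

lemma charts_span: "c \<in> charts M \<Longrightarrow> x \<in> fst c \<Longrightarrow> snd c x \<in> span (model M)"
  using opn_span[OF charts_opn] by blast

lemma charts_local_rep:
  "c \<in> charts M \<Longrightarrow> x \<in> fst c \<Longrightarrow> local_rep c d f (snd c x) = snd d (f x)"
  by (rule local_rep_apply[OF charts_inj])

lemma compatible_sym: "compatible B c d \<Longrightarrow> compatible B d c"
  by (simp add: compatible_def Int_commute)

text \<open>The image under \<open>d\<close> is the preimage of an open set under the transition map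
  from \<open>d\<close> back to \<open>c\<close>, which is continuous.\<close>

lemma opn_transfer:
  assumes "inj_on (snd c) (fst c)" "inj_on (snd d) (fst d)" "compatible B c d"
    and "opn B (snd c ` (fst c \<inter> W))"
  shows "opn B (snd d ` (fst d \<inter> fst c \<inter> W))"
proof -
  have cd: "opn B (snd c ` (fst c \<inter> fst d))" "opn B (snd d ` (fst c \<inter> fst d))"
      "smooth_on B (snd d ` (fst c \<inter> fst d)) (local_rep d c id)"
    using assms(3) by (auto simp: compatible_def)
  have "opn B {y \<in> snd d ` (fst c \<inter> fst d). local_rep d c id y \<in> snd c ` (fst c \<inter> W)}"
    by (rule openin_preimage_smooth[OF cd(2,3) _ assms(4)])
      (use openin_imp_subset[OF cd(1)] in \<open>auto simp: local_rep_apply[OF assms(2)]\<close>)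
  also have "{y \<in> snd d ` (fst c \<inter> fst d). local_rep d c id y \<in> snd c ` (fst c \<inter> W)} = snd d ` (fst d \<inter> fst c \<inter> W)"
    by (auto simp: local_rep_apply[OF assms(2)] inj_on_eq_iff[OF assms(1)])
  finally show ?thesis .
qed

text \<open>On the triple overlap the transition from \<open>c\<close> to \<open>d\<close> factors
  through \<open>e\<close>. Compatibility is transitive only in this restricted sense.\<close>

lemma smooth_compatible_comp:
  assumes "B \<subseteq> Basis" "is_chart B c" "is_chart B d" "is_chart B e" "compatible B c e" "compatible B e d"
  shows "smooth_on B (snd c ` (fst c \<inter> fst e \<inter> fst d)) (local_rep c d id)"
    and "opn B (snd c ` (fst c \<inter> fst e \<inter> fst d))"
proof -
  note inj = is_chart_inj[OF assms(2)] is_chart_inj[OF assms(3)] is_chart_inj[OF assms(4)]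
  show O: "opn B (snd c ` (fst c \<inter> fst e \<inter> fst d))"
    by (rule opn_transfer[OF inj(3,1) compatible_sym[OF assms(5)]]) (use assms(6) in \<open>simp add: compatible_def\<close>)
  have "smooth_on B (snd c ` (fst c \<inter> fst e \<inter> fst d)) (\<lambda>y. local_rep e d id (local_rep c e id y))"
  proof (rule smooth_on_compose[OF assms(1,1) O, where g = "local_rep e d id" and T = "snd e ` (fst e \<inter> fst d)"])
    show "smooth_on B (snd e ` (fst e \<inter> fst d)) (local_rep e d id)" "snd e ` (fst e \<inter> fst d) \<subseteq> span B"
      using assms(6) openin_imp_subset unfolding compatible_def by blast+
    show "smooth_on B (snd c ` (fst c \<inter> fst e \<inter> fst d)) (local_rep c e id)"
      by (rule smooth_on_subset[of _ "snd c ` (fst c \<inter> fst e)"]) (use assms(5) in \<open>auto simp: compatible_def\<close>)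
  qed (auto simp: local_rep_apply[OF inj(1)])
  then show "smooth_on B (snd c ` (fst c \<inter> fst e \<inter> fst d)) (local_rep c d id)"
    by (rule smooth_on_congI[OF O]) (auto simp: local_rep_apply[OF inj(1)] local_rep_apply[OF inj(3)])
qed

text \<open>Members of the maximal atlas are compatible with atlas charts by definition. Near each
  point of the overlap an atlas chart mediates between \<open>c\<close> and \<open>d\<close>, and
  openness and smoothness are local.\<close>

lemma charts_compatible:
  assumes M: "satlas M" and c: "c \<in> charts M" and d: "d \<in> charts M"
  shows "compatible (model M) c d"
proof -
  have *: "opn (model M) (snd c ` (fst c \<inter> fst d)) \<and>
     smooth_on (model M) (snd c ` (fst c \<inter> fst d)) (local_rep c d id)"
    if c: "c \<in> charts M" and d: "d \<in> charts M" for c d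
  proof -
    have ex: "\<exists>U. opn (model M) U \<and> snd c x \<in> U \<and> U \<subseteq> snd c ` (fst c \<inter> fst d) \<and>
        smooth_on (model M) U (local_rep c d id)" if x: "x \<in> fst c" "x \<in> fst d" for x
    proof -
      obtain e where e: "e \<in> atlas M" "x \<in> fst e"
        using charts_carrier[OF c] x unfolding carrier_def by blast
      have "is_chart (model M) e" using M e by (simp add: smooth_atlas_def)
      moreover have "is_chart (model M) c" "is_chart (model M) d" "compatible (model M) c e" "compatible (model M) e d"
        using c d e compatible_sym unfolding charts_def by blast+
      ultimately have "smooth_on (model M) (snd c ` (fst c \<inter> fst e \<inter> fst d)) (local_rep c d id)"
          "opn (model M) (snd c ` (fst c \<inter> fst e \<inter> fst d))"
        using smooth_compatible_comp[OF satlas_Basis[OF M], of c d e] by auto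
      then show ?thesis using that e by (intro exI[of _ "snd c ` (fst c \<inter> fst e \<inter> fst d)"]) auto
    qed
    have "opn (model M) (snd c ` (fst c \<inter> fst d))"
      by (subst openin_subopen) (use ex in blast)
    moreover have "smooth_on (model M) (snd c ` (fst c \<inter> fst d)) (local_rep c d id)"
      by (rule smooth_on_local) (use ex openin_imp_subset[OF calculation] in blast)+
    ultimately show ?thesis ..
  qed
  show ?thesis using *[OF c d] *[OF d c] by (simp add: compatible_def Int_commute)
qed

lemma atlas_charts: "satlas M \<Longrightarrow> c \<in> atlas M \<Longrightarrow> c \<in> charts M"
  by (auto simp: charts_def smooth_atlas_def carrier_def)

lemma charts_at_charts: "c \<in> charts_at M x \<longleftrightarrow> c \<in> charts M \<and> x \<in> fst c"
  by (simp add: charts_at_def)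

lemma carrier_charts_at: "satlas M \<Longrightarrow> x \<in> carrier M \<longleftrightarrow> (\<exists>c. c \<in> charts_at M x)"
  using atlas_charts charts_carrier unfolding carrier_def charts_at_charts by fastforce

lemma some_chart: "satlas M \<Longrightarrow> x \<in> carrier M \<Longrightarrow> (SOME c. c \<in> charts_at M x) \<in> charts_at M x"
  by (rule someI_ex) (simp add: carrier_charts_at)

section \<open>The topology of a manifold\<close>

text \<open>What has to be checked is that the predicate in \<open>mtop\<close> is a topology.
  Binary intersections need injectivity of the charts, as images do not commute with intersections
  in general.\<close>

lemma openin_mtop:
  assumes "satlas M"
  shows "openin (mtop M) W \<longleftrightarrow> W \<subseteq> carrier M \<and> (\<forall>c\<in>atlas M. opn (model M) (snd c ` (fst c \<inter> W)))"
proof -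
  have inj: "inj_on (snd c) (fst c)" if "c \<in> atlas M" for c
    using charts_inj atlas_charts assms that by blast
  have "istopology (\<lambda>W. W \<subseteq> carrier M \<and> (\<forall>c\<in>atlas M. opn (model M) (snd c ` (fst c \<inter> W))))"
    unfolding istopology_def
  proof (intro conjI allI impI ballI)
    fix S T c
    assume *: "S \<subseteq> carrier M \<and> (\<forall>c\<in>atlas M. opn (model M) (snd c ` (fst c \<inter> S)))"
      "T \<subseteq> carrier M \<and> (\<forall>c\<in>atlas M. opn (model M) (snd c ` (fst c \<inter> T)))"
    then show "S \<inter> T \<subseteq> carrier M" by blast
    assume c: "c \<in> atlas M"
    have "snd c ` (fst c \<inter> (S \<inter> T)) = snd c ` (fst c \<inter> S) \<inter> snd c ` (fst c \<inter> T)"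
      using inj[OF c] by (auto simp: inj_on_def)
    then show "opn (model M) (snd c ` (fst c \<inter> (S \<inter> T)))" using * c by auto
  next
    fix K c
    assume *: "\<forall>S\<in>K. S \<subseteq> carrier M \<and> (\<forall>c\<in>atlas M. opn (model M) (snd c ` (fst c \<inter> S)))"
    then show "\<Union>K \<subseteq> carrier M" by blast
    assume c: "c \<in> atlas M"
    have "snd c ` (fst c \<inter> \<Union>K) = (\<Union>S\<in>K. snd c ` (fst c \<inter> S))" by blast
    then show "opn (model M) (snd c ` (fst c \<inter> \<Union>K))" using * c by auto
  qed
  then show ?thesis by (simp add: mtop_def)
qed

lemma openin_mtop_carrier: "satlas M \<Longrightarrow> openin (mtop M) W \<Longrightarrow> W \<subseteq> carrier M"
  by (simp add: openin_mtop)

lemma openin_mtopI: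
  assumes M: "satlas M"
    and ex: "\<And>x. x \<in> W \<Longrightarrow> \<exists>c\<in>charts M. \<exists>G\<subseteq>W. x \<in> G \<and> G \<subseteq> fst c \<and> opn (model M) (snd c ` G)"
  shows "openin (mtop M) W"
  unfolding openin_mtop[OF M]
proof (intro conjI ballI)
  show "W \<subseteq> carrier M" using ex charts_carrier by blast
  fix d assume d: "d \<in> atlas M"
  have "\<exists>T. opn (model M) T \<and> y \<in> T \<and> T \<subseteq> snd d ` (fst d \<inter> W)" if "y \<in> snd d ` (fst d \<inter> W)" for y
  proof -
    obtain x where x: "x \<in> fst d" "x \<in> W" "y = snd d x" using \<open>y \<in> _\<close> by blast
    obtain c G where c: "c \<in> charts M" "G \<subseteq> W" "x \<in> G" "G \<subseteq> fst c" "opn (model M) (snd c ` G)" using ex x by blast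
    have G: "fst c \<inter> G = G" using c by blast
    have d': "d \<in> charts M" using atlas_charts[OF M d] .
    have "opn (model M) (snd d ` (fst d \<inter> fst c \<inter> G))"
      by (rule opn_transfer[OF charts_inj[OF c(1)] charts_inj[OF d'] charts_compatible[OF M c(1) d']])
        (simp add: G c)
    then show ?thesis using x c by (intro exI[of _ "snd d ` (fst d \<inter> fst c \<inter> G)"]) auto
  qed
  then show "opn (model M) (snd d ` (fst d \<inter> W))" by (subst openin_subopen) blast
qed

lemma openin_mtopD:
  assumes M: "satlas M" and W: "openin (mtop M) W" and c: "c \<in> charts M"
  shows "opn (model M) (snd c ` (fst c \<inter> W))"
proof -
  have "\<exists>T. opn (model M) T \<and> y \<in> T \<and> T \<subseteq> snd c ` (fst c \<inter> W)" if "y \<in> snd c ` (fst c \<inter> W)" for y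
  proof -
    obtain x where x: "x \<in> fst c" "x \<in> W" "y = snd c x" using \<open>y \<in> _\<close> by blast
    obtain e where e: "e \<in> atlas M" "x \<in> fst e"
      using charts_carrier[OF c] x unfolding carrier_def by blast
    have e': "e \<in> charts M" using atlas_charts[OF M e(1)] .
    have "opn (model M) (snd c ` (fst c \<inter> fst e \<inter> W))"
      by (rule opn_transfer[OF charts_inj[OF e'] charts_inj[OF c] charts_compatible[OF M e' c]])
        (use W e openin_mtop[OF M] in blast)
    then show ?thesis using x e by (intro exI[of _ "snd c ` (fst c \<inter> fst e \<inter> W)"]) auto
  qed
  then show ?thesis by (subst openin_subopen) blast
qed

lemma openin_mtop_chart:
  assumes "satlas M" "c \<in> charts M" "G \<subseteq> fst c" "opn (model M) (snd c ` G)"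
  shows "openin (mtop M) G"
  using assms by (intro openin_mtopI) auto

lemma openin_mtop_domain: "satlas M \<Longrightarrow> c \<in> charts M \<Longrightarrow> openin (mtop M) (fst c)"
  using openin_mtop_chart charts_opn by blast

text \<open>The source of new charts: restrictions to open sets, and later the chart that
  straightens the image in T*TQ into a slice. The left inverse \<open>h'\<close> makes
  \<open>h\<close> a diffeomorphism of \<open>U\<close> onto its image, and every transition to an
  atlas chart is one for \<open>c\<close> preceded by \<open>h'\<close> or followed by
  \<open>h\<close>.\<close>

lemma charts_diffeo:
  assumes M: "satlas M" and c: "c \<in> charts M"
    and U: "opn (model M) U" "U \<subseteq> snd c ` fst c" and h: "smooth_on (model M) U h"
    and hU: "opn (model M) (h ` U)" and h': "smooth_on (model M) (h ` U) h'" and hh': "\<And>y. y \<in> U \<Longrightarrow> h' (h y) = y"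
  shows "({x \<in> fst c. snd c x \<in> U}, h \<circ> snd c) \<in> charts M" (is "?e \<in> _")
proof -
  let ?B = "model M"
  note B = satlas_Basis[OF M]
  have inj: "inj_on (snd ?e) (fst ?e)"
    using charts_inj[OF c] hh' by (auto simp: inj_on_def) metis
  have im: "snd ?e ` fst ?e = h ` U" using U(2) by (auto simp: image_iff)
  have "is_chart ?B ?e" using inj im hU by (simp add: is_chart_def)
  moreover have "fst ?e \<subseteq> carrier M" using charts_carrier[OF c] by auto
  moreover have "compatible ?B ?e d" if d: "d \<in> atlas M" for d
  proof -
    have d': "d \<in> charts M" using atlas_charts[OF M d] .
    note cd = charts_compatible[OF M c d', unfolded compatible_def]
    have "local_rep ?e d id (h (snd c x)) = snd d x" if "x \<in> fst c" "snd c x \<in> U" for x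
      using local_rep_apply[OF inj, of x d id] that by simp
    note rep = this charts_local_rep[OF c] charts_local_rep[OF d']
    have 1: "snd ?e ` (fst ?e \<inter> fst d) = {z \<in> h ` U. h' z \<in> snd c ` (fst c \<inter> fst d)}" (is "?L = ?R")
    proof
      show "?L \<subseteq> ?R" using hh' by auto
      show "?R \<subseteq> ?L"
      proof
        fix z assume "z \<in> ?R"
        then obtain y x where "y \<in> U" "z = h y" "x \<in> fst c" "x \<in> fst d" "h' z = snd c x" by auto
        then show "z \<in> ?L" using hh' by (auto intro!: image_eqI[of _ _ x])
      qed
    qed
    have 2: "snd d ` (fst ?e \<inter> fst d) = {y \<in> snd d ` (fst c \<inter> fst d). local_rep d c id y \<in> U}" (is "?L2 = ?R2")
      by (auto simp: rep)
    have O1: "opn ?B ?L"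
      unfolding 1 by (rule openin_preimage_smooth[OF hU h', where C = ?B])
        (use cd opn_span[OF U(1)] hh' in auto)
    have O2: "opn ?B ?L2"
      unfolding 2 by (rule openin_preimage_smooth[where C = ?B])
        (use cd U charts_span[OF c] in \<open>auto simp: rep\<close>)
    have "smooth_on ?B ?L (\<lambda>z. local_rep c d id (h' z))"
      by (rule smooth_on_compose[OF B B O1, where g = "local_rep c d id" and T = "snd c ` (fst c \<inter> fst d)"])
        (use cd hh' smooth_on_subset[OF h', of ?L] charts_span[OF c] in auto)
    then have "smooth_on ?B ?L (local_rep ?e d id)"
      by (rule smooth_on_congI[OF O1]) (use hh' in \<open>auto simp: rep\<close>)
    moreover have "smooth_on ?B ?L2 (\<lambda>z. h (local_rep d c id z))"
      by (rule smooth_on_compose[OF B B O2 openin_imp_subset[OF U(1)] h])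
        (use cd smooth_on_subset[of ?B "snd d ` (fst c \<inter> fst d)" "local_rep d c id" ?L2] in \<open>auto simp: rep\<close>)
    then have "smooth_on ?B ?L2 (local_rep d ?e id)"
      by (rule smooth_on_congI[OF O2]) (auto simp: rep)
    ultimately show ?thesis using O1 O2 by (simp add: compatible_def)
  qed
  ultimately show ?thesis by (simp add: charts_def)
qed

lemma charts_restrict:
  assumes M: "satlas M" and c: "c \<in> charts M" and W: "openin (mtop M) W"
  shows "(fst c \<inter> W, snd c) \<in> charts M"
proof -
  let ?U = "snd c ` (fst c \<inter> W)"
  have U: "opn (model M) ?U" by (rule openin_mtopD[OF M W c])
  have "({x \<in> fst c. snd c x \<in> ?U}, (\<lambda>y. y) \<circ> snd c) \<in> charts M"
    by (rule charts_diffeo[OF M c U]) (use U satlas_Basis[OF M] in \<open>auto intro: smooth_on_ident\<close>)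
  moreover have "{x \<in> fst c. snd c x \<in> ?U} = fst c \<inter> W"
    by (auto simp: inj_on_eq_iff[OF charts_inj[OF c]])
  ultimately show ?thesis by (simp add: o_def)
qed

section \<open>Smooth maps in charts\<close>

lemma smooth_mapE:
  assumes "smooth_map M W M' f" "x \<in> W"
  obtains c d where "c \<in> charts M" "x \<in> fst c" "d \<in> charts M'" "f x \<in> fst d"
    "fst c \<subseteq> W" "f ` fst c \<subseteq> fst d" "smooth_on (model M) (snd c ` fst c) (local_rep c d f)"
  using assms unfolding smooth_map_def Ball_def Bex_def charts_at_charts by blast

lemma smooth_funE:
  assumes "smooth_fun M W f" "x \<in> W"
  obtains c where "c \<in> charts M" "x \<in> fst c"
    "fst c \<subseteq> W" "smooth_on (model M) (snd c ` fst c) (f \<circ> inv_into (fst c) (snd c))"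
  using assms unfolding smooth_fun_def Ball_def Bex_def charts_at_charts by blast

lemma smooth_map_openin:
  assumes M: "satlas M" and f: "smooth_map M W M' f"
  shows "openin (mtop M) W"
proof (rule openin_mtopI[OF M])
  fix x assume "x \<in> W"
  then obtain c where "c \<in> charts M" "x \<in> fst c" "fst c \<subseteq> W" using smooth_mapE[OF f] by metis
  then show "\<exists>c\<in>charts M. \<exists>G\<subseteq>W. x \<in> G \<and> G \<subseteq> fst c \<and> opn (model M) (snd c ` G)"
    using charts_opn by blast
qed

lemma smooth_map_carrier:
  assumes "smooth_map M W M' f" "x \<in> W" shows "f x \<in> carrier M'"
  using smooth_mapE[OF assms] charts_carrier by (metis subsetD)

text \<open>\<open>smooth_map\<close> supplies some pair of charts at each point. In the prescribed
  charts the representative is, near that point, the supplied one placed between two transition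
  maps.\<close>

lemma smooth_mapD:
  assumes M: "satlas M" and M': "satlas M'" and f: "smooth_map M W M' f"
    and c: "c \<in> charts M" and d: "d \<in> charts M'"
  defines "G \<equiv> {x \<in> fst c \<inter> W. f x \<in> fst d}"
  shows "opn (model M) (snd c ` G)" "smooth_on (model M) (snd c ` G) (local_rep c d f)"
proof -
  let ?B = "model M" and ?B' = "model M'"
  note B = satlas_Basis[OF M] satlas_Basis[OF M']
  have ex: "\<exists>U. opn ?B U \<and> snd c x \<in> U \<and> U \<subseteq> snd c ` G \<and> smooth_on ?B U (local_rep c d f)" if x: "x \<in> G" for x
  proof -
    obtain c1 d1 where c1: "c1 \<in> charts M" "x \<in> fst c1" and d1: "d1 \<in> charts M'" "f x \<in> fst d1"
      and cW: "fst c1 \<subseteq> W" and fc: "f ` fst c1 \<subseteq> fst d1" and sm: "smooth_on ?B (snd c1 ` fst c1) (local_rep c1 d1 f)"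
      using smooth_mapE[OF f, of x] x unfolding G_def by blast
    note rep = charts_local_rep[OF c] charts_local_rep[OF d] charts_local_rep[OF c1(1)] charts_local_rep[OF d1(1)]
    note cc = charts_compatible[OF M c c1(1), unfolded compatible_def]
    note dd = charts_compatible[OF M' d1(1) d, unfolded compatible_def]
    define A where "A = {y \<in> snd c1 ` fst c1. local_rep c1 d1 f y \<in> snd d1 ` (fst d1 \<inter> fst d)}"
    have A: "opn ?B A" unfolding A_def
      by (rule openin_preimage_smooth[OF charts_opn[OF c1(1)] sm, where C = ?B'])
        (use dd charts_span[OF d1(1)] fc in \<open>auto simp: rep\<close>)
    have Aiff: "snd c1 z \<in> A \<longleftrightarrow> f z \<in> fst d" if "z \<in> fst c1" for z
    proof -
      have "f z \<in> fst d1" using fc that by blast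
      then show ?thesis unfolding A_def using that by (auto simp: rep inj_on_eq_iff[OF charts_inj[OF d1(1)]])
    qed
    define U where "U = {y \<in> snd c ` (fst c \<inter> fst c1). local_rep c c1 id y \<in> A}"
    have U: "opn ?B U" unfolding U_def
      by (rule openin_preimage_smooth[where C = ?B]) (use cc A charts_span[OF c1(1)] in \<open>auto simp: rep\<close>)
    have Ueq: "U = snd c ` {z \<in> fst c \<inter> fst c1. f z \<in> fst d}"
      unfolding U_def using Aiff by (auto simp: rep)
    have Us: "smooth_on ?B U (local_rep c c1 id)"
      by (rule smooth_on_subset[of _ "snd c ` (fst c \<inter> fst c1)"]) (use cc in \<open>auto simp: U_def\<close>)
    have As: "smooth_on ?B A (local_rep c1 d1 f)"
      by (rule smooth_on_subset[OF sm]) (auto simp: A_def)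
    have U1: "smooth_on ?B U (\<lambda>y. local_rep c1 d1 f (local_rep c c1 id y))"
      by (rule smooth_on_compose[OF B(1) B(1) U openin_imp_subset[OF A] As Us]) (simp add: U_def)
    have "smooth_on ?B U (\<lambda>y. local_rep d1 d id (local_rep c1 d1 f (local_rep c c1 id y)))"
      by (rule smooth_on_compose[OF B(1) B(2) U, where g = "local_rep d1 d id" and T = "snd d1 ` (fst d1 \<inter> fst d)"])
        (use dd U1 charts_span[OF d1(1)] in \<open>auto simp: U_def A_def\<close>)
    then have "smooth_on ?B U (local_rep c d f)"
      by (rule smooth_on_congI[OF U]) (use fc in \<open>auto simp: Ueq rep image_subset_iff\<close>)
    moreover have "U \<subseteq> snd c ` G" using cW by (auto simp: Ueq G_def)
    moreover have "snd c x \<in> U" using x c1 by (auto simp: Ueq G_def)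
    ultimately show ?thesis using U by blast
  qed
  show O: "opn ?B (snd c ` G)" by (subst openin_subopen) (use ex in blast)
  show "smooth_on ?B (snd c ` G) (local_rep c d f)"
    by (rule smooth_on_local) (use ex openin_imp_subset[OF O] in blast)+
qed

lemma smooth_funD:
  assumes M: "satlas M" and f: "smooth_fun M W f" and c: "c \<in> charts M"
  shows "opn (model M) (snd c ` (fst c \<inter> W))" "smooth_on (model M) (snd c ` (fst c \<inter> W)) (f \<circ> inv_into (fst c) (snd c))"
proof -
  let ?B = "model M"
  note B = satlas_Basis[OF M]
  have ex: "\<exists>U. opn ?B U \<and> snd c x \<in> U \<and> U \<subseteq> snd c ` (fst c \<inter> W) \<and> smooth_on ?B U (f \<circ> inv_into (fst c) (snd c))"
    if x: "x \<in> fst c \<inter> W" for x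
  proof -
    obtain c1 where c1: "c1 \<in> charts M" "x \<in> fst c1"
      and cW: "fst c1 \<subseteq> W" and sm: "smooth_on ?B (snd c1 ` fst c1) (f \<circ> inv_into (fst c1) (snd c1))"
      using smooth_funE[OF f, of x] x by blast
    note cc = charts_compatible[OF M c c1(1), unfolded compatible_def]
    let ?U = "snd c ` (fst c \<inter> fst c1)"
    have "smooth_on ?B ?U (\<lambda>y. (f \<circ> inv_into (fst c1) (snd c1)) (local_rep c c1 id y))"
      by (rule smooth_on_compose[OF B B _ openin_imp_subset[OF charts_opn[OF c1(1)]] sm])
        (use cc in \<open>auto simp: charts_local_rep[OF c]\<close>)
    then have "smooth_on ?B ?U (f \<circ> inv_into (fst c) (snd c))"
      by (rule smooth_on_congI[OF conjunct1[OF cc]])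
        (auto simp: charts_local_rep[OF c] charts_inj[OF c] charts_inj[OF c1(1)])
    then show ?thesis using cc cW x c1 by (intro exI[of _ ?U]) auto
  qed
  show O: "opn ?B (snd c ` (fst c \<inter> W))" by (subst openin_subopen) (use ex in blast)
  show "smooth_on ?B (snd c ` (fst c \<inter> W)) (f \<circ> inv_into (fst c) (snd c))"
    by (rule smooth_on_local) (use ex openin_imp_subset[OF O] in blast)+
qed

lemma inv_into_subset:
  assumes "inj_on g A" "G \<subseteq> A" "y \<in> g ` G"
  shows "inv_into G g y = inv_into A g y"
  using assms by (auto simp: inj_on_subset[OF assms(1,2)] subset_iff)

text \<open>\<open>smooth_map\<close> wants a chart whose whole domain lies in \<open>W\<close> and
  goes into a single target chart. The restriction of \<open>c\<close> to \<open>G\<close> is one,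
  so the shrinking is done here once and for all.\<close>

lemma smooth_mapI:
  assumes M: "satlas M"
    and ex: "\<And>x. x \<in> W \<Longrightarrow> \<exists>c\<in>charts M. \<exists>d\<in>charts M'. \<exists>G\<subseteq>W. x \<in> G \<and> G \<subseteq> fst c \<and>
      f ` G \<subseteq> fst d \<and> opn (model M) (snd c ` G) \<and> smooth_on (model M) (snd c ` G) (local_rep c d f)"
  shows "smooth_map M W M' f"
  unfolding smooth_map_def
proof
  fix x assume "x \<in> W"
  then obtain c d G where c: "c \<in> charts M" and d: "d \<in> charts M'" and G: "G \<subseteq> W" "x \<in> G" "G \<subseteq> fst c" "f ` G \<subseteq> fst d"
    and O: "opn (model M) (snd c ` G)" and sm: "smooth_on (model M) (snd c ` G) (local_rep c d f)"
    using ex by meson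
  have "(fst c \<inter> G, snd c) \<in> charts M"
    by (rule charts_restrict[OF M c openin_mtop_chart[OF M c G(3) O]])
  then have c': "(G, snd c) \<in> charts M" using G(3) by (simp add: Int_absorb1)
  have "smooth_on (model M) (snd c ` G) (local_rep (G, snd c) d f)"
    by (rule smooth_on_congI[OF O sm])
      (simp add: local_rep_def inv_into_subset[OF charts_inj[OF c] G(3)])
  then show "\<exists>c\<in>charts_at M x. \<exists>d\<in>charts_at M' (f x). fst c \<subseteq> W \<and> f ` fst c \<subseteq> fst d \<and>
      smooth_on (model M) (snd c ` fst c) (local_rep c d f)"
    using c' d G by (intro bexI[of _ "(G, snd c)"] bexI[of _ d]) (auto simp: charts_at_charts)
qed

lemma smooth_map_id:
  assumes M: "satlas M" shows "smooth_map M (carrier M) M id"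
proof (rule smooth_mapI[OF M])
  fix x assume "x \<in> carrier M"
  then obtain c where c: "c \<in> charts M" "x \<in> fst c" unfolding carrier_charts_at[OF M] charts_at_charts by blast
  have "smooth_on (model M) (snd c ` fst c) (local_rep c c id)"
    by (rule smooth_on_congI[OF charts_opn[OF c(1)] smooth_on_ident[OF charts_opn[OF c(1)] satlas_Basis[OF M]]])
      (auto simp: charts_local_rep[OF c(1)])
  then show "\<exists>c\<in>charts M. \<exists>d\<in>charts M. \<exists>G\<subseteq>carrier M. x \<in> G \<and> G \<subseteq> fst c \<and>
      id ` G \<subseteq> fst d \<and> opn (model M) (snd c ` G) \<and> smooth_on (model M) (snd c ` G) (local_rep c d id)"
    using c charts_carrier[OF c(1)] charts_opn[OF c(1)] by (intro bexI[of _ c] exI[of _ "fst c"]) auto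
qed

lemma local_rep_differentiable:
  assumes "satlas M" "satlas M'" "smooth_map M W M' f" "x \<in> W" "c \<in> charts_at M x" "d \<in> charts_at M' (f x)"
  shows "local_rep c d f differentiable (at (snd c x) within span (model M))"
  using assms by (intro smooth_on_differentiable[OF smooth_mapD(2)[OF assms(1-3), of c d]])
    (auto simp: charts_at_charts)

lemma pd_local_rep_span:
  assumes M: "satlas M" and M': "satlas M'" and f: "smooth_map M W M' f" and x: "x \<in> W"
    and c: "c \<in> charts_at M x" and d: "d \<in> charts_at M' (f x)" and u: "u \<in> span (model M)"
  shows "pd (model M) (local_rep c d f) u (snd c x) \<in> span (model M')"
proof -
  have c': "c \<in> charts M" "x \<in> fst c" and d': "d \<in> charts M'" "f x \<in> fst d" using c d by (auto simp: charts_at_charts)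
  show ?thesis
    by (rule pd_in_span[OF smooth_mapD(1)[OF M M' f c'(1) d'(1)] _ _ satlas_Basis[OF M']
          local_rep_differentiable[OF M M' f x c d] u])
      (use x c' d' charts_span[OF d'(1)] in \<open>auto simp: charts_local_rep[OF c'(1)]\<close>)
qed

text \<open>The representative of a composition is the composition of representatives only where the
  intermediate point lies in \<open>d\<close>. Openness of this set is what allows derivatives at a
  point to be compared.\<close>

lemma local_rep_comp_germ:
  assumes M: "satlas M" and M': "satlas M'" and M'': "satlas M''"
    and f: "smooth_map M W M' f" and g: "smooth_map M' W' M'' g"
    and c: "c \<in> charts M" and d: "d \<in> charts M'" and e: "e \<in> charts M''"
  defines "G \<equiv> {x \<in> fst c \<inter> W. f x \<in> fst d \<inter> W' \<and> g (f x) \<in> fst e}"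
  shows "opn (model M) (snd c ` G)"
    and "\<And>y. y \<in> snd c ` G \<Longrightarrow> local_rep c e (g \<circ> f) y = local_rep d e g (local_rep c d f y)"
proof -
  let ?F = "snd c ` {x \<in> fst c \<inter> W. f x \<in> fst d}" and ?H = "snd d ` {x \<in> fst d \<inter> W'. g x \<in> fst e}"
  note fD = smooth_mapD[OF M M' f c d] and gD = smooth_mapD[OF M' M'' g d e]
  have eq: "snd c ` G = {y \<in> ?F. local_rep c d f y \<in> ?H}"
    unfolding G_def by (auto simp: charts_local_rep[OF c] inj_on_eq_iff[OF charts_inj[OF d]])
  show O: "opn (model M) (snd c ` G)"
    unfolding eq by (rule openin_preimage_smooth[OF fD _ gD(1)])
      (use charts_span[OF d] in \<open>auto simp: charts_local_rep[OF c]\<close>)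
  show "local_rep c e (g \<circ> f) y = local_rep d e g (local_rep c d f y)" if "y \<in> snd c ` G" for y
    using that by (auto simp: G_def charts_local_rep[OF c] charts_local_rep[OF d])
qed

text \<open>Taking one or both maps to be the identity, this is also the cocycle rule for Jacobians
  of transitions and the reason why tangent maps do not depend on charts.\<close>

lemma pd_local_rep_comp:
  assumes M: "satlas M" and M': "satlas M'" and M'': "satlas M''"
    and f: "smooth_map M W M' f" and g: "smooth_map M' W' M'' g" and x: "x \<in> W" "f x \<in> W'"
    and c: "c \<in> charts_at M x" and d: "d \<in> charts_at M' (f x)" and e: "e \<in> charts_at M'' (g (f x))"
    and u: "u \<in> span (model M)"
  shows "pd (model M) (local_rep c e (g \<circ> f)) u (snd c x) =
    pd (model M') (local_rep d e g) (pd (model M) (local_rep c d f) u (snd c x)) (snd d (f x))"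
proof -
  let ?G = "{x \<in> fst c \<inter> W. f x \<in> fst d \<inter> W' \<and> g (f x) \<in> fst e}"
  have c': "c \<in> charts M" "x \<in> fst c" and d': "d \<in> charts M'" "f x \<in> fst d" and e': "e \<in> charts M''" "g (f x) \<in> fst e"
    using c d e by (auto simp: charts_at_charts)
  note germ = local_rep_comp_germ[OF M M' M'' f g c'(1) d'(1) e'(1)]
  have xG: "snd c x \<in> snd c ` ?G" using x c' d' e' by blast
  have "pd (model M) (local_rep c e (g \<circ> f)) u (snd c x) =
      pd (model M) (\<lambda>y. local_rep d e g (local_rep c d f y)) u (snd c x)"
    by (rule pd_cong[OF germ(1) xG germ(2)])
  also have "\<dots> = pd (model M') (local_rep d e g) (pd (model M) (local_rep c d f) u (snd c x)) (local_rep c d f (snd c x))"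
    by (rule pd_compose[OF germ(1) xG _ local_rep_differentiable[OF M M' f x(1) c d] _ u])
      (use charts_span[OF d'(1)] local_rep_differentiable[OF M' M'' g x(2) d e] c'
        in \<open>auto simp: charts_local_rep[OF c'(1)]\<close>)
  finally show ?thesis by (simp add: charts_local_rep[OF c'(1,2)])
qed

section \<open>Submanifolds\<close>

lemma opn_Int_span:
  assumes "opn B S" "C \<subseteq> B" shows "opn C (S \<inter> span C)"
proof -
  obtain T where "open T" "S = span B \<inter> T" using assms(1) by (auto simp: openin_open)
  then show ?thesis using span_mono[OF assms(2)] by (auto simp: openin_open)
qed

lemma smooth_on_Int_span:
  assumes "opn B S" "C \<subseteq> B" "B \<subseteq> Basis" "smooth_on B S f" shows "smooth_on C (S \<inter> span C) f"
proof -
  have C: "C \<subseteq> Basis" using assms by blast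
  show ?thesis
    by (rule smooth_on_compose[OF C assms(3) opn_Int_span[OF assms(1,2)] openin_imp_subset[OF assms(1)] assms(4)
          smooth_on_ident[OF opn_Int_span[OF assms(1,2)] C]]) blast
qed

lemma submanifoldE:
  assumes "submanifold M C S" "x \<in> S"
  obtains c where "c \<in> slice_charts M C S" "x \<in> fst c"
  using assms unfolding submanifold_def by blast

abbreviation slice_restr :: "'a set \<Rightarrow> ('a, 'e) chart \<Rightarrow> ('a, 'e) chart" where
  "slice_restr S c \<equiv> (fst c \<inter> S, snd c)"

lemma slice_chartsD:
  assumes "c \<in> slice_charts M C S"
  shows "c \<in> charts M" "snd c ` (fst c \<inter> S) = snd c ` fst c \<inter> span C"
  using assms by (auto simp: slice_charts_def)

lemma model_submfd [simp]: "model (submfd M C S) = C"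
  by (simp add: submfd_def)

lemma carrier_submfd: "submanifold M C S \<Longrightarrow> carrier (submfd M C S) = S"
  by (auto simp: carrier_def submfd_def submanifold_def)

text \<open>The slice condition identifies the image of a restricted chart with an open part of
  \<open>span C\<close>. Overlaps of restricted charts are slices of overlaps, so the transitions
  are restrictions of smooth maps to a coordinate subspace.\<close>

lemma satlas_submfd:
  assumes M: "satlas M" and S: "submanifold M C S"
  shows "satlas (submfd M C S)"
proof -
  have C: "C \<subseteq> model M" using S by (simp add: submanifold_def)
  note B = satlas_Basis[OF M]
  have chart: "is_chart C (slice_restr S c)" if "c \<in> slice_charts M C S" for c
  proof -
    note c = slice_chartsD[OF that]
    have "inj_on (snd c) (fst c \<inter> S)" using charts_inj[OF c(1)] inj_on_subset by blast
    then show ?thesis using opn_Int_span[OF charts_opn[OF c(1)] C] c(2) by (simp add: is_chart_def)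
  qed
  have half: "opn C (snd c ` (fst c \<inter> S \<inter> (fst d \<inter> S))) \<and>
      smooth_on C (snd c ` (fst c \<inter> S \<inter> (fst d \<inter> S))) (local_rep (slice_restr S c) (slice_restr S d) id)"
    if cs: "c \<in> slice_charts M C S" and ds: "d \<in> slice_charts M C S" for c d
  proof -
    note c = slice_chartsD[OF cs] and d = slice_chartsD[OF ds]
    note cd = charts_compatible[OF M c(1) d(1), unfolded compatible_def]
    have "snd c ` (fst c \<inter> S \<inter> (fst d \<inter> S)) = snd c ` (fst c \<inter> fst d) \<inter> snd c ` (fst c \<inter> S)"
      by (auto simp: inj_on_eq_iff[OF charts_inj[OF c(1)]])
    then have eq: "snd c ` (fst c \<inter> S \<inter> (fst d \<inter> S)) = snd c ` (fst c \<inter> fst d) \<inter> span C" using c(2) by auto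
    have O: "opn C (snd c ` (fst c \<inter> fst d) \<inter> span C)" using cd C opn_Int_span by blast
    have "smooth_on C (snd c ` (fst c \<inter> fst d) \<inter> span C) (local_rep c d id)"
      using cd C B by (intro smooth_on_Int_span[of "model M"]) auto
    then have "smooth_on C (snd c ` (fst c \<inter> fst d) \<inter> span C) (local_rep (slice_restr S c) (slice_restr S d) id)"
      by (rule smooth_on_congI[OF O])
        (auto simp: eq[symmetric] local_rep_def inj_on_subset[OF charts_inj[OF c(1)]] charts_inj[OF c(1)])
    then show ?thesis using O eq by simp
  qed
  have "compatible C (slice_restr S c) (slice_restr S d)"
    if "c \<in> slice_charts M C S" "d \<in> slice_charts M C S" for c d
    using half[OF that] half[OF that(2,1)] by (simp add: compatible_def Int_commute)
  then show ?thesis using chart C B by (auto simp: smooth_atlas_def submfd_def)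
qed

lemma slice_restr_charts:
  "satlas M \<Longrightarrow> submanifold M C S \<Longrightarrow> c \<in> slice_charts M C S \<Longrightarrow> slice_restr S c \<in> charts (submfd M C S)"
  by (rule atlas_charts[OF satlas_submfd]) (auto simp: submfd_def)

lemma smooth_map_inclusion:
  assumes M: "satlas M" and S: "submanifold M C S"
  shows "smooth_map (submfd M C S) S M id"
proof (rule smooth_mapI[OF satlas_submfd[OF M S]])
  fix x assume x: "x \<in> S"
  then obtain c where c: "c \<in> slice_charts M C S" "x \<in> fst c" using submanifoldE[OF S x] by metis
  note c' = slice_restr_charts[OF M S c(1)]
  have B: "C \<subseteq> Basis" using S satlas_Basis[OF M] by (auto simp: submanifold_def)
  note O = charts_opn[OF c', simplified]
  have "smooth_on C (snd c ` (fst c \<inter> S)) (local_rep (slice_restr S c) c id)"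
    by (rule smooth_on_congI[OF O smooth_on_ident[OF O B]]) (use charts_local_rep[OF c', of _ c id] in auto)
  then show "\<exists>c\<in>charts (submfd M C S). \<exists>d\<in>charts M. \<exists>G\<subseteq>S. x \<in> G \<and> G \<subseteq> fst c \<and>
      id ` G \<subseteq> fst d \<and> opn (model (submfd M C S)) (snd c ` G) \<and> smooth_on (model (submfd M C S)) (snd c ` G) (local_rep c d id)"
    using c' slice_chartsD(1)[OF c(1)] c(2) x O
    by (intro bexI[of _ "slice_restr S c"] bexI[of _ c] exI[of _ "fst c \<inter> S"]) auto
qed

text \<open>Embeddedness enters here: a slice chart and its restriction to \<open>S\<close> have the
  same coordinate function, so a map into \<open>S\<close> has the same local representative with
  respect to both.\<close>

lemma smooth_map_into_submfd:
  assumes K: "satlas K" and M: "satlas M" and S: "submanifold M C S" and f: "smooth_map K W M f" and fS: "f ` W \<subseteq> S"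
  shows "smooth_map K W (submfd M C S) f"
proof (rule smooth_mapI[OF K])
  fix x assume x: "x \<in> W"
  obtain e where e: "e \<in> charts K" "x \<in> fst e" using smooth_mapE[OF f x] by metis
  obtain c where c: "c \<in> slice_charts M C S" "f x \<in> fst c" using submanifoldE[OF S subsetD[OF fS imageI[OF x]]] by metis
  note fD = smooth_mapD[OF K M f e(1) slice_chartsD(1)[OF c(1)]]
  have "local_rep e (slice_restr S c) f = local_rep e c f" by (simp add: local_rep_def)
  then show "\<exists>c\<in>charts K. \<exists>d\<in>charts (submfd M C S). \<exists>G\<subseteq>W. x \<in> G \<and> G \<subseteq> fst c \<and>
      f ` G \<subseteq> fst d \<and> opn (model K) (snd c ` G) \<and> smooth_on (model K) (snd c ` G) (local_rep c d f)"
    using fD e c x fS slice_restr_charts[OF M S c(1)]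
    by (intro bexI[of _ e] bexI[of _ "slice_restr S c"] exI[of _ "{x \<in> fst e \<inter> W. f x \<in> fst c}"]) auto
qed

section \<open>Tangent vectors\<close>

lemma tangent_atD:
  assumes "v \<in> tangent_at M x"
  shows "fst v = x" "c \<in> charts_at M x \<Longrightarrow> snd v c \<in> span (model M)" "c \<notin> charts_at M x \<Longrightarrow> snd v c = 0"
    "c \<in> charts_at M x \<Longrightarrow> d \<in> charts_at M x \<Longrightarrow>
      snd v d = pd (model M) (local_rep c d id) (snd v c) (snd c x)"
proof -
  note v = assms[unfolded tangent_at_def mem_Collect_eq]
  show "fst v = x" by (rule conjunct1[OF v])
  note v1 = conjunct1[OF conjunct2[OF v], THEN spec[of _ c]]
  show "c \<in> charts_at M x \<Longrightarrow> snd v c \<in> span (model M)" "c \<notin> charts_at M x \<Longrightarrow> snd v c = 0"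
    using v1 by simp_all
  show "c \<in> charts_at M x \<Longrightarrow> d \<in> charts_at M x \<Longrightarrow>
      snd v d = pd (model M) (local_rep c d id) (snd v c) (snd c x)"
    using conjunct2[OF conjunct2[OF v]] by blast
qed

lemma tangent_atI:
  assumes "fst v = x" "\<And>c. c \<in> charts_at M x \<Longrightarrow> snd v c \<in> span (model M)" "\<And>c. c \<notin> charts_at M x \<Longrightarrow> snd v c = 0"
    and "\<And>c d. c \<in> charts_at M x \<Longrightarrow> d \<in> charts_at M x \<Longrightarrow>
      snd v d = pd (model M) (local_rep c d id) (snd v c) (snd c x)"
  shows "v \<in> tangent_at M x"
  unfolding tangent_at_def mem_Collect_eq
proof (intro conjI allI ballI)
  show "if c \<in> charts_at M x then snd v c \<in> span (model M) else snd v c = 0" for c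
    using assms(2,3)[of c] by (cases "c \<in> charts_at M x") simp_all
qed (fact assms)+

text \<open>The components in one chart determine those in all charts at \<open>x\<close> by the
  Jacobians; in the remaining charts both families have the default value 0.\<close>

lemma tangent_at_eqI:
  assumes "v \<in> tangent_at M x" "w \<in> tangent_at M x" "c \<in> charts_at M x" "snd v c = snd w c"
  shows "v = w"
proof -
  have "snd v d = snd w d" for d
    using tangent_atD(3)[OF assms(1)] tangent_atD(3)[OF assms(2)] tangent_atD(4)[OF assms(1,3), of d]
      tangent_atD(4)[OF assms(2,3), of d] assms(4) by (cases "d \<in> charts_at M x") auto
  then show ?thesis using tangent_atD(1)[OF assms(1)] tangent_atD(1)[OF assms(2)] by (auto simp: prod_eq_iff)
qed

lemma charts_at_carrier: "c \<in> charts_at M x \<Longrightarrow> x \<in> carrier M"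
  using charts_carrier[of c M] by (auto simp: charts_at_charts)

lemma pd_local_rep_id:
  assumes M: "satlas M" and c: "c \<in> charts_at M x" and u: "u \<in> span (model M)"
  shows "pd (model M) (local_rep c c id) u (snd c x) = u"
proof -
  have c': "c \<in> charts M" "x \<in> fst c" using c by (auto simp: charts_at_charts)
  have "pd (model M) (local_rep c c id) u (snd c x) = pd (model M) (\<lambda>y. y) u (snd c x)"
    using c' by (intro pd_cong[OF charts_opn[OF c'(1)]]) (auto simp: charts_local_rep[OF c'(1)])
  then show ?thesis using pd_bounded_linear[OF bounded_linear_ident charts_span[OF c'] u] by simp
qed

lemma pd_transition_comp:
  assumes M: "satlas M" and c: "c \<in> charts_at M x" "d \<in> charts_at M x" "e \<in> charts_at M x" and u: "u \<in> span (model M)"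
  shows "pd (model M) (local_rep d e id) (pd (model M) (local_rep c d id) u (snd c x)) (snd d x) =
    pd (model M) (local_rep c e id) u (snd c x)"
  using pd_local_rep_comp[OF M M M smooth_map_id[OF M] smooth_map_id[OF M], of x c d e u]
    c u charts_at_carrier[OF c(1)] by simp

lemma transition_span:
  assumes M: "satlas M" and c: "c \<in> charts_at M x" "d \<in> charts_at M x" and u: "u \<in> span (model M)"
  shows "pd (model M) (local_rep c d id) u (snd c x) \<in> span (model M)"
  using pd_local_rep_span[OF M M smooth_map_id[OF M] charts_at_carrier[OF c(1)]] c u by simp

lemma transition_differentiable:
  assumes M: "satlas M" and c: "c \<in> charts_at M x" "d \<in> charts_at M x"
  shows "local_rep c d id differentiable (at (snd c x) within span (model M))"
  using local_rep_differentiable[OF M M smooth_map_id[OF M] charts_at_carrier[OF c(1)]] c by simp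

section \<open>Coordinate vectors and tangent maps\<close>

text \<open>The required transformation rule is the cocycle identity for the Jacobians of the
  transitions.\<close>

lemma cvector_tangent:
  assumes M: "satlas M" and c: "c \<in> charts_at M x" and u: "u \<in> span (model M)"
  shows "cvector M c x u \<in> tangent_at M x"
  by (rule tangent_atI)
    (use transition_span[OF M c _ u] pd_transition_comp[OF M c _ _ u] in \<open>simp_all add: cvector_def\<close>)

lemma fst_cvector [simp]: "fst (cvector M c x u) = x"
  by (simp add: cvector_def)

lemma snd_cvector:
  assumes M: "satlas M" and c: "c \<in> charts_at M x" and u: "u \<in> span (model M)"
  shows "snd (cvector M c x u) c = u"
  using pd_local_rep_id[OF M c u] c by (simp add: cvector_def)

lemma cvector_snd:
  assumes M: "satlas M" and c: "c \<in> charts_at M x" and v: "v \<in> tangent_at M x"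
  shows "cvector M c x (snd v c) = v"
  by (rule tangent_at_eqI[OF cvector_tangent[OF M c tangent_atD(2)[OF v c]] v c])
    (rule snd_cvector[OF M c tangent_atD(2)[OF v c]])

lemma tadd_tangent:
  assumes M: "satlas M" and v: "v \<in> tangent_at M x" and w: "w \<in> tangent_at M x"
  shows "tadd v w \<in> tangent_at M x"
proof (rule tangent_atI)
  fix c d assume c: "c \<in> charts_at M x" "d \<in> charts_at M x"
  show "snd (tadd v w) d = pd (model M) (local_rep c d id) (snd (tadd v w) c) (snd c x)"
    unfolding tadd_def snd_conv pd_add_dir[OF transition_differentiable[OF M c]]
      tangent_atD(4)[OF v c] tangent_atD(4)[OF w c] ..
qed (use tangent_atD(1-3)[OF v] tangent_atD(1-3)[OF w] in \<open>simp_all add: tadd_def span_add\<close>)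

lemma tscale_tangent:
  assumes M: "satlas M" and v: "v \<in> tangent_at M x"
  shows "tscale r v \<in> tangent_at M x"
proof (rule tangent_atI)
  fix c d assume c: "c \<in> charts_at M x" "d \<in> charts_at M x"
  show "snd (tscale r v) d = pd (model M) (local_rep c d id) (snd (tscale r v) c) (snd c x)"
    unfolding tscale_def snd_conv pd_scale[OF transition_differentiable[OF M c]] tangent_atD(4)[OF v c] ..
qed (use tangent_atD(1-3)[OF v] in \<open>simp_all add: tscale_def span_scale\<close>)

lemma cvector_add:
  assumes M: "satlas M" and c: "c \<in> charts_at M x"
  shows "cvector M c x (u + u') = tadd (cvector M c x u) (cvector M c x u')"
  using pd_add_dir[OF transition_differentiable[OF M c]] by (auto simp: cvector_def tadd_def fun_eq_iff)

lemma cvector_scale: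
  assumes M: "satlas M" and c: "c \<in> charts_at M x"
  shows "cvector M c x (r *\<^sub>R u) = tscale r (cvector M c x u)"
  using pd_scale[OF transition_differentiable[OF M c]] by (auto simp: cvector_def tscale_def fun_eq_iff)

text \<open>Removes the chart picked by \<open>SOME\<close> in \<open>tangent_map\<close>: the
  components of \<open>v\<close> in that chart come from those in \<open>c\<close> by a Jacobian,
  and the chain rule absorbs the detour.\<close>

lemma snd_tangent_map:
  assumes M: "satlas M" and M': "satlas M'" and f: "smooth_map M W M' f" and x: "x \<in> W"
    and v: "v \<in> tangent_at M x" and c: "c \<in> charts_at M x" and d: "d \<in> charts_at M' (f x)"
  shows "snd (tangent_map M M' f v) d = pd (model M) (local_rep c d f) (snd v c) (snd c x)"
proof -
  have xM: "x \<in> carrier M" using charts_at_carrier[OF c] .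
  define e where "e = (SOME c. c \<in> charts_at M x)"
  have e: "e \<in> charts_at M x" using some_chart[OF M xM] by (simp add: e_def)
  have "snd (tangent_map M M' f v) d = pd (model M) (local_rep e d f) (snd v e) (snd e x)"
    using d tangent_atD(1)[OF v] by (simp add: tangent_map_def Let_def e_def)
  also have "\<dots> = pd (model M) (local_rep e d f) (pd (model M) (local_rep c e id) (snd v c) (snd c x)) (snd e x)"
    using tangent_atD(4)[OF v c e] by simp
  also have "\<dots> = pd (model M) (local_rep c d f) (snd v c) (snd c x)"
    using pd_local_rep_comp[OF M M M' smooth_map_id[OF M] f, of x c e d "snd v c"] xM x c d e
      tangent_atD(2)[OF v c] by simp
  finally show ?thesis .
qed

lemma fst_tangent_map [simp]: "fst (tangent_map M M' f v) = f (fst v)"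
  by (simp add: tangent_map_def Let_def)

lemma tangent_map_tangent:
  assumes M: "satlas M" and M': "satlas M'" and f: "smooth_map M W M' f" and x: "x \<in> W" and v: "v \<in> tangent_at M x"
  shows "tangent_map M M' f v \<in> tangent_at M' (f x)"
proof -
  have xM: "x \<in> carrier M" using openin_mtop_carrier[OF M smooth_map_openin[OF M f]] x by blast
  obtain c where c: "c \<in> charts_at M x" using carrier_charts_at[OF M] xM by blast
  have fx: "f x \<in> carrier M'" using smooth_map_carrier[OF f x] .
  note s = snd_tangent_map[OF M M' f x v c]
  have sp: "snd v c \<in> span (model M)" using tangent_atD(2)[OF v c] .
  show ?thesis
  proof (rule tangent_atI)
    show "snd (tangent_map M M' f v) d = 0" if "d \<notin> charts_at M' (f x)" for d
      using that tangent_atD(1)[OF v] by (simp add: tangent_map_def Let_def)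
    show "snd (tangent_map M M' f v) d \<in> span (model M')" if "d \<in> charts_at M' (f x)" for d
      using s[OF that] pd_local_rep_span[OF M M' f x c that sp] by simp
    fix d e assume d: "d \<in> charts_at M' (f x)" and e: "e \<in> charts_at M' (f x)"
    have "pd (model M) (local_rep c e (id \<circ> f)) (snd v c) (snd c x) =
        pd (model M') (local_rep d e id) (pd (model M) (local_rep c d f) (snd v c) (snd c x)) (snd d (f x))"
      by (rule pd_local_rep_comp[OF M M' M' f smooth_map_id[OF M'] x fx c d _ sp]) (simp add: e)
    then show "snd (tangent_map M M' f v) e = pd (model M') (local_rep d e id) (snd (tangent_map M M' f v) d) (snd d (f x))"
      unfolding s[OF d] s[OF e] id_comp .
  qed (simp add: tangent_atD(1)[OF v])
qed

section \<open>The tangent bundle\<close>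

lemma bundle_model_Basis: "B \<subseteq> Basis \<Longrightarrow> bundle_model B \<subseteq> Basis"
  by (auto simp: bundle_model_def Basis_prod_def)

lemma span_bundle_model: "span (bundle_model B) = span B \<times> span B"
proof
  show "span (bundle_model B) \<subseteq> span B \<times> span B"
    by (rule span_minimal) (auto simp: bundle_model_def intro: span_base span_zero subspace_Times)
  have "(u, 0) \<in> span (bundle_model B)" if "u \<in> span B" for u :: 'a
  proof -
    have "(u, 0) \<in> (\<lambda>b. (b, 0::'a)) ` span B" using that by blast
    also have "\<dots> = span ((\<lambda>b. (b, 0)) ` B)"
      using linear_span_image[OF bounded_linear.linear[OF bounded_linear_Pair_0(1)]] by metis
    also have "\<dots> \<subseteq> span (bundle_model B)" by (intro span_mono) (auto simp: bundle_model_def)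
    finally show ?thesis .
  qed
  moreover have "(0, u) \<in> span (bundle_model B)" if "u \<in> span B" for u :: 'a
  proof -
    have "(0, u) \<in> (\<lambda>b. (0::'a, b)) ` span B" using that by blast
    also have "\<dots> = span ((\<lambda>b. (0, b)) ` B)"
      using linear_span_image[OF bounded_linear.linear[OF bounded_linear_Pair_0(2)]] by metis
    also have "\<dots> \<subseteq> span (bundle_model B)" by (intro span_mono) (auto simp: bundle_model_def)
    finally show ?thesis .
  qed
  ultimately have "(u, 0) + (0, v) \<in> span (bundle_model B)" if "u \<in> span B" "v \<in> span B" for u v :: 'a
    using that by (intro span_add) auto
  then show "span B \<times> span B \<subseteq> span (bundle_model B)" by auto
qed

lemma opn_bundle: "opn B S \<Longrightarrow> opn (bundle_model B) (S \<times> span B)"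
  unfolding span_bundle_model by (intro openin_Times) auto

lemma smooth_on_fst_comp:
  assumes "B \<subseteq> Basis" "opn B S" "smooth_on B S f"
  shows "smooth_on (bundle_model B) (S \<times> span B) (\<lambda>z. f (fst z))"
  by (rule smooth_on_compose[OF bundle_model_Basis[OF assms(1)] assms(1) opn_bundle[OF assms(2)]
        openin_imp_subset[OF assms(2)] assms(3)
        smooth_on_linear[OF bounded_linear_fst opn_bundle[OF assms(2)] bundle_model_Basis[OF assms(1)]]]) auto

lemma smooth_on_snd_proj:
  assumes "B \<subseteq> Basis" "opn B S"
  shows "smooth_on (bundle_model B) (S \<times> span B) snd"
  by (rule smooth_on_linear[OF bounded_linear_snd opn_bundle[OF assms(2)] bundle_model_Basis[OF assms(1)]])

text \<open>The dependence on the direction is linear; expanding it in the basis separates it from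
  the smooth dependence on the base point.\<close>

lemma smooth_on_tangent:
  assumes "B \<subseteq> Basis" "opn B S" "smooth_on B S f"
  shows "smooth_on (bundle_model B) (S \<times> span B) (\<lambda>z. pd B f (snd z) (fst z))"
proof -
  note O = opn_bundle[OF assms(2)]
  have "smooth_on (bundle_model B) (S \<times> span B) (\<lambda>z. \<Sum>b\<in>B. (snd z \<bullet> b) *\<^sub>R pd B f b (fst z))"
    using assms by (intro smooth_on_sum smooth_on_scaleR smooth_on_linear_image[OF bounded_linear_inner_left] O
        smooth_on_snd_proj smooth_on_fst_comp smooth_on_pd_Basis bundle_model_Basis)
  then show ?thesis
    by (rule smooth_on_congI[OF O])
      (auto intro!: pd_expand[symmetric] smooth_on_differentiable[OF assms(3)] assms(1))
qed

section \<open>Charts of the tangent bundle\<close>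

lemma fst_tchart: "fst (tchart M c) = {v. fst v \<in> fst c \<and> v \<in> tangent_at M (fst v)}"
  by (auto simp: tchart_def dest: tangent_atD(1))

lemma snd_tchart: "snd (tchart M c) v = (snd c (fst v), snd v c)"
  by (simp add: tchart_def)

lemma tchart_image:
  assumes M: "satlas M" and c: "c \<in> charts M" and G: "G \<subseteq> fst c"
  shows "snd (tchart M c) ` {v \<in> fst (tchart M c). fst v \<in> G} = snd c ` G \<times> span (model M)"
proof
  show "snd (tchart M c) ` {v \<in> fst (tchart M c). fst v \<in> G} \<subseteq> snd c ` G \<times> span (model M)"
    using c by (auto simp: fst_tchart snd_tchart charts_at_charts intro!: tangent_atD(2))
  show "snd c ` G \<times> span (model M) \<subseteq> snd (tchart M c) ` {v \<in> fst (tchart M c). fst v \<in> G}"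
  proof clarsimp
    fix x u assume x: "x \<in> G" and u: "u \<in> span (model M)"
    have cx: "c \<in> charts_at M x" using c G x by (auto simp: charts_at_charts)
    show "(snd c x, u) \<in> snd (tchart M c) ` {v \<in> fst (tchart M c). fst v \<in> G}"
      using cvector_tangent[OF M cx u] snd_cvector[OF M cx u] x G
      by (intro image_eqI[of _ _ "cvector M c x u"]) (auto simp: fst_tchart snd_tchart)
  qed
qed

lemma tchart_image_full:
  assumes M: "satlas M" and c: "c \<in> charts M"
  shows "snd (tchart M c) ` fst (tchart M c) = snd c ` fst c \<times> span (model M)"
  using tchart_image[OF M c order_refl] by (simp add: fst_tchart cong: conj_cong)

lemma tchart_inj:
  assumes M: "satlas M" and c: "c \<in> charts M"
  shows "inj_on (snd (tchart M c)) (fst (tchart M c))"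
proof (rule inj_onI)
  fix v w assume v: "v \<in> fst (tchart M c)" and w: "w \<in> fst (tchart M c)" and eq: "snd (tchart M c) v = snd (tchart M c) w"
  have "fst v = fst w" using eq v w inj_onD[OF charts_inj[OF c]] by (auto simp: fst_tchart snd_tchart)
  then show "v = w"
    using v w eq c by (intro tangent_at_eqI[of v M "fst v" w c]) (auto simp: fst_tchart snd_tchart charts_at_charts)
qed

lemma local_rep_tchart:
  assumes M: "satlas M" and c: "c \<in> charts M" and d: "d \<in> charts M"
    and y: "y \<in> snd c ` (fst c \<inter> fst d)" and u: "u \<in> span (model M)"
  shows "local_rep (tchart M c) (tchart M d) id (y, u) = (local_rep c d id y, pd (model M) (local_rep c d id) u y)"
proof -
  obtain x where x: "x \<in> fst c" "x \<in> fst d" "y = snd c x" using y by blast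
  have cx: "c \<in> charts_at M x" "d \<in> charts_at M x" using c d x by (auto simp: charts_at_charts)
  let ?v = "cvector M c x u"
  have v: "?v \<in> tangent_at M x" "snd ?v c = u" using cvector_tangent[OF M cx(1) u] snd_cvector[OF M cx(1) u] by auto
  have "local_rep (tchart M c) (tchart M d) id (snd (tchart M c) ?v) = snd (tchart M d) ?v"
    using local_rep_apply[OF tchart_inj[OF M c], of ?v "tchart M d" id] v x by (simp add: fst_tchart)
  then show ?thesis using tangent_atD(4)[OF v(1) cx] v x by (simp add: snd_tchart charts_local_rep[OF c])
qed

lemma model_tangent_bundle [simp]: "model (tangent_bundle M) = bundle_model (model M)"
  by (simp add: tangent_bundle_def)

text \<open>By \<open>local_rep_tchart\<close> the transitions are tangent maps of transitions of
  \<open>M\<close>, which are smooth by \<open>smooth_on_tangent\<close>.\<close>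

lemma satlas_tangent_bundle:
  assumes M: "satlas M" shows "satlas (tangent_bundle M)"
proof -
  let ?B = "model M"
  note B = satlas_Basis[OF M]
  have chart: "is_chart (bundle_model ?B) (tchart M c)" if c: "c \<in> charts M" for c
    using tchart_inj[OF M c] opn_bundle[OF charts_opn[OF c]] by (simp add: is_chart_def tchart_image_full[OF M c])
  have half: "opn (bundle_model ?B) (snd (tchart M c) ` (fst (tchart M c) \<inter> fst (tchart M d))) \<and>
      smooth_on (bundle_model ?B) (snd (tchart M c) ` (fst (tchart M c) \<inter> fst (tchart M d))) (local_rep (tchart M c) (tchart M d) id)"
    if c: "c \<in> charts M" and d: "d \<in> charts M" for c d
  proof -
    let ?G = "fst c \<inter> fst d"
    note cd = charts_compatible[OF M c d, unfolded compatible_def]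
    have "fst (tchart M c) \<inter> fst (tchart M d) = {v \<in> fst (tchart M c). fst v \<in> ?G}" by (auto simp: fst_tchart)
    then have eq: "snd (tchart M c) ` (fst (tchart M c) \<inter> fst (tchart M d)) = snd c ` ?G \<times> span ?B"
      using tchart_image[OF M c, of ?G] by simp
    have O: "opn (bundle_model ?B) (snd c ` ?G \<times> span ?B)" using opn_bundle cd by blast
    have "smooth_on (bundle_model ?B) (snd c ` ?G \<times> span ?B)
        (\<lambda>z. (local_rep c d id (fst z), pd ?B (local_rep c d id) (snd z) (fst z)))"
      using cd smooth_on_Pair[OF O smooth_on_fst_comp[OF B, of _ "local_rep c d id"] smooth_on_tangent[OF B, of _ "local_rep c d id"]]
      by blast
    then have "smooth_on (bundle_model ?B) (snd c ` ?G \<times> span ?B) (local_rep (tchart M c) (tchart M d) id)"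
      by (rule smooth_on_congI[OF O]) (auto simp: local_rep_tchart[OF M c d])
    then show ?thesis using O eq by simp
  qed
  have "compatible (bundle_model ?B) (tchart M c) (tchart M d)" if "c \<in> charts M" "d \<in> charts M" for c d
    using half[OF that] half[OF that(2,1)] by (simp add: compatible_def Int_commute)
  then show ?thesis using chart bundle_model_Basis[OF B] by (auto simp: smooth_atlas_def tangent_bundle_def)
qed

lemma tchart_charts: "satlas M \<Longrightarrow> c \<in> charts M \<Longrightarrow> tchart M c \<in> charts (tangent_bundle M)"
  by (rule atlas_charts[OF satlas_tangent_bundle]) (auto simp: tangent_bundle_def)

lemma carrier_tangent_bundle:
  assumes M: "satlas M"
  shows "v \<in> carrier (tangent_bundle M) \<longleftrightarrow> fst v \<in> carrier M \<and> v \<in> tangent_at M (fst v)"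
proof -
  have "v \<in> carrier (tangent_bundle M) \<longleftrightarrow> (\<exists>c\<in>charts M. v \<in> fst (tchart M c))"
    by (auto simp: carrier_def tangent_bundle_def)
  then show ?thesis unfolding carrier_charts_at[OF M, of "fst v"] fst_tchart charts_at_charts by blast
qed

lemma tchart_charts_at:
  assumes "satlas M" "c \<in> charts_at M (fst v)" "v \<in> tangent_at M (fst v)"
  shows "tchart M c \<in> charts_at (tangent_bundle M) v"
  using tchart_charts[OF assms(1)] assms by (auto simp: charts_at_charts fst_tchart)

section \<open>The cotangent bundle\<close>

text \<open>The fibre coordinates p_i in the chart \<open>c\<close>, packed into one vector, so that
  pairing with a tangent vector becomes the Euclidean inner product with its components.\<close>

definition ccomp :: "('a, 'e::euclidean_space) mfd \<Rightarrow> ('a, 'e) chart \<Rightarrow> ('a, 'e) cvec \<Rightarrow> 'e" where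
  "ccomp M c p = (\<Sum>b\<in>model M. snd p (cvector M c (fst p) b) *\<^sub>R b)"

text \<open>The covector p_i dq^i at \<open>x\<close>. The value 0 off the tangent space matches the
  convention of \<open>cotangent_at\<close>.\<close>

definition cov :: "('a, 'e::euclidean_space) mfd \<Rightarrow> ('a, 'e) chart \<Rightarrow> 'a \<Rightarrow> 'e \<Rightarrow> ('a, 'e) cvec" where
  "cov M c x p = (x, \<lambda>v. if v \<in> tangent_at M x then p \<bullet> snd v c else 0)"

lemma fst_cov [simp]: "fst (cov M c x p) = x"
  by (simp add: cov_def)

lemma cotangent_atD:
  assumes "p \<in> cotangent_at M x"
  shows "fst p = x" "v \<in> tangent_at M x \<Longrightarrow> w \<in> tangent_at M x \<Longrightarrow> snd p (tadd v w) = snd p v + snd p w"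
    "v \<in> tangent_at M x \<Longrightarrow> snd p (tscale r v) = r * snd p v" "v \<notin> tangent_at M x \<Longrightarrow> snd p v = 0"
  using assms unfolding cotangent_at_def mem_Collect_eq by blast+

lemma cov_cotangent:
  assumes M: "satlas M"
  shows "cov M c x p \<in> cotangent_at M x"
  unfolding cotangent_at_def cov_def
  using tadd_tangent[OF M] tscale_tangent[OF M] by (auto simp: tadd_def tscale_def inner_add_right)

lemma ccomp_span: "ccomp M c p \<in> span (model M)"
  unfolding ccomp_def by (rule sum_Basis_in_span)

text \<open>A covector respects \<open>tadd\<close> and \<open>tscale\<close>, so composed with
  \<open>cvector\<close> it is linear on the model space. It is then determined by its values on the
  basis, which are the coordinates collected by \<open>ccomp\<close>.\<close>

lemma cotangent_cvector:
  assumes M: "satlas M" and c: "c \<in> charts_at M x" and p: "p \<in> cotangent_at M x" and u: "u \<in> span (model M)"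
  shows "snd p (cvector M c x u) = ccomp M c p \<bullet> u"
proof -
  let ?B = "model M"
  note B = satlas_Basis[OF M]
  define g where "g u = snd p (cvector M c x u)" for u
  have add: "g (u + u') = g u + g u'" if "u \<in> span ?B" "u' \<in> span ?B" for u u'
    using cotangent_atD(2)[OF p cvector_tangent[OF M c that(1)] cvector_tangent[OF M c that(2)]]
    by (simp add: g_def cvector_add[OF M c])
  have scale: "g (r *\<^sub>R u) = r * g u" if "u \<in> span ?B" for r u
    using cotangent_atD(3)[OF p cvector_tangent[OF M c that]] by (simp add: g_def cvector_scale[OF M c])
  have fin: "finite ?B" by (rule finite_subset[OF B finite_Basis])
  have "g (\<Sum>b\<in>F. r b *\<^sub>R b) = (\<Sum>b\<in>F. r b * g b)" if "F \<subseteq> ?B" for F r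
    using finite_subset[OF that fin] that
  proof (induction F rule: finite_induct)
    case empty
    show ?case using scale[OF span_zero, of 0] by simp
  next
    case (insert b F)
    have "b \<in> span ?B" using insert.prems by (simp add: span_base)
    moreover have "(\<Sum>b\<in>F. r b *\<^sub>R b) \<in> span ?B"
      using insert.prems by (intro span_sum span_scale span_base) auto
    ultimately show ?case using insert add scale by (simp add: span_scale)
  qed
  from this[OF order_refl, of "\<lambda>b. u \<bullet> b"]
  have "g u = (\<Sum>b\<in>?B. (u \<bullet> b) * g b)" unfolding span_expand[OF B u] .
  also have "\<dots> = (\<Sum>b\<in>?B. (ccomp M c p \<bullet> b) * (u \<bullet> b))"
    using inner_sum_Basis[OF B] cotangent_atD(1)[OF p]
    by (intro sum.cong) (auto simp: ccomp_def g_def)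
  also have "\<dots> = ccomp M c p \<bullet> u" by (rule inner_span_expand[OF B u, symmetric])
  finally show ?thesis by (simp add: g_def)
qed

lemma cotangent_eval:
  assumes M: "satlas M" and c: "c \<in> charts_at M x" and p: "p \<in> cotangent_at M x" and v: "v \<in> tangent_at M x"
  shows "snd p v = ccomp M c p \<bullet> snd v c"
  using cotangent_cvector[OF M c p tangent_atD(2)[OF v c]] cvector_snd[OF M c v] by simp

lemma cotangent_eqI:
  assumes M: "satlas M" and c: "c \<in> charts_at M x" and p: "p \<in> cotangent_at M x" and q: "q \<in> cotangent_at M x"
    and eq: "ccomp M c p = ccomp M c q"
  shows "p = q"
proof -
  have "snd p v = snd q v" for v
    using cotangent_eval[OF M c p] cotangent_eval[OF M c q] eq cotangent_atD(4)[OF p] cotangent_atD(4)[OF q]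
    by (cases "v \<in> tangent_at M x") auto
  then show ?thesis using cotangent_atD(1)[OF p] cotangent_atD(1)[OF q] by (auto simp: prod_eq_iff)
qed

lemma ccomp_cov:
  assumes M: "satlas M" and c: "c \<in> charts_at M x" and p: "p \<in> span (model M)"
  shows "ccomp M c (cov M c x p) = p"
proof (rule span_eqI[OF satlas_Basis[OF M] ccomp_span p])
  fix b assume b: "b \<in> model M"
  have "ccomp M c (cov M c x p) \<bullet> b = snd (cov M c x p) (cvector M c x b)"
    by (rule cotangent_cvector[OF M c cov_cotangent[OF M] span_base[OF b], symmetric])
  then show "ccomp M c (cov M c x p) \<bullet> b = p \<bullet> b"
    using cvector_tangent[OF M c span_base[OF b]] snd_cvector[OF M c span_base[OF b]] by (simp add: cov_def)
qed

text \<open>Both sides evaluate \<open>p\<close> on one and the same tangent vector, the one with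
  components \<open>u\<close> in the chart \<open>d\<close>.\<close>

lemma ccomp_transform:
  assumes M: "satlas M" and c: "c \<in> charts_at M x" and d: "d \<in> charts_at M x" and p: "p \<in> cotangent_at M x"
    and u: "u \<in> span (model M)"
  shows "ccomp M d p \<bullet> u = ccomp M c p \<bullet> pd (model M) (local_rep d c id) u (snd d x)"
proof -
  note v = cvector_tangent[OF M d u]
  show ?thesis
    using cotangent_eval[OF M c p v] cotangent_eval[OF M d p v] tangent_atD(4)[OF v d c] snd_cvector[OF M d u] by simp
qed

lemma fst_cchart: "fst (cchart M c) = {p. fst p \<in> fst c \<and> p \<in> cotangent_at M (fst p)}"
  by (auto simp: cchart_def dest: cotangent_atD(1))

lemma snd_cchart: "snd (cchart M c) p = (snd c (fst p), ccomp M c p)"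
  by (simp add: cchart_def ccomp_def)

lemma cchart_image:
  assumes M: "satlas M" and c: "c \<in> charts M" and G: "G \<subseteq> fst c"
  shows "snd (cchart M c) ` {p \<in> fst (cchart M c). fst p \<in> G} = snd c ` G \<times> span (model M)"
proof
  show "snd (cchart M c) ` {p \<in> fst (cchart M c). fst p \<in> G} \<subseteq> snd c ` G \<times> span (model M)"
    by (auto simp: fst_cchart snd_cchart ccomp_span)
  show "snd c ` G \<times> span (model M) \<subseteq> snd (cchart M c) ` {p \<in> fst (cchart M c). fst p \<in> G}"
  proof clarsimp
    fix x u assume x: "x \<in> G" and u: "u \<in> span (model M)"
    have cx: "c \<in> charts_at M x" using c G x by (auto simp: charts_at_charts)
    show "(snd c x, u) \<in> snd (cchart M c) ` {p \<in> fst (cchart M c). fst p \<in> G}"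
      using cov_cotangent[OF M, of c x u] ccomp_cov[OF M cx u] x G
      by (intro image_eqI[of _ _ "cov M c x u"]) (auto simp: fst_cchart snd_cchart)
  qed
qed

lemma cchart_image_full:
  assumes M: "satlas M" and c: "c \<in> charts M"
  shows "snd (cchart M c) ` fst (cchart M c) = snd c ` fst c \<times> span (model M)"
  using cchart_image[OF M c order_refl] by (simp add: fst_cchart cong: conj_cong)

lemma cchart_inj:
  assumes M: "satlas M" and c: "c \<in> charts M"
  shows "inj_on (snd (cchart M c)) (fst (cchart M c))"
proof (rule inj_onI)
  fix p q assume p: "p \<in> fst (cchart M c)" and q: "q \<in> fst (cchart M c)" and eq: "snd (cchart M c) p = snd (cchart M c) q"
  have "fst p = fst q" using eq p q inj_onD[OF charts_inj[OF c]] by (auto simp: fst_cchart snd_cchart)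
  then show "p = q"
    using p q eq c by (intro cotangent_eqI[OF M, of c "fst p" p q]) (auto simp: fst_cchart snd_cchart charts_at_charts)
qed

lemma inv_cchart:
  assumes M: "satlas M" and c: "c \<in> charts_at M x" and p: "p \<in> span (model M)"
  shows "inv_into (fst (cchart M c)) (snd (cchart M c)) (snd c x, p) = cov M c x p"
proof -
  have c': "c \<in> charts M" "x \<in> fst c" using c by (auto simp: charts_at_charts)
  have "snd (cchart M c) (cov M c x p) = (snd c x, p)" using ccomp_cov[OF M c p] by (simp add: snd_cchart)
  moreover have "cov M c x p \<in> fst (cchart M c)" using cov_cotangent[OF M] c' by (simp add: fst_cchart)
  ultimately show ?thesis using inv_into_f_f[OF cchart_inj[OF M c'(1)]] by metis
qed

text \<open>Fibre coordinates change by the transposed Jacobian of the inverse coordinate change,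
  taken at the image point; this is \<open>ccomp_transform\<close> read on basis vectors.\<close>

lemma local_rep_cchart:
  assumes M: "satlas M" and c: "c \<in> charts M" and d: "d \<in> charts M"
    and y: "y \<in> snd c ` (fst c \<inter> fst d)" and u: "u \<in> span (model M)"
  shows "local_rep (cchart M c) (cchart M d) id (y, u) =
    (local_rep c d id y, \<Sum>b\<in>model M. (u \<bullet> pd (model M) (local_rep d c id) b (local_rep c d id y)) *\<^sub>R b)"
proof -
  obtain x where x: "x \<in> fst c" "x \<in> fst d" "y = snd c x" using y by blast
  have cx: "c \<in> charts_at M x" "d \<in> charts_at M x" using c d x by (auto simp: charts_at_charts)
  let ?p = "cov M c x u"
  have p: "?p \<in> cotangent_at M x" "ccomp M c ?p = u" using cov_cotangent[OF M] ccomp_cov[OF M cx(1) u] by auto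
  have "local_rep (cchart M c) (cchart M d) id (snd (cchart M c) ?p) = snd (cchart M d) ?p"
    using local_rep_apply[OF cchart_inj[OF M c], of ?p "cchart M d" id] p x by (simp add: fst_cchart)
  moreover have "ccomp M d ?p = (\<Sum>b\<in>model M. (u \<bullet> pd (model M) (local_rep d c id) b (snd d x)) *\<^sub>R b)"
    using ccomp_transform[OF M cx p(1)] p(2) span_base inner_sum_Basis[OF satlas_Basis[OF M]]
    by (intro span_eqI[OF satlas_Basis[OF M] ccomp_span sum_Basis_in_span]) auto
  ultimately show ?thesis using p x by (simp add: snd_cchart charts_local_rep[OF c])
qed

lemma model_cotangent_bundle [simp]: "model (cotangent_bundle M) = bundle_model (model M)"
  by (simp add: cotangent_bundle_def)

lemma satlas_cotangent_bundle:
  assumes M: "satlas M" shows "satlas (cotangent_bundle M)"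
proof -
  let ?B = "model M"
  note B = satlas_Basis[OF M]
  have chart: "is_chart (bundle_model ?B) (cchart M c)" if c: "c \<in> charts M" for c
    using cchart_inj[OF M c] opn_bundle[OF charts_opn[OF c]] by (simp add: is_chart_def cchart_image_full[OF M c])
  have half: "opn (bundle_model ?B) (snd (cchart M c) ` (fst (cchart M c) \<inter> fst (cchart M d))) \<and>
      smooth_on (bundle_model ?B) (snd (cchart M c) ` (fst (cchart M c) \<inter> fst (cchart M d))) (local_rep (cchart M c) (cchart M d) id)"
    if c: "c \<in> charts M" and d: "d \<in> charts M" for c d
  proof -
    let ?G = "fst c \<inter> fst d"
    note cd = charts_compatible[OF M c d, unfolded compatible_def]
    have "fst (cchart M c) \<inter> fst (cchart M d) = {v \<in> fst (cchart M c). fst v \<in> ?G}" by (auto simp: fst_cchart)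
    then have eq: "snd (cchart M c) ` (fst (cchart M c) \<inter> fst (cchart M d)) = snd c ` ?G \<times> span ?B"
      using cchart_image[OF M c, of ?G] by simp
    have O1: "opn ?B (snd c ` ?G)" and s1: "smooth_on ?B (snd c ` ?G) (local_rep c d id)"
      and O2: "opn ?B (snd d ` ?G)" and s2: "smooth_on ?B (snd d ` ?G) (local_rep d c id)" using cd by auto
    have O: "opn (bundle_model ?B) (snd c ` ?G \<times> span ?B)" using opn_bundle[OF O1] .
    have "smooth_on ?B (snd c ` ?G) (\<lambda>y. pd ?B (local_rep d c id) b (local_rep c d id y))" if b: "b \<in> ?B" for b
      by (rule smooth_on_compose[OF B B O1 openin_imp_subset[OF O2] smooth_on_pd_Basis[OF s2 b] s1])
        (auto simp: charts_local_rep[OF c])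
    then have "smooth_on (bundle_model ?B) (snd c ` ?G \<times> span ?B)
        (\<lambda>z. (local_rep c d id (fst z), \<Sum>b\<in>?B. (snd z \<bullet> pd ?B (local_rep d c id) b (local_rep c d id (fst z))) *\<^sub>R b))"
      by (intro smooth_on_Pair[OF O] smooth_on_sum[OF O] smooth_on_scaleR[OF O] smooth_on_inner[OF O]
          smooth_on_snd_proj smooth_on_fst_comp[where f = "local_rep c d id"]
          smooth_on_fst_comp[where f = "\<lambda>y. pd ?B (local_rep d c id) b (local_rep c d id y)" for b]
          smooth_on_const[OF O] bundle_model_Basis B O1 s1) auto
    then have "smooth_on (bundle_model ?B) (snd c ` ?G \<times> span ?B) (local_rep (cchart M c) (cchart M d) id)"
      by (rule smooth_on_congI[OF O]) (auto simp: local_rep_cchart[OF M c d])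
    then show ?thesis using O eq by simp
  qed
  have "compatible (bundle_model ?B) (cchart M c) (cchart M d)" if "c \<in> charts M" "d \<in> charts M" for c d
    using half[OF that] half[OF that(2,1)] by (simp add: compatible_def Int_commute)
  then show ?thesis using chart bundle_model_Basis[OF B] by (auto simp: smooth_atlas_def cotangent_bundle_def)
qed

lemma cchart_charts: "satlas M \<Longrightarrow> c \<in> charts M \<Longrightarrow> cchart M c \<in> charts (cotangent_bundle M)"
  by (rule atlas_charts[OF satlas_cotangent_bundle]) (auto simp: cotangent_bundle_def)

lemma carrier_cotangent_bundle:
  assumes M: "satlas M"
  shows "p \<in> carrier (cotangent_bundle M) \<longleftrightarrow> fst p \<in> carrier M \<and> p \<in> cotangent_at M (fst p)"
proof -
  have "p \<in> carrier (cotangent_bundle M) \<longleftrightarrow> (\<exists>c\<in>charts M. p \<in> fst (cchart M c))"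
    by (auto simp: carrier_def cotangent_bundle_def)
  then show ?thesis unfolding carrier_charts_at[OF M, of "fst p"] fst_cchart charts_at_charts by blast
qed

lemma cchart_charts_at:
  assumes "satlas M" "c \<in> charts_at M (fst p)" "p \<in> cotangent_at M (fst p)"
  shows "cchart M c \<in> charts_at (cotangent_bundle M) p"
  using cchart_charts[OF assms(1)] assms by (auto simp: charts_at_charts fst_cchart)

section \<open>Second order calculus\<close>

lemma pd_Pair:
  assumes "f differentiable (at y within span B)" "g differentiable (at y within span B)" "y \<in> span B" "u \<in> span B"
  shows "pd B (\<lambda>z. (f z, g z)) u y = (pd B f u y, pd B g u y)"
  by (rule pd_eqI[OF has_derivative_Pair[OF pd_works[OF assms(1)] pd_works[OF assms(2)]] assms(3,4)])

lemma opn_span_self: "opn B (span B)"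
  by simp

text \<open>The Jacobian of the tangent map of \<open>f\<close>. In a direction
  \<open>(j, k)\<close>, the part \<open>j\<close> moves the base point and produces a second
  derivative, while \<open>k\<close> enters linearly. Symmetry is used to make \<open>u\<close> the
  outer direction, the order in which second derivatives appear in
  \<open>pd_covector_transform\<close>.\<close>

lemma pd_tangent_rep:
  fixes f :: "'e::euclidean_space \<Rightarrow> 'f::euclidean_space"
  assumes B: "B \<subseteq> Basis" and S: "opn B S" and f: "smooth_on B S f" and y: "y \<in> S"
    and u: "u \<in> span B" and j: "j \<in> span B" and k: "k \<in> span B"
  shows "pd (bundle_model B) (\<lambda>z. (f (fst z), pd B f (snd z) (fst z))) (j, k) (y, u) =
    (pd B f j y, pd B (pd B f j) u y + pd B f k y)"
proof -
  let ?BB = "bundle_model B" and ?S = "S \<times> span B"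
  define g where "g z = pd B f (snd z) (fst z)" for z
  have yB: "y \<in> span B" using opn_span[OF S y] .
  have O: "opn ?BB ?S" using opn_bundle[OF S] .
  have in_S: "(y, u) \<in> ?S" using y u by simp
  have sp: "(y, u) \<in> span ?BB" "(j, k) \<in> span ?BB" "(j, 0) \<in> span ?BB" "(0, k) \<in> span ?BB"
    using yB u j k by (auto simp: span_bundle_model span_zero)
  have gs: "smooth_on ?BB ?S g" unfolding g_def by (rule smooth_on_tangent[OF B S f])
  have fs: "smooth_on ?BB ?S (\<lambda>z. f (fst z))" by (rule smooth_on_fst_comp[OF B S f])
  note gd = smooth_on_differentiable[OF gs in_S] and fd = smooth_on_differentiable[OF fs in_S]
  have "pd ?BB (\<lambda>z. f (fst z)) (j, k) (y, u) = pd B f (pd ?BB fst (j, k) (y, u)) (fst (y, u))"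
    using smooth_on_differentiable[OF f y] y
    by (intro pd_compose[OF O in_S _ _ _ sp(2)])
      (auto intro: opn_span[OF S] bounded_linear_imp_differentiable bounded_linear_fst)
  then have 1: "pd ?BB (\<lambda>z. f (fst z)) (j, k) (y, u) = pd B f j y"
    using pd_bounded_linear[OF bounded_linear_fst sp(1,2)] by simp
  have ysm: "smooth_on B S (\<lambda>z. (z, u))" "smooth_on B (span B) (\<lambda>z. (y, z))"
    by (intro smooth_on_Pair S opn_span_self smooth_on_ident smooth_on_const B)+
  have idd: "(\<lambda>z. z) differentiable (at x within span B)" for x :: 'e
    by (simp add: bounded_linear_imp_differentiable)
  have cd: "(\<lambda>z. c) differentiable (at x within span B)" for x c :: 'e by simp
  have d1: "pd B (\<lambda>z. (z, u)) j y = (j, 0)"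
    using pd_Pair[OF idd cd yB j] pd_bounded_linear[OF bounded_linear_ident yB j] pd_const[OF yB j] by simp
  have d2: "pd B (\<lambda>z. (y, z)) k u = (0, k)"
    using pd_Pair[OF cd idd u k] pd_bounded_linear[OF bounded_linear_ident u k] pd_const[OF u k] by simp
  \<comment> \<open>With one argument frozen, each partial derivative on the bundle becomes a
    derivative on \<open>span B\<close>.\<close>
  have "pd B (\<lambda>y. g (y, u)) j y = pd ?BB g (pd B (\<lambda>z. (z, u)) j y) (y, u)"
    by (rule pd_compose[OF S y _ smooth_on_differentiable[OF ysm(1) y] gd j])
      (use u opn_span[OF S] in \<open>auto simp: span_bundle_model\<close>)
  then have 2: "pd ?BB g (j, 0) (y, u) = pd B (pd B f j) u y"
    using pd_symmetric[OF S B f y u j] by (simp add: d1 g_def)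
  have "pd B (\<lambda>z. g (y, z)) k u = pd ?BB g (pd B (\<lambda>z. (y, z)) k u) (y, u)"
    by (rule pd_compose[OF opn_span_self u _ smooth_on_differentiable[OF ysm(2) u] gd k])
      (use yB in \<open>auto simp: span_bundle_model\<close>)
  moreover have "pd B (\<lambda>z. g (y, z)) k u = pd B f k y"
    unfolding g_def fst_conv snd_conv
    by (rule pd_bounded_linear[OF has_derivative_bounded_linear[OF pd_works[OF smooth_on_differentiable[OF f y]]] u k])
  ultimately have 3: "pd ?BB g (0, k) (y, u) = pd B f k y" by (simp add: d2)
  have "pd ?BB g (j, k) (y, u) = pd ?BB g ((j, 0) + (0, k)) (y, u)" by simp
  also have "\<dots> = pd B (pd B f j) u y + pd B f k y" unfolding pd_add_dir[OF gd] 2 3 ..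
  finally have "pd ?BB g (j, k) (y, u) = pd B (pd B f j) u y + pd B f k y" .
  then have "pd ?BB (\<lambda>z. (f (fst z), g z)) (j, k) (y, u) = (pd B f j y, pd B (pd B f j) u y + pd B f k y)"
    using pd_Pair[OF fd gd sp(1,2)] 1 by simp
  then show ?thesis by (simp add: g_def)
qed

text \<open>The fibre coordinates of a covector field along \<open>q\<close> in two charts related by \<open>h\<close>.\<close>

lemma pd_covector_transform:
  fixes h :: "'b::euclidean_space \<Rightarrow> 'c::euclidean_space" and P0 :: "'e::euclidean_space \<Rightarrow> 'b"
  assumes K: "K \<subseteq> Basis" and V: "opn K V" and B: "B \<subseteq> Basis" and U: "opn B U"
    and q: "smooth_on K V q" "\<And>y. y \<in> V \<Longrightarrow> q y \<in> U" and h: "smooth_on B U h"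
    and P1: "smooth_on K V P1" and P0: "smooth_on K V P0"
    and eq: "\<And>y. y \<in> V \<Longrightarrow> P0 y \<bullet> j = P1 y \<bullet> pd B h j (q y)"
    and y: "y \<in> V" and g: "g \<in> span K" and j: "j \<in> span B"
  shows "pd K P0 g y \<bullet> j = pd K P1 g y \<bullet> pd B h j (q y) + P1 y \<bullet> pd B (pd B h j) (pd K q g y) (q y)"
proof -
  have yK: "y \<in> span K" using opn_span[OF V y] .
  have hs: "smooth_on B U (pd B h j)" by (rule smooth_on_pd[OF U B h j])
  have hq: "smooth_on K V (\<lambda>y. pd B h j (q y))"
    by (rule smooth_on_compose[OF K B V openin_imp_subset[OF U] hs q])
  note d = smooth_on_differentiable[OF _ y]
  have "pd K P0 g y \<bullet> j = pd K (\<lambda>y. P0 y \<bullet> j) g y"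
    using pd_linear_image[OF bounded_linear_inner_left d[OF P0] yK g] by simp
  also have "\<dots> = pd K (\<lambda>y. P1 y \<bullet> pd B h j (q y)) g y"
    by (rule pd_cong[OF V y eq])
  also have "\<dots> = P1 y \<bullet> pd K (\<lambda>y. pd B h j (q y)) g y + pd K P1 g y \<bullet> pd B h j (q y)"
    by (rule pd_inner[OF d[OF P1] d[OF hq] yK g])
  also have "pd K (\<lambda>y. pd B h j (q y)) g y = pd B (pd B h j) (pd K q g y) (q y)"
    by (rule pd_compose[OF V y _ d[OF q(1)] smooth_on_differentiable[OF hs q(2)[OF y]] g])
      (use q(2) opn_span[OF U] in blast)
  finally show ?thesis by simp
qed

section \<open>Euler-Lagrange equations along a second order field\<close>

lemma pd_bundle_expand:
  assumes "f differentiable (at y within span (bundle_model B))" "B \<subseteq> Basis" "u \<in> span B" "A \<in> span B"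
  shows "pd (bundle_model B) f (u, A) y = (\<Sum>b\<in>B. (u \<bullet> b) *\<^sub>R pd (bundle_model B) f (b, 0) y + (A \<bullet> b) *\<^sub>R pd (bundle_model B) f (0, b) y)"
proof -
  interpret linear "\<lambda>u. pd (bundle_model B) f u y" using pd_linear[OF assms(1)] .
  have "(u, A) = (\<Sum>b\<in>B. (u \<bullet> b) *\<^sub>R (b, 0) + (A \<bullet> b) *\<^sub>R (0, b))"
  proof (rule prod_eqI)
    show "fst (u, A) = fst (\<Sum>b\<in>B. (u \<bullet> b) *\<^sub>R (b, 0::'a) + (A \<bullet> b) *\<^sub>R (0, b))"
      by (simp add: fst_sum span_expand[OF assms(2,3)])
    show "snd (u, A) = snd (\<Sum>b\<in>B. (u \<bullet> b) *\<^sub>R (b, 0::'a) + (A \<bullet> b) *\<^sub>R (0, b))"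
      by (simp add: snd_sum span_expand[OF assms(2,4)])
  qed
  then have "pd (bundle_model B) f (u, A) y = pd (bundle_model B) f (\<Sum>b\<in>B. (u \<bullet> b) *\<^sub>R (b, 0) + (A \<bullet> b) *\<^sub>R (0, b)) y"
    by simp
  then show ?thesis by (simp only: sum add scale)
qed

text \<open>The acceleration \<open>A\<close> enters both sides through the same Hessian term. Their
  difference therefore does not depend on \<open>A\<close>, and the whole family of equations
  reduces to one: the derivative of dL/dq'^a in the direction \<open>(q', g)\<close> equals
  dL/dq^a.\<close>

lemma Euler_Lagrange_iff:
  fixes L :: "'e::euclidean_space \<times> 'e \<Rightarrow> real"
  assumes B: "B \<subseteq> Basis" and Y: "opn (bundle_model B) Y" and L: "smooth_on (bundle_model B) Y L" and y: "y \<in> Y"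
    and g: "g \<in> span B" and a: "a \<in> B"
  shows "(\<forall>A\<in>span B. (\<Sum>b\<in>B. dv B b (dv B a L) y * (A \<bullet> b - g \<bullet> b)) = ddt B (dv B a L) y A - dq B a L y)
    \<longleftrightarrow> dq B a L y = pd (bundle_model B) (dv B a L) (snd y, g) y"
proof -
  let ?BB = "bundle_model B"
  have BB: "?BB \<subseteq> Basis" using bundle_model_Basis[OF B] .
  have "(0, a) \<in> span ?BB" using a by (auto simp: span_bundle_model span_base span_zero)
  then have "smooth_on ?BB Y (dv B a L)" unfolding dv_def by (rule smooth_on_pd[OF Y BB L])
  note d = smooth_on_differentiable[OF this y]
  have yB: "snd y \<in> span B" using opn_span[OF Y y] by (auto simp: span_bundle_model)
  have "pd ?BB (dv B a L) (snd y, g) y = (\<Sum>b\<in>B. (snd y \<bullet> b) * dq B b (dv B a L) y + (g \<bullet> b) * dv B b (dv B a L) y)"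
    using pd_bundle_expand[OF d B yB g] by (simp add: dq_def dv_def)
  moreover have "ddt B (dv B a L) y A - (\<Sum>b\<in>B. dv B b (dv B a L) y * (A \<bullet> b - g \<bullet> b)) =
      (\<Sum>b\<in>B. (snd y \<bullet> b) * dq B b (dv B a L) y + (g \<bullet> b) * dv B b (dv B a L) y)" for A
    unfolding ddt_def sum_subtractf[symmetric] by (rule sum.cong) (auto simp: algebra_simps)
  ultimately have *: "ddt B (dv B a L) y A - (\<Sum>b\<in>B. dv B b (dv B a L) y * (A \<bullet> b - g \<bullet> b)) =
      pd ?BB (dv B a L) (snd y, g) y" for A by simp
  show ?thesis
  proof
    assume "\<forall>A\<in>span B. (\<Sum>b\<in>B. dv B b (dv B a L) y * (A \<bullet> b - g \<bullet> b)) = ddt B (dv B a L) y A - dq B a L y"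
    from bspec[OF this span_zero] show "dq B a L y = pd ?BB (dv B a L) (snd y, g) y" using *[of 0] by linarith
  next
    assume eq: "dq B a L y = pd ?BB (dv B a L) (snd y, g) y"
    show "\<forall>A\<in>span B. (\<Sum>b\<in>B. dv B b (dv B a L) y * (A \<bullet> b - g \<bullet> b)) = ddt B (dv B a L) y A - dq B a L y"
    proof
      fix A
      show "(\<Sum>b\<in>B. dv B b (dv B a L) y * (A \<bullet> b - g \<bullet> b)) = ddt B (dv B a L) y A - dq B a L y"
        using *[of A] eq by linarith
    qed
  qed
qed

section \<open>Invertible matrices\<close>

text \<open>An injective linear map of \<open>span B\<close> into itself is onto by dimension, so
  its linear left inverse is two-sided. The matrix of that inverse in the basis \<open>B\<close> is
  the witness.\<close>

lemma invertible_onI: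
  fixes h :: "'e::euclidean_space \<Rightarrow> 'e"
  assumes B: "B \<subseteq> Basis" and h: "linear h" and hB: "h ` span B \<subseteq> span B"
    and inj: "\<And>u. u \<in> span B \<Longrightarrow> h u = 0 \<Longrightarrow> u = 0"
  shows "invertible_on B (\<lambda>a b. h b \<bullet> a)"
proof -
  have inj': "inj_on h (span B)"
    using inj linear_injective_on_subspace_0[OF h subspace_span] by blast
  have inj2: "inj_on h (span (span B))" using inj' by (simp add: span_span)
  have surj: "h ` span B = span B"
    by (rule subspace_dim_equal)
      (use hB dim_image_eq[OF h inj2] linear_subspace_image[OF h subspace_span] in auto)
  obtain k where k: "range k \<subseteq> span B" "linear k" "\<And>u. u \<in> span B \<Longrightarrow> k (h u) = u"
    using linear_exists_left_inverse_on[OF h subspace_span inj'] by blast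
  have hk: "h (k u) = u" if "u \<in> span B" for u using k(3) surj that by (metis imageE)
  have exp: "(\<Sum>j\<in>B. (f j \<bullet> a) * (w \<bullet> j)) = f w \<bullet> a" if "linear f" "w \<in> span B" for f :: "'e \<Rightarrow> 'e" and w a
  proof -
    have "f w \<bullet> a = f (\<Sum>j\<in>B. (w \<bullet> j) *\<^sub>R j) \<bullet> a" by (simp add: span_expand[OF B that(2)])
    then show ?thesis by (simp add: linear_sum[OF that(1)] linear_cmul[OF that(1)] inner_sum_left mult.commute)
  qed
  have delta: "b \<bullet> a = (if a = b then 1 else 0)" if "a \<in> B" "b \<in> B" for a b
    using that B by (auto simp: inner_Basis subset_iff)
  show ?thesis unfolding invertible_on_def
  proof (intro exI[of _ "\<lambda>a b. k b \<bullet> a"] ballI conjI)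
    fix a b assume ab: "a \<in> B" "b \<in> B"
    have "k b \<in> span B" "h b \<in> span B" using k(1) hB span_base[OF ab(2)] by auto
    then show "(\<Sum>j\<in>B. h j \<bullet> a * (k b \<bullet> j)) = (if a = b then 1 else 0)"
      "(\<Sum>j\<in>B. k j \<bullet> a * (h b \<bullet> j)) = (if a = b then 1 else 0)"
      using exp[OF h, of "k b" a] exp[OF k(2), of "h b" a] hk[OF span_base[OF ab(2)]]
        k(3)[OF span_base[OF ab(2)]] delta[OF ab] by auto
  qed
qed

text \<open>Applying the left inverse matrix to the coordinates of \<open>h u\<close> recovers the
  coordinates of \<open>u\<close>.\<close>

lemma invertible_onD:
  fixes h :: "'e::euclidean_space \<Rightarrow> 'e"
  assumes B: "B \<subseteq> Basis" and h: "linear h" and inv: "invertible_on B (\<lambda>a b. h b \<bullet> a)"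
    and u: "u \<in> span B" "h u = 0"
  shows "u = 0"
proof -
  obtain K where K: "\<And>a b. a \<in> B \<Longrightarrow> b \<in> B \<Longrightarrow> (\<Sum>j\<in>B. K a j * (h b \<bullet> j)) = (if a = b then 1 else 0)"
    using inv unfolding invertible_on_def by blast
  have fin: "finite B" by (rule finite_subset[OF B finite_Basis])
  have "u \<bullet> c = 0" if c: "c \<in> B" for c
  proof -
    have "h u = (\<Sum>b\<in>B. (u \<bullet> b) *\<^sub>R h b)"
      using arg_cong[OF span_expand[OF B u(1)], of h] by (simp add: linear_sum[OF h] linear_cmul[OF h])
    from arg_cong[OF this, of "\<lambda>w. w \<bullet> j" for j]
    have hu: "(\<Sum>b\<in>B. (u \<bullet> b) * (h b \<bullet> j)) = 0" for j using u(2) by (simp add: inner_sum_left)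
    have "u \<bullet> c = (\<Sum>b\<in>B. (if c = b then 1 else 0) * (u \<bullet> b))" 
      using c fin by (subst sum.cong[of B B _ "\<lambda>b. if c = b then u \<bullet> b else 0"]) auto
    also have "\<dots> = (\<Sum>b\<in>B. (\<Sum>j\<in>B. K c j * (h b \<bullet> j)) * (u \<bullet> b))" using K[OF c] by simp
    also have "\<dots> = (\<Sum>b\<in>B. \<Sum>j\<in>B. K c j * ((u \<bullet> b) * (h b \<bullet> j)))"
      by (simp add: sum_distrib_left mult_ac)
    also have "\<dots> = (\<Sum>j\<in>B. K c j * (\<Sum>b\<in>B. (u \<bullet> b) * (h b \<bullet> j)))"
      by (subst sum.swap) (simp add: sum_distrib_left)
    finally show ?thesis by (simp add: hu)
  qed
  then show ?thesis by (intro span_eqI[OF B u(1) span_zero]) auto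
qed

section \<open>The Poincare lemma\<close>

text \<open>For \<open>K \<subseteq> Basis\<close> this is the orthogonal projection of the ambient
  space onto \<open>span K\<close>.\<close>

definition cproj :: "'e::euclidean_space set \<Rightarrow> 'e \<Rightarrow> 'e" where
  "cproj K u = (\<Sum>b\<in>K. (u \<bullet> b) *\<^sub>R b)"

lemma bounded_linear_cproj: "bounded_linear (cproj K)"
  unfolding cproj_def
  by (intro bounded_linear_sum bounded_linear_scaleR_left[THEN bounded_linear_compose[of _ "\<lambda>u. u \<bullet> b" for b]]
      bounded_linear_inner_left)

lemma cproj_span: "cproj K u \<in> span K"
  unfolding cproj_def by (rule sum_Basis_in_span)

lemma cproj_ident: "K \<subseteq> Basis \<Longrightarrow> u \<in> span K \<Longrightarrow> cproj K u = u"
  unfolding cproj_def by (rule span_expand)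

text \<open>A derivative within \<open>span K\<close> is arbitrary off \<open>span K\<close>; precomposing with the projection makes it depend
  continuously on the point as a bounded linear map, which differentiation under the integral sign needs.\<close>

lemma has_derivative_cproj:
  assumes "K \<subseteq> Basis" "(f has_derivative f') (at y within span K)" "y \<in> span K"
  shows "(f has_derivative (\<lambda>u. f' (cproj K u))) (at y within span K)"
proof -
  have "((\<lambda>z. f (cproj K z)) has_derivative (\<lambda>u. f' (cproj K u))) (at y within span K)"
    by (rule has_derivative_compose_opn[OF opn_span_self assms(3) _ bounded_linear_imp_has_derivative[OF bounded_linear_cproj]])
      (use assms(2) cproj_span in \<open>auto simp: cproj_ident[OF assms(1,3)]\<close>)
  then show ?thesis
    using has_derivative_opn_cong[OF opn_span_self assms(3), of "\<lambda>z. f (cproj K z)" f] cproj_ident[OF assms(1)] by auto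
qed

text \<open>The one-form with components \<open>a\<close> is integrated along the segments issuing
  from \<open>y0\<close>. The integral is differentiated under the integral sign, and closedness
  turns the result into the integral of a total derivative in the segment parameter.\<close>

lemma Poincare_lemma:
  fixes a :: "'e::euclidean_space \<Rightarrow> 'e"
  assumes K: "K \<subseteq> Basis" and V: "opn K V" and y0: "y0 \<in> V" and a: "smooth_on K V a"
    and closed: "\<And>y u v. y \<in> V \<Longrightarrow> u \<in> span K \<Longrightarrow> v \<in> span K \<Longrightarrow>
      pd K (\<lambda>y. a y \<bullet> u) v y = pd K (\<lambda>y. a y \<bullet> v) u y"
  shows "\<exists>V' l. opn K V' \<and> y0 \<in> V' \<and> V' \<subseteq> V \<and> smooth_on K V' l \<and>
    (\<forall>y\<in>V'. \<forall>u\<in>span K. pd K l u y = a y \<bullet> u)"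
proof -
  obtain T where T: "open T" "V = span K \<inter> T" using V by (auto simp: openin_open)
  obtain e where e: "e > 0" "ball y0 e \<subseteq> T" using T y0 openE by blast
  \<comment> \<open>A ball meets \<open>span K\<close> in a convex set, so every segment from
    \<open>y0\<close> to one of its points stays inside.\<close>
  define U where "U = span K \<inter> ball y0 e"
  have UV: "U \<subseteq> V" and y0U: "y0 \<in> U" and U: "opn K U"
    using e T y0 by (auto simp: U_def openin_open)
  have convU: "convex U"
    unfolding U_def by (intro convex_Int subspace_imp_convex subspace_span convex_ball)
  have y0K: "y0 \<in> span K" using opn_span[OF V y0] .
  define m where "m y s = y0 + s *\<^sub>R (y - y0)" for y and s :: real
  have mU: "m y s \<in> U" if "y \<in> U" "s \<in> {0..1}" for y s
  proof -
    have "(1 - s) *\<^sub>R y0 + s *\<^sub>R y \<in> U" using convU y0U that by (intro convexD) auto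
    then show ?thesis by (simp add: m_def algebra_simps)
  qed
  define f where "f y s = a (m y s) \<bullet> (y - y0)" for y s
  \<comment> \<open>The derivative of \<open>f y s\<close> with respect to \<open>y\<close> in the
    direction \<open>u\<close>; the factor \<open>s\<close> is the derivative of
    \<open>m y s\<close>.\<close>
  define D where "D y s u = s * (pd K a u (m y s) \<bullet> (y - y0)) + a (m y s) \<bullet> u" for y s u
  have ad: "a differentiable (at (m y s) within span K)" if "y \<in> U" "s \<in> {0..1}" for y s
    using smooth_on_differentiable[OF a] mU[OF that] UV by blast
  have fD: "((\<lambda>y. f y s) has_derivative D y s) (at y within span K)" if y: "y \<in> U" and s: "s \<in> {0..1}" for y s
  proof -
    have "((\<lambda>y. m y s) has_derivative (\<lambda>u. s *\<^sub>R u)) (at y within span K)"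
      unfolding m_def by (auto intro!: derivative_eq_intros)
    then have "((\<lambda>y. a (m y s)) has_derivative (\<lambda>u. pd K a (s *\<^sub>R u) (m y s))) (at y within span K)"
      by (intro has_derivative_compose_opn[where f = "\<lambda>y. m y s" and f' = "\<lambda>u. s *\<^sub>R u", OF U y _ _ pd_works[OF ad[OF y s]]])
        (use mU[OF _ s] opn_span[OF U] in auto)
    moreover have "((\<lambda>y. y - y0) has_derivative (\<lambda>u. u)) (at y within span K)"
      by (auto intro!: derivative_eq_intros)
    ultimately have "((\<lambda>y. a (m y s) \<bullet> (y - y0)) has_derivative
        (\<lambda>u. a (m y s) \<bullet> u + pd K a (s *\<^sub>R u) (m y s) \<bullet> (y - y0))) (at y within span K)"
      by (rule has_derivative_inner)
    then show ?thesis unfolding f_def D_def pd_scale[OF ad[OF y s]] by (simp add: add.commute)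
  qed
  \<comment> \<open>This is \<open>D y s\<close> after \<open>cproj K\<close>, written as a finite
    sum so that its joint continuity in \<open>(y, s)\<close> follows from that of the values on
    basis vectors.\<close>
  define Df where "Df y s = (\<Sum>b\<in>K. D y s b *\<^sub>R blinfun_inner_left b)" for y s
  have Dlin: "linear (D y s)" if "y \<in> U" "s \<in> {0..1}" for y s
    using has_derivative_bounded_linear[OF fD[OF that]] bounded_linear.linear by blast
  have Df: "blinfun_apply (Df y s) u = D y s (cproj K u)" if "y \<in> U" "s \<in> {0..1}" for y s u
    unfolding Df_def cproj_def linear_sum[OF Dlin[OF that]] linear_cmul[OF Dlin[OF that]]
    by (simp add: blinfun.sum_left blinfun.scaleR_left inner_commute mult.commute)
  have cm: "continuous_on (U \<times> {0..1}) (\<lambda>(y, s). m y s)"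
    unfolding m_def split_beta by (intro continuous_intros)
  have comp: "continuous_on (U \<times> {0..1}) (\<lambda>(y, s). k (m y s))" if "continuous_on V k" for k :: "'e \<Rightarrow> 'e"
  proof -
    have im: "(\<lambda>(y, s). m y s) ` (U \<times> {0..1}) \<subseteq> V" using mU UV by auto
    show ?thesis using continuous_on_compose2[OF that cm im] by (simp add: split_beta)
  qed
  have "continuous_on (U \<times> {0..1}) (\<lambda>(y, s). D y s b)" if b: "b \<in> K" for b
  proof -
    have "continuous_on V (pd K a b)" by (rule smooth_on_continuous[OF smooth_on_pd_Basis[OF a b]])
    note c = comp[OF this] comp[OF smooth_on_continuous[OF a]]
    show ?thesis unfolding D_def
      using c unfolding split_beta by (intro continuous_intros)
  qed
  then have cDf: "continuous_on (U \<times> {0..1}) (\<lambda>(y, s). Df y s)"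
    unfolding Df_def split_beta by (intro continuous_intros)
  have fs: "continuous_on {0..1} (f y)" if "y \<in> U" for y
  proof -
    have "continuous_on {0..1} (m y)" unfolding m_def by (intro continuous_intros)
    then have "continuous_on {0..1} (\<lambda>s. a (m y s))"
      by (rule continuous_on_compose2[OF smooth_on_continuous[OF a]]) (use mU that UV in auto)
    then show ?thesis unfolding f_def by (intro continuous_intros)
  qed
  define l where "l y = integral {0..1} (f y)" for y
  \<comment> \<open>The integrand is the derivative of \<open>s * (a (m y s) \<bullet> u)\<close> in
    \<open>s\<close>. The lower limit contributes 0, and at the upper limit \<open>m y 1\<close> is
    \<open>y\<close>.\<close>
  have int: "integral {0..1} (\<lambda>s. D y s u) = a y \<bullet> u" if y: "y \<in> U" and u: "u \<in> span K" for y u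
  proof -
    have yK: "y - y0 \<in> span K" using opn_span[OF U y] y0K by (rule span_diff)
    have "((\<lambda>s. s * (a (m y s) \<bullet> u)) has_vector_derivative D y s u) (at s within {0..1})" if s: "s \<in> {0..1}" for s
    proof -
      have mV: "m y s \<in> V" and mK: "m y s \<in> span K" using mU[OF y s] UV opn_span[OF U] by auto
      have "(\<lambda>z. a z \<bullet> u) differentiable (at (m y s) within span K)"
        by (rule smooth_on_differentiable[OF smooth_on_linear_image[OF bounded_linear_inner_left V a] mV])
      note pullback_form = has_derivative_along_line[OF pd_works[OF this] mK yK]
      have "m y s + t *\<^sub>R (y - y0) = m y (t + s)" for t by (simp add: m_def algebra_simps)
      then have "((\<lambda>t. a (m y (t + s)) \<bullet> u) has_real_derivative pd K (\<lambda>z. a z \<bullet> u) (y - y0) (m y s)) (at 0)"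
        using pullback_form by (simp add: has_real_derivative_iff_has_vector_derivative)
      then have d: "((\<lambda>t. a (m y t) \<bullet> u) has_real_derivative pd K (\<lambda>z. a z \<bullet> u) (y - y0) (m y s)) (at s)"
        using DERIV_shift[of "\<lambda>t. a (m y t) \<bullet> u" _ 0 s] by (simp add: add.commute)
      \<comment> \<open>Closedness exchanges the direction \<open>y - y0\<close> of the segment with
        the direction \<open>u\<close> of differentiation.\<close>
      have "pd K (\<lambda>z. a z \<bullet> u) (y - y0) (m y s) = pd K (\<lambda>z. a z \<bullet> (y - y0)) u (m y s)"
        by (rule closed[OF mV u yK])
      also have "\<dots> = pd K a u (m y s) \<bullet> (y - y0)"
        by (rule pd_linear_image[OF bounded_linear_inner_left ad[OF y s] mK u])
      finally have "((\<lambda>t. a (m y t) \<bullet> u) has_real_derivative pd K a u (m y s) \<bullet> (y - y0)) (at s)" using d by simp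
      then have "((\<lambda>s. s * (a (m y s) \<bullet> u)) has_real_derivative D y s u) (at s)"
        unfolding D_def by (auto intro!: derivative_eq_intros)
      then show ?thesis
        using has_real_derivative_iff_has_vector_derivative has_vector_derivative_at_within by blast
    qed
    then have "((\<lambda>s. D y s u) has_integral 1 * (a (m y 1) \<bullet> u) - 0 * (a (m y 0) \<bullet> u)) {0..1}"
      by (intro fundamental_theorem_of_calculus) auto
    then show ?thesis by (simp add: integral_unique m_def)
  qed
  have lD: "(l has_derivative (\<lambda>u. a y \<bullet> cproj K u)) (at y within span K)" if y: "y \<in> U" for y
  proof -
    have "((\<lambda>x. integral (cbox 0 1) (f x)) has_derivative blinfun_apply (integral (cbox 0 1) (Df y))) (at y within U)"
    proof (rule leibniz_rule[OF _ _ _ y convU])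
      show "((\<lambda>x. f x t) has_derivative blinfun_apply (Df x t)) (at x within U)" if "x \<in> U" "t \<in> cbox 0 1" for x t
      proof -
        have t: "t \<in> {0..1}" using that by simp
        have "((\<lambda>x. f x t) has_derivative (\<lambda>u. D x t (cproj K u))) (at x within span K)"
          by (rule has_derivative_cproj[OF K fD[OF that(1) t] opn_span[OF U that(1)]])
        moreover have "blinfun_apply (Df x t) = (\<lambda>u. D x t (cproj K u))" by (rule ext) (rule Df[OF that(1) t])
        ultimately show ?thesis by (simp add: at_within_opn[OF U that(1)])
      qed
      show "f x integrable_on cbox 0 1" if "x \<in> U" for x
        using fs[OF that] by (auto intro: integrable_continuous_interval)
      show "continuous_on (U \<times> cbox 0 1) (\<lambda>(x, t). Df x t)" using cDf by simp
    qed
    moreover have "blinfun_apply (integral (cbox 0 1) (Df y)) = (\<lambda>u. a y \<bullet> cproj K u)"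
    proof
      fix u
      have "continuous_on {0..1} (\<lambda>s. Df y s)"
      proof -
        have c: "continuous_on {0..1} (\<lambda>s. (y, s))" by (intro continuous_intros)
        have im: "(\<lambda>s. (y, s)) ` {0..1} \<subseteq> U \<times> {0..1}" using y by auto
        show ?thesis using continuous_on_compose2[OF cDf c im] by simp
      qed
      then have "Df y integrable_on cbox 0 1" by (auto intro: integrable_continuous_interval)
      then have "blinfun_apply (integral (cbox 0 1) (Df y)) u = integral (cbox 0 1) (\<lambda>s. blinfun_apply (Df y s) u)"
        using integral_linear[OF _ blinfun.bounded_linear_left[of u], of "Df y" "cbox 0 1"] by (simp add: o_def)
      also have "\<dots> = integral {0..1} (\<lambda>s. D y s (cproj K u))"
        unfolding cbox_interval by (rule integral_cong) (use Df[OF y] in auto)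
      finally show "blinfun_apply (integral (cbox 0 1) (Df y)) u = a y \<bullet> cproj K u" using int[OF y cproj_span] by simp
    qed
    ultimately show ?thesis
      unfolding at_within_opn[OF U y] by (simp add: l_def[abs_def])
  qed
  have pdl: "pd K l u y = a y \<bullet> u" if "y \<in> U" "u \<in> span K" for y u
    using pd_eqI[OF lD[OF that(1)] opn_span[OF U that(1)] that(2)] cproj_ident[OF K that(2)] by simp
  have aU: "smooth_on K U a" by (rule smooth_on_subset[OF a UV])
  have "smooth_on K U l"
  proof (rule smooth_onI[OF U])
    show "l differentiable (at y within span K)" if "y \<in> U" for y
      using lD[OF that] by (rule differentiableI)
    show "smooth_on K U (pd K l b)" if "b \<in> K" for b
      by (rule smooth_on_congI[OF U smooth_on_linear_image[OF bounded_linear_inner_left U aU, of b]])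
        (simp add: pdl span_base[OF that])
  qed
  then show ?thesis using U UV y0U pdl by blast
qed

section \<open>The canonical symplectic form along a parametrised submanifold\<close>

text \<open>\<open>omega\<close> is computed in a chart chosen by the epsilon operator.  The choice does not matter because
  \<open>omega\<close> is, up to sign, the exterior derivative of the canonical one-form, whose pullback involves first derivatives only.\<close>

lemma omega_eq:
  fixes K :: "('k, 'd::euclidean_space) mfd" and R :: "('r, 'f::euclidean_space) mfd"
  assumes K: "satlas K" and R: "satlas R" and F: "smooth_map K W (cotangent_bundle R) F" and w: "w \<in> W"
    and t: "t \<in> charts_at K w" and d: "d \<in> charts_at R (fst (F w))"
    and u: "u \<in> span (model K)" and v: "v \<in> span (model K)"
    and X: "fst X = F w" "\<And>e. e \<in> charts_at R (fst (F w)) \<Longrightarrow>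
      snd X (cchart R e) = pd (model K) (local_rep t (cchart R e) F) u (snd t w)"
    and Y: "fst Y = F w" "\<And>e. e \<in> charts_at R (fst (F w)) \<Longrightarrow>
      snd Y (cchart R e) = pd (model K) (local_rep t (cchart R e) F) v (snd t w)"
  defines "r \<equiv> local_rep t (cchart R d) F"
  shows "omega R X Y =
    pd (model K) (\<lambda>y. snd (r y) \<bullet> pd (model K) (\<lambda>z. fst (r z)) u y) v (snd t w) -
    pd (model K) (\<lambda>y. snd (r y) \<bullet> pd (model K) (\<lambda>z. fst (r z)) v y) u (snd t w)"
proof -
  let ?K = "model K" and ?R = "model R" and ?T = "cotangent_bundle R"
  note bK = satlas_Basis[OF K] and bR = satlas_Basis[OF R] and T = satlas_cotangent_bundle[OF R]
  have Fw: "F w \<in> cotangent_at R (fst (F w))" "fst (F w) \<in> carrier R"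
    using smooth_map_carrier[OF F w] carrier_cotangent_bundle[OF R] by auto
  have t': "t \<in> charts K" "w \<in> fst t" and d': "d \<in> charts R" "fst (F w) \<in> fst d"
    using t d by (auto simp: charts_at_charts)
  define e where "e = (SOME c. c \<in> charts_at R (fst (F w)))"
  have e: "e \<in> charts_at R (fst (F w))" using some_chart[OF R Fw(2)] by (simp add: e_def)
  have e': "e \<in> charts R" "fst (F w) \<in> fst e" using e by (auto simp: charts_at_charts)
  have Fcot: "F w' \<in> cotangent_at R (fst (F w'))" if "w' \<in> W" for w'
    using smooth_map_carrier[OF F that] carrier_cotangent_bundle[OF R] by auto
  define s where "s = local_rep t (cchart R e) F"
  let ?y = "snd t w"
  define V where "V = snd t ` {w' \<in> fst t \<inter> W. F w' \<in> fst (cchart R e)}"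
  define Vd where "Vd = snd t ` {w' \<in> fst t \<inter> W. F w' \<in> fst (cchart R d)}"
  have V: "opn ?K V" and ss: "smooth_on ?K V s"
    unfolding V_def s_def using smooth_mapD[OF K T F t'(1) cchart_charts[OF R e'(1)]] by auto
  have Vd: "opn ?K Vd" and rs: "smooth_on ?K Vd r"
    unfolding Vd_def r_def using smooth_mapD[OF K T F t'(1) cchart_charts[OF R d'(1)]] by auto
  \<comment> \<open>The two charts of \<open>R\<close> have to be compared on a neighbourhood of the
    point, since derivatives are taken afterwards.\<close>
  define Z where "Z = V \<inter> Vd"
  have Z: "opn ?K Z" unfolding Z_def using V Vd by auto
  have yV: "?y \<in> V" unfolding V_def using w t' e' Fw by (auto simp: fst_cchart)
  have yZ: "?y \<in> Z" unfolding Z_def Vd_def using yV w t' d' Fw by (auto simp: fst_cchart)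
  have yK: "?y \<in> span ?K" using charts_span[OF t'] .
  have ssZ: "smooth_on ?K Z s" and rsZ: "smooth_on ?K Z r"
    using smooth_on_subset[OF ss] smooth_on_subset[OF rs] by (auto simp: Z_def)
  have Zw: "\<exists>w'\<in>fst t \<inter> W. y = snd t w' \<and> fst (F w') \<in> fst e \<and> fst (F w') \<in> fst d" if "y \<in> Z" for y
    using that charts_inj[OF t'(1)] by (auto simp: Z_def V_def Vd_def fst_cchart dest: inj_onD)
  \<comment> \<open>The pullback of the canonical one-form reads the same in both charts: velocities
    change by the Jacobian, fibre coordinates by its transpose.\<close>
  have theta: "snd (s y) \<bullet> pd ?K (\<lambda>z. fst (s z)) a y = snd (r y) \<bullet> pd ?K (\<lambda>z. fst (r z)) a y"
    if y: "y \<in> Z" and a: "a \<in> span ?K" for y a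
  proof -
    obtain w' where w': "w' \<in> fst t" "w' \<in> W" "y = snd t w'" "fst (F w') \<in> fst e" "fst (F w') \<in> fst d"
      using Zw[OF y] by auto
    have ch: "e \<in> charts_at R (fst (F w'))" "d \<in> charts_at R (fst (F w'))"
      using w' e' d' by (auto simp: charts_at_charts)
    have sv: "s y = (snd e (fst (F w')), ccomp R e (F w'))" "r y = (snd d (fst (F w')), ccomp R d (F w'))"
      unfolding s_def r_def using w' by (simp_all add: charts_local_rep[OF t'(1)] snd_cchart)
    have "fst (s z) = local_rep d e id (fst (r z))" if "z \<in> Z" for z
      using Zw[OF that] unfolding s_def r_def
      by (auto simp: charts_local_rep[OF t'(1)] charts_local_rep[OF d'(1)] snd_cchart)
    then have "pd ?K (\<lambda>z. fst (s z)) a y = pd ?K (\<lambda>z. local_rep d e id (fst (r z))) a y"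
      by (rule pd_cong[OF Z y])
    also have "\<dots> = pd ?R (local_rep d e id) (pd ?K (\<lambda>z. fst (r z)) a y) (fst (r y))"
    proof (rule pd_compose[OF Z y _ _ _ a])
      show "fst (r z) \<in> span ?R" if "z \<in> Z" for z
        using Zw[OF that] charts_span[OF d'(1)] unfolding r_def by (auto simp: charts_local_rep[OF t'(1)] snd_cchart)
      show "(\<lambda>z. fst (r z)) differentiable at y within span ?K"
        by (rule smooth_on_differentiable[OF smooth_on_fst[OF Z rsZ] y])
      show "local_rep d e id differentiable at (fst (r y)) within span ?R"
        using transition_differentiable[OF R ch(2,1)] by (simp add: sv)
    qed
    finally have q: "pd ?K (\<lambda>z. fst (s z)) a y = pd ?R (local_rep d e id) (pd ?K (\<lambda>z. fst (r z)) a y) (snd d (fst (F w')))"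
      by (simp add: sv)
    have "pd ?K (\<lambda>z. fst (r z)) a y \<in> span ?R"
    proof (rule pd_in_span[OF Z y _ bR _ a])
      show "fst (r z) \<in> span ?R" if "z \<in> Z" for z
        using Zw[OF that] charts_span[OF d'(1)] unfolding r_def by (auto simp: charts_local_rep[OF t'(1)] snd_cchart)
      show "(\<lambda>z. fst (r z)) differentiable at y within span ?K"
        by (rule smooth_on_differentiable[OF smooth_on_fst[OF Z rsZ] y])
    qed
    then show ?thesis
      using ccomp_transform[OF R ch(1,2) Fcot[OF w'(2)]] by (simp add: sv q)
  qed
  have sfs: "smooth_on ?K Z (\<lambda>z. fst (s z))" and sss: "smooth_on ?K Z (\<lambda>z. snd (s z))"
    using smooth_on_fst[OF Z ssZ] smooth_on_snd[OF Z ssZ] by auto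
  note dd = smooth_on_differentiable[OF _ yZ]
  have comps: "pd ?K s a ?y = (pd ?K (\<lambda>z. fst (s z)) a ?y, pd ?K (\<lambda>z. snd (s z)) a ?y)" if "a \<in> span ?K" for a
    using pd_Pair[OF dd[OF sfs] dd[OF sss] yK that] by simp
  have dth: "pd ?K (\<lambda>y. snd (s y) \<bullet> pd ?K (\<lambda>z. fst (s z)) a y) b ?y =
      snd (s ?y) \<bullet> pd ?K (pd ?K (\<lambda>z. fst (s z)) a) b ?y + pd ?K (\<lambda>z. snd (s z)) b ?y \<bullet> pd ?K (\<lambda>z. fst (s z)) a ?y"
    if "a \<in> span ?K" "b \<in> span ?K" for a b
    by (rule pd_inner[OF dd[OF sss] dd[OF smooth_on_pd[OF Z bK sfs that(1)]] yK that(2)])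
  have span: "pd ?K (\<lambda>z. fst (s z)) a ?y \<in> span ?R" "pd ?K (\<lambda>z. snd (s z)) a ?y \<in> span ?R" if "a \<in> span ?K" for a
  proof -
    show "pd ?K (\<lambda>z. fst (s z)) a ?y \<in> span ?R"
      by (rule pd_in_span[OF Z yZ _ bR dd[OF sfs] that])
        (use Zw charts_span[OF e'(1)] in \<open>fastforce simp: s_def charts_local_rep[OF t'(1)] snd_cchart\<close>)
    show "pd ?K (\<lambda>z. snd (s z)) a ?y \<in> span ?R"
      by (rule pd_in_span[OF Z yZ _ bR dd[OF sss] that])
        (use Zw ccomp_span in \<open>fastforce simp: s_def charts_local_rep[OF t'(1)] snd_cchart\<close>)
  qed
  have sX: "snd X (cchart R e) = pd ?K s u ?y" and sY: "snd Y (cchart R e) = pd ?K s v ?y"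
    using X(2)[OF e] Y(2)[OF e] by (auto simp: s_def)
  have "omega R X Y = pd ?K (\<lambda>z. fst (s z)) u ?y \<bullet> pd ?K (\<lambda>z. snd (s z)) v ?y
      - pd ?K (\<lambda>z. fst (s z)) v ?y \<bullet> pd ?K (\<lambda>z. snd (s z)) u ?y"
    unfolding omega_def X(1) Let_def e_def[symmetric] sX sY comps[OF u] comps[OF v]
      inner_span_expand[OF bR span(2)[OF v]] inner_span_expand[OF bR span(2)[OF u]]
    by (simp add: sum_subtractf)
  \<comment> \<open>After antisymmetrisation of the product rule the second derivatives of the base
    part cancel by symmetry.\<close>
  also have "\<dots> = pd ?K (\<lambda>y. snd (s y) \<bullet> pd ?K (\<lambda>z. fst (s z)) u y) v ?y
      - pd ?K (\<lambda>y. snd (s y) \<bullet> pd ?K (\<lambda>z. fst (s z)) v y) u ?y"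
    unfolding dth[OF u v] dth[OF v u] pd_symmetric[OF Z bK sfs yZ u v] by (simp add: inner_commute)
  also have "\<dots> = pd ?K (\<lambda>y. snd (r y) \<bullet> pd ?K (\<lambda>z. fst (r z)) u y) v ?y
      - pd ?K (\<lambda>y. snd (r y) \<bullet> pd ?K (\<lambda>z. fst (r z)) v y) u ?y"
    using pd_cong[OF Z yZ theta[OF _ u]] pd_cong[OF Z yZ theta[OF _ v]] by simp
  finally show ?thesis .
qed

section \<open>The Tulczyjew isomorphism along the second order field\<close>

text \<open>Covectors on the tangent bundle change by the transpose of this Jacobian. Its second
  derivative entry is the term that the Tulczyjew coordinates have to match.\<close>

lemma pd_tchart_transition:
  assumes M: "satlas M" and c: "c \<in> charts_at M x" and d: "d \<in> charts_at M x"
    and u: "u \<in> span (model M)" and j: "j \<in> span (model M)" and k: "k \<in> span (model M)"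
  shows "pd (bundle_model (model M)) (local_rep (tchart M c) (tchart M d) id) (j, k) (snd c x, u) =
    (pd (model M) (local_rep c d id) j (snd c x),
     pd (model M) (pd (model M) (local_rep c d id) j) u (snd c x) + pd (model M) (local_rep c d id) k (snd c x))"
proof -
  let ?B = "model M" and ?S = "snd c ` (fst c \<inter> fst d)" and ?h = "local_rep c d id"
  have c': "c \<in> charts M" "x \<in> fst c" and d': "d \<in> charts M" "x \<in> fst d" using c d by (auto simp: charts_at_charts)
  have S: "opn ?B ?S" and h: "smooth_on ?B ?S ?h"
    using charts_compatible[OF M c'(1) d'(1)] unfolding compatible_def by blast+
  have x: "snd c x \<in> ?S" using c' d' by blast
  have "pd (bundle_model ?B) (local_rep (tchart M c) (tchart M d) id) (j, k) (snd c x, u) =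
      pd (bundle_model ?B) (\<lambda>z. (?h (fst z), pd ?B ?h (snd z) (fst z))) (j, k) (snd c x, u)"
    by (rule pd_cong[OF opn_bundle[OF S]]) (use x u in \<open>auto simp: local_rep_tchart[OF M c'(1) d'(1)]\<close>)
  then show ?thesis using pd_tangent_rep[OF satlas_Basis[OF M] S h x u j k] by simp
qed

lemma inner_bundle_eqI:
  assumes B: "B \<subseteq> Basis" and uv: "u \<in> span (bundle_model B)" "v \<in> span (bundle_model B)"
    and eq: "\<And>j k. j \<in> span B \<Longrightarrow> k \<in> span B \<Longrightarrow> u \<bullet> (j, k) = v \<bullet> (j, k)"
  shows "u = v"
proof (rule span_eqI[OF bundle_model_Basis[OF B] uv])
  fix b assume "b \<in> bundle_model B"
  then have "b \<in> span B \<times> span B" using span_base span_bundle_model by blast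
  then show "u \<bullet> b = v \<bullet> b" using eq by auto
qed

section \<open>A second order field on a submanifold: the common setting\<close>

locale sode_along =
  fixes Q :: "('a, 'e::euclidean_space) mfd" and C :: "'e set" and N :: "'a set"
    and \<Gamma> :: "('a, 'e) tvec \<Rightarrow> (('a, 'e) tvec, 'e \<times> 'e) tvec"
  assumes Q: "satlas Q" and sub: "submanifold Q C N" and sode: "sode (submfd Q C N) \<Gamma>"
begin

abbreviation "M \<equiv> submfd Q C N"
abbreviation "TM \<equiv> tangent_bundle (submfd Q C N)"
abbreviation "TQ \<equiv> tangent_bundle Q"
abbreviation "T'Q \<equiv> cotangent_bundle Q"
abbreviation "B \<equiv> model Q"
abbreviation "CC \<equiv> bundle_model C"
abbreviation "BB \<equiv> bundle_model (model Q)"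
abbreviation "T c \<equiv> tchart (submfd Q C N) c"
abbreviation "tinv c \<equiv> inv_into (fst (tchart (submfd Q C N) c)) (snd (tchart (submfd Q C N) c))"

lemma M: "satlas M" using satlas_submfd[OF Q sub] .
lemma TM: "satlas TM" using satlas_tangent_bundle[OF M] .
lemma TQ: "satlas TQ" using satlas_tangent_bundle[OF Q] .
lemma T'Q: "satlas T'Q" using satlas_cotangent_bundle[OF Q] .
lemma T'TQ: "satlas (cotangent_bundle TQ)" using satlas_cotangent_bundle[OF TQ] .
lemma B: "B \<subseteq> Basis" using satlas_Basis[OF Q] .
lemma CB: "C \<subseteq> B" using sub by (simp add: submanifold_def)
lemma C: "C \<subseteq> Basis" using B CB by blast
lemma CC: "CC \<subseteq> Basis" using bundle_model_Basis[OF C] .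
lemma BB: "BB \<subseteq> Basis" using bundle_model_Basis[OF B] .
lemma span_CB: "u \<in> span C \<Longrightarrow> u \<in> span B" using span_mono[OF CB] by blast

lemma carrier_M: "carrier M = N" using carrier_submfd[OF sub] .

lemma carrier_TM: "w \<in> carrier TM \<longleftrightarrow> fst w \<in> N \<and> w \<in> tangent_at M (fst w)"
  using carrier_tangent_bundle[OF M] carrier_M by simp

lemma incl: "smooth_map M N Q id" using smooth_map_inclusion[OF Q sub] .

lemma T_charts: "c \<in> charts M \<Longrightarrow> T c \<in> charts TM" by (rule tchart_charts[OF M])

lemma T_charts_at: "w \<in> carrier TM \<Longrightarrow> c \<in> charts_at M (fst w) \<Longrightarrow> T c \<in> charts_at TM w"
  using tchart_charts_at[OF M] carrier_TM by blast

lemma tinv_T: "c \<in> charts M \<Longrightarrow> w \<in> fst (T c) \<Longrightarrow> tinv c (snd (T c) w) = w"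
  using inv_into_f_f[OF tchart_inj[OF M]] by blast

lemma fst_T_carrier: "c \<in> charts M \<Longrightarrow> w \<in> fst (T c) \<Longrightarrow> w \<in> carrier TM \<and> c \<in> charts_at M (fst w)"
  using charts_carrier[of c M] by (auto simp: fst_tchart carrier_TM carrier_M charts_at_charts)

lemma carrier_fst_T: "w \<in> carrier TM \<Longrightarrow> c \<in> charts_at M (fst w) \<Longrightarrow> c \<in> charts M \<and> w \<in> fst (T c)"
  by (auto simp: fst_tchart carrier_TM charts_at_charts)

lemma T_snd_span: "w \<in> carrier TM \<Longrightarrow> c \<in> charts_at M (fst w) \<Longrightarrow> snd w c \<in> span C"
  using tangent_atD(2)[of w M "fst w" c] carrier_TM by simp

subsection \<open>Coordinates of the second order field\<close>

text \<open>The components of \<Gamma> in induced coordinates: the velocity q'^a first, by the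
  second order condition, then the coefficients \<Gamma>^a.\<close>

definition Gam :: "('a, 'e) chart \<Rightarrow> ('a, 'e) tvec \<Rightarrow> 'e \<times> 'e" where
  "Gam c w = snd (\<Gamma> w) (T c)"

lemma Gamma_tangent: "w \<in> carrier TM \<Longrightarrow> \<Gamma> w \<in> tangent_at TM w"
  using sode by (simp add: sode_def Let_def)

lemma Gamma_smooth: "smooth_map TM (carrier TM) (tangent_bundle TM) \<Gamma>"
  using sode by (simp add: sode_def Let_def)

lemma fst_gam: "w \<in> carrier TM \<Longrightarrow> c \<in> charts_at M (fst w) \<Longrightarrow> fst (Gam c w) = snd w c"
  using sode by (simp add: sode_def Let_def Gam_def)

lemma gam_span: "w \<in> carrier TM \<Longrightarrow> c \<in> charts_at M (fst w) \<Longrightarrow> Gam c w \<in> span CC"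
  using tangent_atD(2)[OF Gamma_tangent T_charts_at] by (simp add: Gam_def)

lemma gam_smooth:
  assumes c: "c \<in> charts M"
  shows "smooth_on CC (snd (T c) ` fst (T c)) (\<lambda>y. Gam c (tinv c y))"
proof -
  note O = charts_opn[OF T_charts[OF c], simplified]
  have fG: "fst (\<Gamma> w) = w" if "w \<in> fst (T c)" for w
    using tangent_atD(1)[OF Gamma_tangent] fst_T_carrier[OF c that] by blast
  have "{w \<in> fst (T c) \<inter> carrier TM. \<Gamma> w \<in> fst (tchart TM (T c))} = fst (T c)"
    using fst_T_carrier[OF c] Gamma_tangent fG by (auto simp: fst_tchart[of TM])
  then have "smooth_on CC (snd (T c) ` fst (T c)) (local_rep (T c) (tchart TM (T c)) \<Gamma>)"
    using smooth_mapD(2)[OF TM satlas_tangent_bundle[OF TM] Gamma_smooth T_charts[OF c] tchart_charts[OF TM T_charts[OF c]]]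
    by simp
  then have "smooth_on CC (snd (T c) ` fst (T c)) (\<lambda>y. snd (local_rep (T c) (tchart TM (T c)) \<Gamma> y))"
    by (rule smooth_on_snd[OF O])
  then show ?thesis by (simp add: local_rep_def snd_tchart[of TM] Gam_def)
qed

subsection \<open>The inclusion of tangent bundles and its transpose\<close>

lemma incl_tangent: "w \<in> carrier TM \<Longrightarrow> i_TN Q C N w \<in> tangent_at Q (fst w)"
  using tangent_map_tangent[OF M Q incl, of "fst w" w] by (simp add: i_TN_def carrier_TM)

lemma fst_incl [simp]: "fst (i_TN Q C N w) = fst w"
  by (simp add: i_TN_def)

lemma snd_incl:
  assumes "w \<in> carrier TM" "c \<in> charts_at M (fst w)" "d \<in> charts_at Q (fst w)"
  shows "snd (i_TN Q C N w) d = pd C (local_rep c d id) (snd w c) (snd c (fst w))"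
  using snd_tangent_map[OF M Q incl, of "fst w" w c d] assms by (simp add: i_TN_def carrier_TM)

lemma incl_differentiable:
  assumes "c \<in> charts_at M x" "d \<in> charts_at Q x"
  shows "local_rep c d id differentiable (at (snd c x) within span C)"
  using local_rep_differentiable[OF M Q incl, of x c d] assms charts_at_carrier[OF assms(1)] carrier_M by simp

lemma incl_smooth:
  assumes c: "c \<in> charts M" and d: "d \<in> charts Q"
  shows "opn C (snd c ` (fst c \<inter> fst d))" "smooth_on C (snd c ` (fst c \<inter> fst d)) (local_rep c d id)"
proof -
  have "{x \<in> fst c \<inter> N. id x \<in> fst d} = fst c \<inter> fst d" using charts_carrier[OF c] carrier_M by auto
  then show "opn C (snd c ` (fst c \<inter> fst d))" "smooth_on C (snd c ` (fst c \<inter> fst d)) (local_rep c d id)"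
    using smooth_mapD[OF M Q incl c d] by simp_all
qed

section \<open>Covector fields along the inclusion, in coordinates\<close>

definition covector_field :: "('a, 'e) tvec set \<Rightarrow> (('a, 'e) tvec \<Rightarrow> ('a, 'e) cvec) \<Rightarrow> bool" where
  "covector_field W F \<longleftrightarrow> smooth_map TM W T'Q F \<and> (\<forall>w\<in>W. fst (F w) = fst w)"

lemma covfD:
  assumes "covector_field W F" "w \<in> W"
  shows "fst (F w) = fst w" "F w \<in> cotangent_at Q (fst w)" "w \<in> carrier TM"
proof -
  show f: "fst (F w) = fst w" using assms by (simp add: covector_field_def)
  have Fs: "smooth_map TM W T'Q F" using assms by (simp add: covector_field_def)
  have "F w \<in> carrier T'Q" by (rule smooth_map_carrier[OF Fs assms(2)])
  then show "F w \<in> cotangent_at Q (fst w)" using carrier_cotangent_bundle[OF Q] f by metis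
  show "w \<in> carrier TM"
    using assms(2) openin_mtop_carrier[OF TM smooth_map_openin[OF TM Fs]] by blast
qed

text \<open>The chart \<open>c\<close> of \<open>N\<close> and the chart \<open>d\<close> of
  \<open>Q\<close> are independent of each other, because the chart in which
  \<open>tulczyjew\<close> computes need not be adapted to \<open>N\<close>.\<close>

definition fib :: "('a, 'e) chart \<Rightarrow> ('a, 'e) chart \<Rightarrow> (('a, 'e) tvec \<Rightarrow> ('a, 'e) cvec) \<Rightarrow> 'e \<times> 'e \<Rightarrow> 'e" where
  "fib c d F y = ccomp Q d (F (tinv c y))"

definition coord_dom :: "('a, 'e) chart \<Rightarrow> ('a, 'e) chart \<Rightarrow> ('a, 'e) tvec set \<Rightarrow> ('e \<times> 'e) set" where
  "coord_dom c d W = snd (T c) ` {w \<in> fst (T c) \<inter> W. fst w \<in> fst d}"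

lemma domE:
  assumes "y \<in> coord_dom c d W"
  obtains w where "w \<in> fst (T c)" "w \<in> W" "fst w \<in> fst d" "y = snd (T c) w"
  using assms unfolding coord_dom_def by blast

lemma dom_smooth:
  assumes F: "covector_field W F" and c: "c \<in> charts M" and d: "d \<in> charts Q"
  shows "opn CC (coord_dom c d W)" "smooth_on CC (coord_dom c d W) (local_rep (T c) (cchart Q d) F)"
    "smooth_on CC (coord_dom c d W) (fib c d F)"
proof -
  have Fs: "smooth_map TM W T'Q F" using F by (simp add: covector_field_def)
  have "{w \<in> fst (T c) \<inter> W. F w \<in> fst (cchart Q d)} = {w \<in> fst (T c) \<inter> W. fst w \<in> fst d}"
    using covfD[OF F] by (auto simp: fst_cchart)
  then show O: "opn CC (coord_dom c d W)" and s: "smooth_on CC (coord_dom c d W) (local_rep (T c) (cchart Q d) F)"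
    using smooth_mapD[OF TM T'Q Fs T_charts[OF c] cchart_charts[OF Q d]] by (simp_all add: coord_dom_def)
  show "smooth_on CC (coord_dom c d W) (fib c d F)"
    using smooth_on_snd[OF O s] by (simp add: fib_def[abs_def] local_rep_def snd_cchart)
qed

lemma dom_base:
  assumes F: "covector_field W F" and c: "c \<in> charts M" and d: "d \<in> charts Q"
  shows "smooth_on CC (coord_dom c d W) fst" "y \<in> coord_dom c d W \<Longrightarrow> fst y \<in> snd c ` (fst c \<inter> fst d)"
    "smooth_on CC (coord_dom c d W) (\<lambda>y. local_rep c d id (fst y))"
proof -
  note O = dom_smooth(1)[OF F c d]
  show f: "smooth_on CC (coord_dom c d W) fst" by (rule smooth_on_linear[OF bounded_linear_fst O CC])
  show fy: "fst y \<in> snd c ` (fst c \<inter> fst d)" if "y \<in> coord_dom c d W" for y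
    using that by (auto simp: coord_dom_def fst_tchart snd_tchart)
  show "smooth_on CC (coord_dom c d W) (\<lambda>y. local_rep c d id (fst y))"
    by (rule smooth_on_compose[OF CC C O openin_imp_subset[OF incl_smooth(1)[OF c d]] incl_smooth(2)[OF c d] f fy])
qed

lemma T_dom: "w \<in> W \<Longrightarrow> w \<in> fst (T c) \<Longrightarrow> fst w \<in> fst d \<Longrightarrow> snd (T c) w \<in> coord_dom c d W"
  by (auto simp: coord_dom_def)

lemma fib_T: "c \<in> charts M \<Longrightarrow> w \<in> fst (T c) \<Longrightarrow> fib c d F (snd (T c) w) = ccomp Q d (F w)"
  by (simp add: fib_def tinv_T)

lemma fst_snd_T: "fst (snd (T c) w) = snd c (fst w)" "snd (snd (T c) w) = snd w c"
  by (simp_all add: snd_tchart)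

lemma local_rep_cchart_T:
  "covector_field W F \<Longrightarrow> c \<in> charts M \<Longrightarrow> w \<in> fst (T c) \<Longrightarrow> w \<in> W \<Longrightarrow>
    local_rep (T c) (cchart Q d) F (snd (T c) w) = (snd d (fst w), ccomp Q d (F w))"
  by (simp add: charts_local_rep[OF T_charts] snd_cchart covfD(1))

lemma T_dom_at:
  assumes F: "covector_field W F" and w: "w \<in> W" and c: "c \<in> charts_at M (fst w)" and d: "d \<in> charts_at Q (fst w)"
  shows "snd (T c) w \<in> coord_dom c d W"
  using T_dom[OF w] carrier_fst_T[OF covfD(3)[OF F w] c] d by (auto simp: charts_at_charts)

text \<open>\<open>F\<close> covers the inclusion and \<Gamma> is of second order, so the base part
  of TF(\<Gamma>(w)) has velocity \<open>i_TN Q C N w\<close>. This is why the Tulczyjew isomorphism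
  sends it to a covector over the point \<open>i_TN Q C N w\<close> of TQ.\<close>

lemma pd_local_rep_cchart:
  assumes F: "covector_field W F" and w: "w \<in> W" and c: "c \<in> charts_at M (fst w)" and d: "d \<in> charts_at Q (fst w)"
  shows "pd CC (local_rep (T c) (cchart Q d) F) (Gam c w) (snd (T c) w) =
    (snd (i_TN Q C N w) d, pd CC (fib c d F) (Gam c w) (snd (T c) w))"
proof -
  have wT: "w \<in> carrier TM" using covfD(3)[OF F w] .
  have c': "c \<in> charts M" and wc: "w \<in> fst (T c)" using carrier_fst_T[OF wT c] by auto
  have d': "d \<in> charts Q" "fst w \<in> fst d" using d by (auto simp: charts_at_charts)
  let ?y = "snd (T c) w" and ?g = "Gam c w"
  note O = dom_smooth(1)[OF F c' d'(1)]
  have y: "?y \<in> coord_dom c d W" by (rule T_dom_at[OF F w c d])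
  have yC: "?y \<in> span CC" using opn_span[OF O y] .
  have g: "?g \<in> span CC" using gam_span[OF wT c] .
  have "pd CC (local_rep (T c) (cchart Q d) F) ?g ?y = pd CC (\<lambda>y. (local_rep c d id (fst y), fib c d F y)) ?g ?y"
  proof (rule pd_cong[OF O y])
    fix z assume "z \<in> coord_dom c d W"
    then obtain w' where w': "w' \<in> fst (T c)" "w' \<in> W" "fst w' \<in> fst d" "z = snd (T c) w'" by (rule domE)
    then have "fst w' \<in> fst c" by (simp add: fst_tchart)
    then show "local_rep (T c) (cchart Q d) F z = (local_rep c d id (fst z), fib c d F z)"
      unfolding w'(4) local_rep_cchart_T[OF F c' w'(1,2)] fib_T[OF c' w'(1)] fst_snd_T
      by (simp add: charts_local_rep[OF c'])
  qed
  also have "\<dots> = (pd CC (\<lambda>y. local_rep c d id (fst y)) ?g ?y, pd CC (fib c d F) ?g ?y)"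
    by (rule pd_Pair[OF smooth_on_differentiable[OF dom_base(3)[OF F c' d'(1)] y]
          smooth_on_differentiable[OF dom_smooth(3)[OF F c' d'(1)] y] yC g])
  also have "pd CC (\<lambda>y. local_rep c d id (fst y)) ?g ?y = pd C (local_rep c d id) (pd CC fst ?g ?y) (fst ?y)"
  proof (rule pd_compose[OF O y _ smooth_on_differentiable[OF dom_base(1)[OF F c' d'(1)] y] _ g])
    show "fst z \<in> span C" if "z \<in> coord_dom c d W" for z using opn_span[OF O that] by (auto simp: span_bundle_model)
    show "local_rep c d id differentiable at (fst ?y) within span C"
      using incl_differentiable[OF c d] by (simp add: snd_tchart)
  qed
  also have "pd CC fst ?g ?y = snd w c" using pd_bounded_linear[OF bounded_linear_fst yC g] fst_gam[OF wT c] by simp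
  also have "pd C (local_rep c d id) (snd w c) (fst ?y) = snd (i_TN Q C N w) d"
    using snd_incl[OF wT c d] by (simp add: snd_tchart)
  finally show ?thesis .
qed

lemma pd_fib_span:
  assumes F: "covector_field W F" and w: "w \<in> W" and c: "c \<in> charts_at M (fst w)" and d: "d \<in> charts_at Q (fst w)"
    and g: "g \<in> span CC"
  shows "pd CC (fib c d F) g (snd (T c) w) \<in> span B"
proof -
  have c': "c \<in> charts M" using c by (auto simp: charts_at_charts)
  have d': "d \<in> charts Q" using d by (auto simp: charts_at_charts)
  note y = T_dom_at[OF F w c d]
  show ?thesis
    by (rule pd_in_span[OF dom_smooth(1)[OF F c' d'] y _ B smooth_on_differentiable[OF dom_smooth(3)[OF F c' d'] y] g])
      (simp add: fib_def ccomp_span)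
qed

section \<open>The induced map from TN to T*TQ\<close>

definition Phi :: "(('a, 'e) tvec \<Rightarrow> ('a, 'e) cvec) \<Rightarrow> ('a, 'e) tvec \<Rightarrow> (('a, 'e) tvec, 'e \<times> 'e) cvec" where
  "Phi F w = tulczyjew Q (tangent_map TM T'Q F (\<Gamma> w))"

text \<open>The chart \<open>d\<close> is the one picked inside \<open>tulczyjew\<close>. It varies
  with the base point in an uncontrolled way, so this formula alone does not yield smoothness of
  \<open>Phi F\<close>.\<close>

lemma Phi_cov:
  assumes F: "covector_field W F" and w: "w \<in> W" and c: "c \<in> charts_at M (fst w)"
  shows "\<exists>d\<in>charts_at Q (fst w). Phi F w =
    cov TQ (tchart Q d) (i_TN Q C N w) (pd CC (fib c d F) (Gam c w) (snd (T c) w), ccomp Q d (F w))"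
proof -
  have wT: "w \<in> carrier TM" using covfD(3)[OF F w] .
  have Fs: "smooth_map TM W T'Q F" using F by (simp add: covector_field_def)
  define x where "x = fst w"
  let ?w = "tangent_map TM T'Q F (\<Gamma> w)"
  have fw: "fst ?w = F w" using tangent_atD(1)[OF Gamma_tangent[OF wT]] by simp
  define d where "d = (SOME c. c \<in> charts_at Q (fst (fst ?w)))"
  have xQ: "fst w \<in> carrier Q" using wT sub by (auto simp: carrier_TM submanifold_def)
  have d: "d \<in> charts_at Q (fst w)" unfolding d_def fw covfD(1)[OF F w] by (rule some_chart[OF Q xQ])
  have d_eq: "(SOME c. c \<in> charts_at Q (fst w)) = d" unfolding d_def fw covfD(1)[OF F w] ..
  have "cchart Q d \<in> charts_at T'Q (F w)"
    using cchart_charts_at[OF Q, of d "F w"] covfD[OF F w] d by simp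
  then have sw: "snd ?w (cchart Q d) = (snd (i_TN Q C N w) d, pd CC (fib c d F) (Gam c w) (snd (T c) w))"
    using snd_tangent_map[OF TM T'Q Fs w Gamma_tangent[OF wT] T_charts_at[OF wT c]]
      pd_local_rep_cchart[OF F w c d] by (simp add: Gam_def)
  let ?p = "(pd CC (fib c d F) (Gam c w) (snd (T c) w), ccomp Q d (F w))"
  have "Phi F w = inv_into (fst (cchart TQ (tchart Q d))) (snd (cchart TQ (tchart Q d)))
      ((snd d (fst w), snd (i_TN Q C N w) d), ?p)"
    unfolding Phi_def tulczyjew_def Let_def d_eq snd_tchart fw covfD(1)[OF F w] sw
    unfolding snd_cchart covfD(1)[OF F w] by simp
  also have "(snd d (fst w), snd (i_TN Q C N w) d) = snd (tchart Q d) (i_TN Q C N w)" by (simp add: snd_tchart)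
  also have "inv_into (fst (cchart TQ (tchart Q d))) (snd (cchart TQ (tchart Q d))) (snd (tchart Q d) (i_TN Q C N w), ?p) =
      cov TQ (tchart Q d) (i_TN Q C N w) ?p"
    by (rule inv_cchart[OF TQ tchart_charts_at[OF Q]])
      (use d incl_tangent[OF wT] pd_fib_span[OF F w c d gam_span[OF wT c]] in \<open>simp_all add: span_bundle_model ccomp_span\<close>)
  finally show ?thesis using d by blast
qed

lemma Phi_cotangent: "covector_field W F \<Longrightarrow> w \<in> W \<Longrightarrow> Phi F w \<in> cotangent_at TQ (i_TN Q C N w)"
proof -
  assume F: "covector_field W F" and w: "w \<in> W"
  obtain c where c: "c \<in> charts_at M (fst w)"
    using carrier_charts_at[OF M, of "fst w"] covfD(3)[OF F w] by (auto simp: carrier_TM carrier_M)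
  from Phi_cov[OF F w c] obtain d where "Phi F w =
    cov TQ (tchart Q d) (i_TN Q C N w) (pd CC (fib c d F) (Gam c w) (snd (T c) w), ccomp Q d (F w))" by blast
  then show ?thesis by (simp only: cov_cotangent[OF TQ])
qed

lemma fst_Phi: "covector_field W F \<Longrightarrow> w \<in> W \<Longrightarrow> fst (Phi F w) = i_TN Q C N w"
  by (rule cotangent_atD(1)[OF Phi_cotangent])

text \<open>The Tulczyjew isomorphism is computed in a chart chosen by the epsilon operator; in any other chart its coordinates have the
  same form because the second derivatives of the coordinate change are symmetric.\<close>

lemma ccomp_Phi:
  assumes F: "covector_field W F" and w: "w \<in> W" and c: "c \<in> charts_at M (fst w)" and d: "d \<in> charts_at Q (fst w)"
  shows "ccomp TQ (tchart Q d) (Phi F w) = (pd CC (fib c d F) (Gam c w) (snd (T c) w), ccomp Q d (F w))"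
proof -
  let ?g = "Gam c w" and ?y = "snd (T c) w" and ?v = "i_TN Q C N w" and ?x = "fst w"
  have wT: "w \<in> carrier TM" using covfD(3)[OF F w] .
  obtain e where e: "e \<in> charts_at Q (fst w)"
    and Phi: "Phi F w = cov TQ (tchart Q e) ?v (pd CC (fib c e F) ?g ?y, ccomp Q e (F w))"
    using Phi_cov[OF F w c] by blast
  let ?h = "local_rep d e id"
  have v: "?v \<in> tangent_at Q (fst ?v)" using incl_tangent[OF wT] by simp
  have td: "tchart Q d \<in> charts_at TQ ?v" and te: "tchart Q e \<in> charts_at TQ ?v"
    using tchart_charts_at[OF Q _ v] d e by simp_all
  have g: "?g \<in> span CC" using gam_span[OF wT c] .
  have c': "c \<in> charts M" and wc: "w \<in> fst (T c)" using carrier_fst_T[OF wT c] by auto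
  have d': "d \<in> charts Q" "?x \<in> fst d" and e': "e \<in> charts Q" "?x \<in> fst e" using d e by (auto simp: charts_at_charts)
  let ?p = "(pd CC (fib c e F) ?g ?y, ccomp Q e (F w))"
  have p: "?p \<in> span BB" using pd_fib_span[OF F w c e g] by (simp add: span_bundle_model ccomp_span)
  have ccomp_e: "ccomp TQ (tchart Q e) (Phi F w) = ?p" unfolding Phi by (rule ccomp_cov[OF TQ te]) (simp add: p)
  have sv: "snd ?v d \<in> span B" using tangent_atD(2)[OF incl_tangent[OF wT] d] .
  define V where "V = coord_dom c d W \<inter> coord_dom c e W"
  have V: "opn CC V" 
    unfolding V_def by (rule openin_Int[OF dom_smooth(1)[OF F c' d'(1)] dom_smooth(1)[OF F c' e'(1)]])
  have yV: "?y \<in> V" using T_dom_at[OF F w c] d e by (simp add: V_def)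
  define q where "q y = local_rep c d id (fst y)" for y :: "'e \<times> 'e"
  have qs: "smooth_on CC V q"
    unfolding q_def by (rule smooth_on_subset[OF dom_base(3)[OF F c' d'(1)]]) (simp add: V_def)
  have Vw: "\<exists>w'. w' \<in> fst (T c) \<and> w' \<in> W \<and> fst w' \<in> fst d \<and> fst w' \<in> fst e \<and> fst w' \<in> fst c \<and> y = snd (T c) w'" if yV: "y \<in> V" for y
  proof -
    have yd: "y \<in> coord_dom c d W" "y \<in> coord_dom c e W" using yV by (auto simp: V_def)
    obtain w1 where w1: "w1 \<in> fst (T c)" "w1 \<in> W" "fst w1 \<in> fst d" "y = snd (T c) w1" using yd(1) by (rule domE)
    obtain w2 where w2: "w2 \<in> fst (T c)" "w2 \<in> W" "fst w2 \<in> fst e" "y = snd (T c) w2" using yd(2) by (rule domE)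
    have "w1 = w2" using inj_onD[OF tchart_inj[OF M c']] w1 w2 by metis
    moreover have "fst w1 \<in> fst c" using w1(1) by (simp add: fst_tchart)
    ultimately show ?thesis using w1 w2 by blast
  qed
  have qV: "q y \<in> snd d ` (fst d \<inter> fst e)" if yV: "y \<in> V" for y
  proof -
    obtain w' where "w' \<in> fst (T c)" "w' \<in> W" "fst w' \<in> fst d" "fst w' \<in> fst e" "fst w' \<in> fst c" "y = snd (T c) w'" using Vw[OF yV] by blast
    then show ?thesis by (simp add: q_def fst_snd_T charts_local_rep[OF c'])
  qed
  have comp: "opn B (snd d ` (fst d \<inter> fst e))" "smooth_on B (snd d ` (fst d \<inter> fst e)) ?h"
    using charts_compatible[OF Q d'(1) e'(1)] unfolding compatible_def by blast+
  \<comment> \<open>The derivative along \<Gamma> of the base coordinates in \<open>d\<close>, read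
    off from the first component in \<open>pd_local_rep_cchart\<close>.\<close>
  have pdq: "pd CC q ?g ?y = snd ?v d"
  proof -
    have "pd CC (\<lambda>y. fst (local_rep (T c) (cchart Q d) F y)) ?g ?y = fst (pd CC (local_rep (T c) (cchart Q d) F) ?g ?y)"
      by (rule pd_linear_image[OF bounded_linear_fst])
        (use smooth_on_differentiable[OF dom_smooth(2)[OF F c' d'(1)]] yV opn_span[OF V yV] g in \<open>auto simp: V_def\<close>)
    moreover have "pd CC q ?g ?y = pd CC (\<lambda>y. fst (local_rep (T c) (cchart Q d) F y)) ?g ?y"
    proof (rule pd_cong[OF V yV])
      fix y assume "y \<in> V"
      then obtain w' where w': "w' \<in> fst (T c)" "w' \<in> W" "fst w' \<in> fst c" "y = snd (T c) w'" using Vw by blast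
      show "q y = fst (local_rep (T c) (cchart Q d) F y)"
        unfolding w'(4) q_def local_rep_cchart_T[OF F c' w'(1,2)] fst_snd_T by (simp add: charts_local_rep[OF c' w'(3)])
    qed
    ultimately show ?thesis using pd_local_rep_cchart[OF F w c d] by simp
  qed
  \<comment> \<open>Differentiating the transformation rule of the fibre coordinates along \<Gamma>
    produces the second derivative of the coordinate change.\<close>
  have transp: "pd CC (fib c d F) ?g ?y \<bullet> j = pd CC (fib c e F) ?g ?y \<bullet> pd B ?h j (q ?y)
      + fib c e F ?y \<bullet> pd B (pd B ?h j) (pd CC q ?g ?y) (q ?y)" if j: "j \<in> span B" for j
  proof (rule pd_covector_transform[OF CC V B comp(1) qs qV comp(2) _ _ _ yV g j])
    show "smooth_on CC V (fib c e F)" "smooth_on CC V (fib c d F)"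
      using smooth_on_subset[OF dom_smooth(3)[OF F c' e'(1)]] smooth_on_subset[OF dom_smooth(3)[OF F c' d'(1)]]
      by (auto simp: V_def)
    fix y assume "y \<in> V"
    then obtain w' where w': "w' \<in> fst (T c)" "w' \<in> W" "fst w' \<in> fst d" "fst w' \<in> fst e" "fst w' \<in> fst c" "y = snd (T c) w'"
      using Vw by blast
    have "e \<in> charts_at Q (fst w')" "d \<in> charts_at Q (fst w')" using w' d' e' by (auto simp: charts_at_charts)
    from ccomp_transform[OF Q this covfD(2)[OF F w'(2)] j]
    show "fib c d F y \<bullet> j = fib c e F y \<bullet> pd B ?h j (q y)"
      unfolding w'(6) fib_T[OF c' w'(1)] q_def fst_snd_T by (simp add: charts_local_rep[OF c' w'(5)])
  qed
  have qy: "q ?y = snd d ?x" using wc by (simp add: q_def fst_snd_T charts_local_rep[OF c'] fst_tchart)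
  show ?thesis
  proof (rule inner_bundle_eqI[OF B])
    show "ccomp TQ (tchart Q d) (Phi F w) \<in> span BB" using ccomp_span[of TQ] by simp
    show "(pd CC (fib c d F) ?g ?y, ccomp Q d (F w)) \<in> span BB"
      using pd_fib_span[OF F w c d g] by (simp add: span_bundle_model ccomp_span)
    fix j k assume j: "j \<in> span B" and k: "k \<in> span B"
    have "ccomp TQ (tchart Q d) (Phi F w) \<bullet> (j, k) =
        ?p \<bullet> pd BB (local_rep (tchart Q d) (tchart Q e) id) (j, k) (snd d ?x, snd ?v d)"
      using ccomp_transform[OF TQ te td Phi_cotangent[OF F w], of "(j, k)"] j k
      by (simp add: ccomp_e span_bundle_model snd_tchart)
    also have "\<dots> = ?p \<bullet> (pd B ?h j (snd d ?x), pd B (pd B ?h j) (snd ?v d) (snd d ?x) + pd B ?h k (snd d ?x))"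
      using pd_tchart_transition[OF Q d e sv j k] by simp
    \<comment> \<open>The second derivative in the Jacobian of the charts of TQ is the same term as
      in \<open>transp\<close>; together they leave the coordinates in \<open>d\<close>.\<close>
    also have "\<dots> = pd CC (fib c d F) ?g ?y \<bullet> j + ccomp Q d (F w) \<bullet> k"
      using transp[OF j] ccomp_transform[OF Q e d covfD(2)[OF F w] k]
      by (simp add: qy pdq fib_T[OF c' wc] inner_add_right)
    finally show "ccomp TQ (tchart Q d) (Phi F w) \<bullet> (j, k) = (pd CC (fib c d F) ?g ?y, ccomp Q d (F w)) \<bullet> (j, k)"
      by simp
  qed
qed

lemma local_rep_Phi:
  assumes F: "covector_field W F" and c: "c \<in> charts M" and d: "d \<in> charts Q" and y: "y \<in> coord_dom c d W"
  shows "local_rep (T c) (cchart TQ (tchart Q d)) (Phi F) y =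
    ((local_rep c d id (fst y), pd C (local_rep c d id) (snd y) (fst y)), (pd CC (fib c d F) (Gam c (tinv c y)) y, fib c d F y))"
proof -
  obtain w where w: "w \<in> fst (T c)" "w \<in> W" "fst w \<in> fst d" "y = snd (T c) w" using y by (rule domE)
  have wc: "fst w \<in> fst c" using w by (simp add: fst_tchart)
  have ca: "c \<in> charts_at M (fst w)" "d \<in> charts_at Q (fst w)" using c d w wc by (auto simp: charts_at_charts)
  have "snd (cchart TQ (tchart Q d)) (Phi F w) = ((snd d (fst w), snd (i_TN Q C N w) d), (pd CC (fib c d F) (Gam c w) y, ccomp Q d (F w)))"
    using ccomp_Phi[OF F w(2) ca] fst_Phi[OF F w(2)] w(4) by (simp add: snd_cchart snd_tchart)
  then show ?thesis
    using w(4) snd_incl[OF covfD(3)[OF F w(2)] ca]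
    by (simp add: charts_local_rep[OF T_charts[OF c] w(1)] tinv_T[OF c w(1)] fib_T[OF c w(1)])
      (simp add: snd_tchart charts_local_rep[OF c wc])
qed

text \<open>Once \<open>local_rep_Phi\<close> has replaced the picked chart by a fixed one, each
  component is a smooth expression in the coordinates of TN.\<close>

lemma Phi_smooth:
  assumes F: "covector_field W F"
  shows "smooth_map TM W (cotangent_bundle TQ) (Phi F)"
proof (rule smooth_mapI[OF TM])
  fix w assume w: "w \<in> W"
  have wT: "w \<in> carrier TM" using covfD(3)[OF F w] .
  obtain c where c: "c \<in> charts_at M (fst w)" using carrier_charts_at[OF M] wT by (auto simp: carrier_TM carrier_M)
  obtain d where d: "d \<in> charts_at Q (fst w)"
    using carrier_charts_at[OF Q, of "fst w"] wT sub by (auto simp: carrier_TM submanifold_def)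
  have c': "c \<in> charts M" and wc: "w \<in> fst (T c)" using carrier_fst_T[OF wT c] by auto
  have d': "d \<in> charts Q" "fst w \<in> fst d" using d by (auto simp: charts_at_charts)
  let ?G = "{w \<in> fst (T c) \<inter> W. fst w \<in> fst d}"
  note O = dom_smooth(1)[OF F c' d'(1)]
  have sub1: "coord_dom c d W \<subseteq> (snd c ` (fst c \<inter> fst d)) \<times> span C"
    using dom_base(2)[OF F c' d'(1)] opn_span[OF O] by (fastforce simp: span_bundle_model)
  have "smooth_on CC (coord_dom c d W) (\<lambda>y. ((local_rep c d id (fst y), pd C (local_rep c d id) (snd y) (fst y)),
      (pd CC (fib c d F) (Gam c (tinv c y)) y, fib c d F y)))"
  proof (intro smooth_on_Pair[OF O] dom_base(3)[OF F c' d'(1)] dom_smooth(3)[OF F c' d'(1)])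
    show "smooth_on CC (coord_dom c d W) (\<lambda>y. pd C (local_rep c d id) (snd y) (fst y))"
      by (rule smooth_on_subset[OF smooth_on_tangent[OF C incl_smooth[OF c' d'(1)]] sub1])
    show "smooth_on CC (coord_dom c d W) (\<lambda>y. pd CC (fib c d F) (Gam c (tinv c y)) y)"
    proof (rule smooth_on_pd_along[OF O CC dom_smooth(3)[OF F c' d'(1)]])
      show "smooth_on CC (coord_dom c d W) (\<lambda>y. Gam c (tinv c y))"
        by (rule smooth_on_subset[OF gam_smooth[OF c']]) (auto simp: coord_dom_def)
      fix y assume "y \<in> coord_dom c d W"
      then obtain w' where w': "w' \<in> fst (T c)" "y = snd (T c) w'" by (rule domE)
      show "Gam c (tinv c y) \<in> span CC"
        unfolding w'(2) tinv_T[OF c' w'(1)] using gam_span fst_T_carrier[OF c' w'(1)] by blast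
    qed
  qed
  then have "smooth_on CC (coord_dom c d W) (local_rep (T c) (cchart TQ (tchart Q d)) (Phi F))"
    by (rule smooth_on_congI[OF O]) (simp add: local_rep_Phi[OF F c' d'(1)])
  moreover have "Phi F ` ?G \<subseteq> fst (cchart TQ (tchart Q d))"
    using Phi_cotangent[OF F] fst_Phi[OF F] incl_tangent covfD(3)[OF F] by (auto simp: fst_cchart fst_tchart)
  ultimately show "\<exists>c\<in>charts TM. \<exists>d\<in>charts (cotangent_bundle TQ). \<exists>G\<subseteq>W. w \<in> G \<and> G \<subseteq> fst c \<and>
      Phi F ` G \<subseteq> fst d \<and> opn (model TM) (snd c ` G) \<and> smooth_on (model TM) (snd c ` G) (local_rep c d (Phi F))"
    using w wc d' O T_charts[OF c'] cchart_charts[OF TQ tchart_charts[OF Q d'(1)]]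
    by (intro bexI[of _ "T c"] bexI[of _ "cchart TQ (tchart Q d)"] exI[of _ ?G]) (auto simp: coord_dom_def)
qed

subsection \<open>The transpose\<close>

abbreviation transp :: "(('a, 'e) tvec \<Rightarrow> ('a, 'e) cvec) \<Rightarrow> ('a, 'e) tvec \<Rightarrow> ('a, 'e) cvec" where
  "transp F \<equiv> i_TN_transpose Q C N \<circ> F"

lemma tr_eval:
  assumes F: "covector_field W F" and w: "w \<in> W" and c: "c \<in> charts_at M (fst w)" and d: "d \<in> charts_at Q (fst w)"
    and v: "v \<in> tangent_at M (fst w)"
  shows "snd (transp F w) v = ccomp Q d (F w) \<bullet> pd C (local_rep c d id) (snd v c) (snd c (fst w))"
proof -
  have fv: "fst v = fst w" using tangent_atD(1)[OF v] .
  have vT: "v \<in> carrier TM" using v fv covfD(3)[OF F w] by (simp add: carrier_TM)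
  have "snd (transp F w) v = snd (F w) (i_TN Q C N v)"
    using v covfD(1)[OF F w] by (simp add: i_TN_transpose_def)
  also have "\<dots> = ccomp Q d (F w) \<bullet> snd (i_TN Q C N v) d"
    by (rule cotangent_eval[OF Q d covfD(2)[OF F w]]) (use incl_tangent[OF vT] fv in simp)
  finally show ?thesis using snd_incl[OF vT] c d fv by simp
qed

lemma tr_cotangent:
  assumes F: "covector_field W F" and w: "w \<in> W"
  shows "transp F w \<in> cotangent_at M (fst w)"
proof -
  have wT: "w \<in> carrier TM" using covfD(3)[OF F w] .
  obtain c where c: "c \<in> charts_at M (fst w)" using carrier_charts_at[OF M] wT by (auto simp: carrier_TM carrier_M)
  obtain d where d: "d \<in> charts_at Q (fst w)"
    using carrier_charts_at[OF Q, of "fst w"] wT sub by (auto simp: carrier_TM submanifold_def)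
  note ev = tr_eval[OF F w c d] and diff = incl_differentiable[OF c d]
  show ?thesis unfolding cotangent_at_def mem_Collect_eq
  proof (intro conjI ballI allI impI)
    show "fst (transp F w) = fst w" using covfD(1)[OF F w] by (simp add: i_TN_transpose_def)
    show "snd (transp F w) v = 0" if "v \<notin> tangent_at M (fst w)" for v
      using that covfD(1)[OF F w] by (simp add: i_TN_transpose_def)
    show "snd (transp F w) (tadd v v') = snd (transp F w) v + snd (transp F w) v'"
      if v: "v \<in> tangent_at M (fst w)" "v' \<in> tangent_at M (fst w)" for v v'
      unfolding ev[OF tadd_tangent[OF M v]] ev[OF v(1)] ev[OF v(2)]
      by (simp add: tadd_def pd_add_dir[OF diff] inner_add_right)
    show "snd (transp F w) (tscale r v) = r * snd (transp F w) v" if v: "v \<in> tangent_at M (fst w)" for r v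
      unfolding ev[OF tscale_tangent[OF M v]] ev[OF v] by (simp add: tscale_def pd_scale[OF diff])
  qed
qed

lemma ccomp_tr:
  assumes F: "covector_field W F" and w: "w \<in> W" and c: "c \<in> charts_at M (fst w)" and d: "d \<in> charts_at Q (fst w)" and k: "k \<in> span C"
  shows "ccomp M c (transp F w) \<bullet> k = ccomp Q d (F w) \<bullet> pd C (local_rep c d id) k (snd c (fst w))"
  using cotangent_cvector[OF M c tr_cotangent[OF F w], of k] tr_eval[OF F w c d cvector_tangent[OF M c, of k]] k
    snd_cvector[OF M c, of k] by simp

text \<open>The fibre coordinates of the transpose of \<open>F\<close> in T*N. In a slice chart they
  are the tangential components F_a.\<close>

definition fibM :: "('a, 'e) chart \<Rightarrow> (('a, 'e) tvec \<Rightarrow> ('a, 'e) cvec) \<Rightarrow> 'e \<times> 'e \<Rightarrow> 'e" where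
  "fibM c F y = ccomp M c (transp F (tinv c y))"

lemma fibM_T: "c \<in> charts M \<Longrightarrow> w \<in> fst (T c) \<Longrightarrow> fibM c F (snd (T c) w) = ccomp M c (transp F w)"
  by (simp add: fibM_def tinv_T)

lemma fibM_span: "fibM c F y \<in> span C"
  using ccomp_span[of M] by (simp add: fibM_def)

lemma covf_openin: "covector_field W F \<Longrightarrow> openin (mtop TM) W"
  by (rule smooth_map_openin[OF TM, of W T'Q F]) (simp add: covector_field_def)

text \<open>The definition mentions no chart of \<open>Q\<close>, but near each point one is
  available; there the components are those of \<open>F\<close> contracted with the Jacobian of the
  inclusion.\<close>

lemma fibM_smooth:
  assumes F: "covector_field W F" and c: "c \<in> charts M"
  shows "opn CC (snd (T c) ` (fst (T c) \<inter> W))" "smooth_on CC (snd (T c) ` (fst (T c) \<inter> W)) (fibM c F)"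
proof -
  show O: "opn CC (snd (T c) ` (fst (T c) \<inter> W))"
    using openin_mtopD[OF TM covf_openin[OF F] T_charts[OF c]] by simp
  show "smooth_on CC (snd (T c) ` (fst (T c) \<inter> W)) (fibM c F)"
  proof (rule smooth_on_local[OF _ openin_imp_subset[OF O]])
    fix y assume "y \<in> snd (T c) ` (fst (T c) \<inter> W)"
    then obtain w where w: "w \<in> fst (T c)" "w \<in> W" "y = snd (T c) w" by blast
    obtain d where d: "d \<in> charts_at Q (fst w)"
      using carrier_charts_at[OF Q, of "fst w"] covfD(3)[OF F w(2)] sub by (auto simp: carrier_TM submanifold_def)
    then have d': "d \<in> charts Q" "fst w \<in> fst d" by (auto simp: charts_at_charts)
    note O' = dom_smooth(1)[OF F c d'(1)]
    have pds: "smooth_on CC (coord_dom c d W) (\<lambda>y. pd C (local_rep c d id) k (fst y))" if "k \<in> C" for k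
      by (rule smooth_on_compose[OF CC C O' openin_imp_subset[OF incl_smooth(1)[OF c d'(1)]]
            smooth_on_pd_Basis[OF incl_smooth(2)[OF c d'(1)] that] dom_base(1,2)[OF F c d'(1)]])
    have "smooth_on CC (coord_dom c d W) (\<lambda>y. \<Sum>k\<in>C. (fib c d F y \<bullet> pd C (local_rep c d id) k (fst y)) *\<^sub>R k)"
      by (intro smooth_on_sum[OF O' CC] smooth_on_scaleR[OF O'] smooth_on_inner[OF O'] pds
          dom_smooth(3)[OF F c d'(1)] smooth_on_const[OF O' CC])
    then have "smooth_on CC (coord_dom c d W) (fibM c F)"
    proof (rule smooth_on_congI[OF O'])
      fix y assume "y \<in> coord_dom c d W"
      then obtain w where w: "w \<in> fst (T c)" "w \<in> W" "fst w \<in> fst d" "y = snd (T c) w" by (rule domE)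
      have ca: "c \<in> charts_at M (fst w)" "d \<in> charts_at Q (fst w)"
        using w c d' by (auto simp: charts_at_charts fst_tchart)
      show "(\<Sum>k\<in>C. (fib c d F y \<bullet> pd C (local_rep c d id) k (fst y)) *\<^sub>R k) = fibM c F y"
        by (rule span_eqI[OF C sum_Basis_in_span fibM_span])
          (use w inner_sum_Basis[OF C] ccomp_tr[OF F w(2) ca span_base] in
            \<open>simp add: fibM_T[OF c w(1)] fib_T[OF c w(1)], simp add: snd_tchart\<close>)
    qed
    moreover have "y \<in> coord_dom c d W" using w d' by (auto simp: coord_dom_def)
    ultimately show "\<exists>S'. opn CC S' \<and> y \<in> S' \<and> smooth_on CC S' (fibM c F)" using O' by blast
  qed
qed

subsection \<open>Slice charts\<close>

lemma slice_rep:
  assumes "c \<in> slice_charts Q C N" "y \<in> snd c ` (fst c \<inter> N)"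
  shows "local_rep (slice_restr N c) c id y = y"
  using assms(2) charts_local_rep[OF slice_restr_charts[OF Q sub assms(1)], of _ c id] by auto

lemma slice_pd:
  assumes c: "c \<in> slice_charts Q C N" and y: "y \<in> snd c ` (fst c \<inter> N)" and u: "u \<in> span C"
  shows "pd C (local_rep (slice_restr N c) c id) u y = u"
proof -
  have O: "opn C (snd c ` (fst c \<inter> N))" using charts_opn[OF slice_restr_charts[OF Q sub c]] by simp
  have "pd C (local_rep (slice_restr N c) c id) u y = pd C (\<lambda>y. y) u y"
    by (rule pd_cong[OF O y]) (rule slice_rep[OF c])
  then show ?thesis using pd_bounded_linear[OF bounded_linear_ident opn_span[OF O y] u] by simp
qed

text \<open>In a slice chart the inclusion has the identity as its derivative on
  \<open>span C\<close>, so the transpose merely forgets the normal components.\<close>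

lemma slice_ccomp_tr:
  assumes F: "covector_field W F" and w: "w \<in> W" and c: "c \<in> slice_charts Q C N" "fst w \<in> fst c" and k: "k \<in> span C"
  shows "ccomp M (slice_restr N c) (transp F w) \<bullet> k = ccomp Q c (F w) \<bullet> k"
proof -
  have wN: "fst w \<in> N" using covfD(3)[OF F w] by (simp add: carrier_TM)
  have ca: "slice_restr N c \<in> charts_at M (fst w)" "c \<in> charts_at Q (fst w)"
    using slice_restr_charts[OF Q sub c(1)] slice_chartsD(1)[OF c(1)] c(2) wN by (auto simp: charts_at_charts)
  have "pd C (local_rep (slice_restr N c) c id) k (snd c (fst w)) = k"
    by (rule slice_pd[OF c(1) _ k]) (use wN c(2) in blast)
  then show ?thesis using ccomp_tr[OF F w ca k] by simp
qed

text \<open>In slice coordinates the inclusion of TN into TQ is the identity. The base part of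
  \<open>Phi F\<close> is therefore \<open>y\<close> itself, and its image is a graph.\<close>

lemma local_rep_Phi_slice:
  assumes F: "covector_field W F" and c: "c \<in> slice_charts Q C N" and y: "y \<in> snd (T (slice_restr N c)) ` (fst (T (slice_restr N c)) \<inter> W)"
  shows "local_rep (T (slice_restr N c)) (cchart TQ (tchart Q c)) (Phi F) y =
    (y, (pd CC (fib (slice_restr N c) c F) (Gam (slice_restr N c) (tinv (slice_restr N c) y)) y, fib (slice_restr N c) c F y))"
proof -
  let ?c = "slice_restr N c"
  have coord_dom: "y \<in> coord_dom ?c c W" using y by (auto simp: coord_dom_def fst_tchart)
  have c': "?c \<in> charts M" by (rule slice_restr_charts[OF Q sub c])
  have fy: "fst y \<in> snd c ` (fst c \<inter> N)" using y by (auto simp: fst_tchart snd_tchart)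
  have "snd y \<in> span C" using opn_span[OF fibM_smooth(1)[OF F c'] y] by (auto simp: span_bundle_model)
  then show ?thesis
    using local_rep_Phi[OF F c' slice_chartsD(1)[OF c] coord_dom] slice_rep[OF c fy] slice_pd[OF c fy] by simp
qed

section \<open>Legendre maps and isotropic images\<close>

abbreviation "T'M \<equiv> cotangent_bundle (submfd Q C N)"

lemma T'M: "satlas T'M" using satlas_cotangent_bundle[OF M] .

lemma local_rep_tr:
  assumes F: "covector_field W F" and c: "c \<in> charts M" and w: "w \<in> fst (T c)" "w \<in> W"
  shows "local_rep (T c) (cchart M c) (transp F) (snd (T c) w) = (fst (snd (T c) w), fibM c F (snd (T c) w))"
  unfolding charts_local_rep[OF T_charts[OF c] w(1)] fibM_T[OF c w(1)] snd_cchart fst_snd_T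
    cotangent_atD(1)[OF tr_cotangent[OF F w(2)]] ..

lemma tr_smooth:
  assumes F: "covector_field W F"
  shows "smooth_map TM W T'M (transp F)"
proof (rule smooth_mapI[OF TM])
  fix w assume w: "w \<in> W"
  have wT: "w \<in> carrier TM" using covfD(3)[OF F w] .
  obtain c where c: "c \<in> charts_at M (fst w)" using carrier_charts_at[OF M] wT by (auto simp: carrier_TM carrier_M)
  have c': "c \<in> charts M" and wc: "w \<in> fst (T c)" using carrier_fst_T[OF wT c] by auto
  let ?G = "fst (T c) \<inter> W"
  note O = fibM_smooth(1)[OF F c']
  have "smooth_on CC (snd (T c) ` ?G) (\<lambda>y. (fst y, fibM c F y))"
    by (intro smooth_on_Pair[OF O] fibM_smooth(2)[OF F c'] smooth_on_linear[OF bounded_linear_fst O CC])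
  then have "smooth_on CC (snd (T c) ` ?G) (local_rep (T c) (cchart M c) (transp F))"
    by (rule smooth_on_congI[OF O]) (use local_rep_tr[OF F c'] in fastforce)
  moreover have "transp F ` ?G \<subseteq> fst (cchart M c)"
  proof
    fix p assume "p \<in> transp F ` ?G"
    then obtain w' where w': "w' \<in> fst (T c)" "w' \<in> W" "p = transp F w'" by blast
    have "fst w' \<in> fst c" using w'(1) by (simp add: fst_tchart)
    then show "p \<in> fst (cchart M c)"
      using tr_cotangent[OF F w'(2)] cotangent_atD(1)[OF tr_cotangent[OF F w'(2)]] unfolding fst_cchart w'(3) by simp
  qed
  ultimately show "\<exists>c\<in>charts TM. \<exists>d\<in>charts T'M. \<exists>G\<subseteq>W. w \<in> G \<and> G \<subseteq> fst c \<and>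
      transp F ` G \<subseteq> fst d \<and> opn (model TM) (snd c ` G) \<and> smooth_on (model TM) (snd c ` G) (local_rep c d (transp F))"
    using w wc O T_charts[OF c'] cchart_charts[OF M c']
    by (intro bexI[of _ "T c"] bexI[of _ "cchart M c"] exI[of _ ?G]) auto
qed

lemma pd_fibM_span:
  assumes F: "covector_field W F" and c: "c \<in> charts M" and y: "y \<in> snd (T c) ` (fst (T c) \<inter> W)" and g: "g \<in> span CC"
  shows "pd CC (fibM c F) g y \<in> span C"
  by (rule pd_in_span[OF fibM_smooth(1)[OF F c] y fibM_span C smooth_on_differentiable[OF fibM_smooth(2)[OF F c] y] g])

lemma tangent_map_tr:
  assumes F: "covector_field W F" and w: "w \<in> W" and c: "c \<in> charts_at M (fst w)" and X: "X \<in> tangent_at TM w"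
  shows "snd (tangent_map TM T'M (transp F) X) (cchart M c) =
    (fst (snd X (T c)), pd CC (fibM c F) (snd X (T c)) (snd (T c) w))"
proof -
  have wT: "w \<in> carrier TM" using covfD(3)[OF F w] .
  have c': "c \<in> charts M" and wc: "w \<in> fst (T c)" using carrier_fst_T[OF wT c] by auto
  let ?y = "snd (T c) w" and ?Y = "snd (T c) ` (fst (T c) \<inter> W)"
  note O = fibM_smooth(1)[OF F c']
  have y: "?y \<in> ?Y" using w wc by blast
  have u: "snd X (T c) \<in> span CC" using tangent_atD(2)[OF X T_charts_at[OF wT c]] by simp
  have trw: "transp F w \<in> cotangent_at M (fst (transp F w))" "fst (transp F w) = fst w"
    using tr_cotangent[OF F w] cotangent_atD(1)[OF tr_cotangent[OF F w]] by simp_all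
  have cc: "cchart M c \<in> charts_at T'M (transp F w)"
    by (rule cchart_charts_at[OF M _ trw(1)]) (use c trw(2) in simp)
  have "snd (tangent_map TM T'M (transp F) X) (cchart M c) = pd CC (local_rep (T c) (cchart M c) (transp F)) (snd X (T c)) ?y"
    using snd_tangent_map[OF TM T'M tr_smooth[OF F] w X T_charts_at[OF wT c] cc]
    unfolding model_tangent_bundle model_submfd .
  also have "\<dots> = pd CC (\<lambda>y. (fst y, fibM c F y)) (snd X (T c)) ?y"
    by (rule pd_cong[OF O y]) (use local_rep_tr[OF F c'] in fastforce)
  also have "\<dots> = (pd CC fst (snd X (T c)) ?y, pd CC (fibM c F) (snd X (T c)) ?y)"
    by (rule pd_Pair[OF bounded_linear_imp_differentiable[OF bounded_linear_fst]
          smooth_on_differentiable[OF fibM_smooth(2)[OF F c'] y] opn_span[OF O y] u])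
  also have "pd CC fst (snd X (T c)) ?y = fst (snd X (T c))"
    by (rule pd_bounded_linear[OF bounded_linear_fst opn_span[OF O y] u])
  finally show ?thesis .
qed

text \<open>The transpose of \<open>F\<close> preserves base points, so its Jacobian is block
  triangular with an identity block. Injectivity is decided on the vertical vectors
  \<open>(0, k)\<close>.\<close>

lemma inj_tr_iff:
  assumes F: "covector_field W F" and w: "w \<in> W" and c: "c \<in> charts_at M (fst w)"
  shows "inj_on (tangent_map TM T'M (transp F)) (tangent_at TM w) \<longleftrightarrow>
    (\<forall>k\<in>span C. pd CC (fibM c F) (0, k) (snd (T c) w) = 0 \<longrightarrow> k = 0)" (is "?inj \<longleftrightarrow> ?reg")
proof
  have wT: "w \<in> carrier TM" using covfD(3)[OF F w] .
  have c': "c \<in> charts M" and wc: "w \<in> fst (T c)" using carrier_fst_T[OF wT c] by auto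
  let ?y = "snd (T c) w"
  have y: "?y \<in> snd (T c) ` (fst (T c) \<inter> W)" using w wc by blast
  note diff = smooth_on_differentiable[OF fibM_smooth(2)[OF F c'] y]
  have trw: "transp F w \<in> cotangent_at M (fst (transp F w))" "fst (transp F w) = fst w"
    using tr_cotangent[OF F w] cotangent_atD(1)[OF tr_cotangent[OF F w]] by simp_all
  have cc: "cchart M c \<in> charts_at T'M (transp F w)"
    by (rule cchart_charts_at[OF M _ trw(1)]) (use c trw(2) in simp)
  note tm = tangent_map_tangent[OF TM T'M tr_smooth[OF F] w]
  have Tc: "T c \<in> charts_at TM w" by (rule T_charts_at[OF wT c])
  {
    assume inj: ?inj
    show ?reg
    proof (intro ballI impI)
      fix k assume k: "k \<in> span C" "pd CC (fibM c F) (0, k) ?y = 0"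
      have sp: "(0, k) \<in> span CC" "0 \<in> span CC" using k span_zero[of CC] by (simp_all add: span_bundle_model span_zero)
      \<comment> \<open>The vertical vector is compared with the zero vector at \<open>w\<close>:
        both have the same image under the tangent map.\<close>
      let ?X = "cvector TM (T c) w (0, k)" and ?Z = "cvector TM (T c) w 0"
      have X: "?X \<in> tangent_at TM w" "snd ?X (T c) = (0, k)"
        using cvector_tangent[OF TM Tc] snd_cvector[OF TM Tc] sp by simp_all
      have Z: "?Z \<in> tangent_at TM w" "snd ?Z (T c) = 0"
        using cvector_tangent[OF TM Tc] snd_cvector[OF TM Tc] sp by simp_all
      have "pd CC (fibM c F) 0 ?y = 0" using pd_scale[OF diff, of 0 0] by simp
      then have "snd (tangent_map TM T'M (transp F) ?X) (cchart M c) = snd (tangent_map TM T'M (transp F) ?Z) (cchart M c)"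
        unfolding tangent_map_tr[OF F w c X(1)] tangent_map_tr[OF F w c Z(1)] X(2) Z(2) using k by simp
      then have "tangent_map TM T'M (transp F) ?X = tangent_map TM T'M (transp F) ?Z"
        by (rule tangent_at_eqI[OF tm[OF X(1)] tm[OF Z(1)] cc])
      then have "?X = ?Z" using inj_onD[OF inj] X(1) Z(1) by blast
      then show "k = 0" using X(2) Z(2) by (simp add: zero_prod_def)
    qed
  next
    assume reg: ?reg
    show ?inj
    proof (rule inj_onI)
      fix X Z assume X: "X \<in> tangent_at TM w" and Z: "Z \<in> tangent_at TM w"
        and eq: "tangent_map TM T'M (transp F) X = tangent_map TM T'M (transp F) Z"
      let ?u = "snd X (T c)" and ?v = "snd Z (T c)"
      have e1: "fst ?u = fst ?v" and e2: "pd CC (fibM c F) ?u ?y = pd CC (fibM c F) ?v ?y"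
        using tangent_map_tr[OF F w c X] tangent_map_tr[OF F w c Z] unfolding eq by simp_all
      have sp: "?u \<in> span CC" "?v \<in> span CC"
        using tangent_atD(2)[OF X Tc] tangent_atD(2)[OF Z Tc] by simp_all
      have "pd CC (fibM c F) (?u - ?v) ?y = 0" using e2 linear_diff[OF pd_linear[OF diff]] by simp
      moreover have "?u - ?v = (0, snd ?u - snd ?v)" using e1 by (simp add: prod_eq_iff)
      moreover have "snd ?u - snd ?v \<in> span C" using sp by (auto simp: span_bundle_model mem_Times_iff intro: span_diff)
      ultimately have "snd ?u - snd ?v = 0" using bspec[OF reg, of "snd ?u - snd ?v"] by metis
      then have "?u = ?v" using e1 by (simp add: prod_eq_iff)
      then show "X = Z" by (rule tangent_at_eqI[OF X Z Tc])
    qed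
  }
qed

text \<open>In a slice chart, this is the pullback along \<open>Phi F\<close> of the canonical one-form of \<open>T\<^sup>*TQ\<close>.\<close>

definition pullback_form :: "('a, 'e) chart \<Rightarrow> (('a, 'e) tvec \<Rightarrow> ('a, 'e) cvec) \<Rightarrow> 'e \<times> 'e \<Rightarrow> 'e \<times> 'e" where
  "pullback_form c F y = (pd CC (fib (slice_restr N c) c F) (Gam (slice_restr N c) (tinv (slice_restr N c) y)) y, fib (slice_restr N c) c F y)"

definition coords :: "('a, 'e) chart \<Rightarrow> ('a, 'e) tvec set \<Rightarrow> ('e \<times> 'e) set" where
  "coords c W = snd (T c) ` (fst (T c) \<inter> W)"

lemma coordsE:
  assumes "y \<in> coords c W"
  obtains w where "w \<in> fst (T c)" "w \<in> W" "y = snd (T c) w"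
  using assms unfolding coords_def by blast

lemma coords_dom: "c \<in> slice_charts Q C N \<Longrightarrow> coord_dom (slice_restr N c) c W = coords (slice_restr N c) W"
  by (auto simp: coord_dom_def coords_def fst_tchart)

lemma al_smooth:
  assumes F: "covector_field W F" and c: "c \<in> slice_charts Q C N"
  shows "opn CC (coords (slice_restr N c) W)" "smooth_on CC (coords (slice_restr N c) W) (pullback_form c F)"
proof -
  have c': "slice_restr N c \<in> charts M" "c \<in> charts Q" using slice_restr_charts[OF Q sub c] slice_chartsD(1)[OF c] by auto
  show O: "opn CC (coords (slice_restr N c) W)" using dom_smooth(1)[OF F c'] by (simp add: coords_dom[OF c])
  have fs: "smooth_on CC (coords (slice_restr N c) W) (fib (slice_restr N c) c F)"
    using dom_smooth(3)[OF F c'] by (simp add: coords_dom[OF c])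
  show "smooth_on CC (coords (slice_restr N c) W) (pullback_form c F)"
    unfolding pullback_form_def
  proof (intro smooth_on_Pair[OF O] fs smooth_on_pd_along[OF O CC fs])
    show "smooth_on CC (coords (slice_restr N c) W) (\<lambda>y. Gam (slice_restr N c) (tinv (slice_restr N c) y))"
      by (rule smooth_on_subset[OF gam_smooth[OF c'(1)]]) (auto simp: coords_def)
    fix y assume "y \<in> coords (slice_restr N c) W"
    then obtain w where w: "w \<in> fst (T (slice_restr N c))" "y = snd (T (slice_restr N c)) w" by (rule coordsE)
    show "Gam (slice_restr N c) (tinv (slice_restr N c) y) \<in> span CC"
      unfolding w(2) tinv_T[OF c'(1) w(1)] using gam_span fst_T_carrier[OF c'(1) w(1)] by blast
  qed
qed

text \<open>The bound is \<open>span BB\<close> and not \<open>span CC\<close>, since normal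
  components of \<open>F\<close> may remain in the form; they drop out when it is paired with
  vectors of \<open>span CC\<close>.\<close>

lemma al_span:
  assumes F: "covector_field W F" and c: "c \<in> slice_charts Q C N" and y: "y \<in> coords (slice_restr N c) W"
  shows "pullback_form c F y \<in> span BB"
proof -
  have c': "slice_restr N c \<in> charts M" "c \<in> charts Q" using slice_restr_charts[OF Q sub c] slice_chartsD(1)[OF c] by auto
  obtain w where w: "w \<in> fst (T (slice_restr N c))" "w \<in> W" "y = snd (T (slice_restr N c)) w" using y by (rule coordsE)
  have wc: "fst w \<in> fst c" using w(1) by (simp add: fst_tchart)
  have ca: "slice_restr N c \<in> charts_at M (fst w)" "c \<in> charts_at Q (fst w)"
    using fst_T_carrier[OF c'(1) w(1)] c' wc by (simp_all add: charts_at_charts)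
  have g: "Gam (slice_restr N c) w \<in> span CC" using gam_span ca(1) covfD(3)[OF F w(2)] by blast
  show ?thesis
    using pd_fib_span[OF F w(2) ca g] unfolding pullback_form_def w(3) tinv_T[OF c'(1) w(1)] fib_T[OF c'(1) w(1)]
    by (simp add: span_bundle_model ccomp_span)
qed

lemma local_rep_Phi_al:
  assumes F: "covector_field W F" and c: "c \<in> slice_charts Q C N" and y: "y \<in> coords (slice_restr N c) W"
  shows "local_rep (T (slice_restr N c)) (cchart TQ (tchart Q c)) (Phi F) y = (y, pullback_form c F y)"
  using local_rep_Phi_slice[OF F c, of y] y by (simp add: coords_def pullback_form_def)

text \<open>With the identity as base part, the inner derivatives in \<open>omega_eq\<close> reduce
  to \<open>u\<close> and \<open>v\<close>, and what remains is minus the exterior derivative of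
  \<open>pullback_form\<close> on \<open>(u, v)\<close>. The components of \<open>X\<close> and
  \<open>Y\<close> are prescribed in all induced charts because \<open>omega\<close> picks its
  own.\<close>

lemma omega_Phi:
  assumes F: "covector_field W F" and c: "c \<in> slice_charts Q C N" and w: "w \<in> W" "fst w \<in> fst c"
    and u: "u \<in> span CC" and v: "v \<in> span CC"
    and X: "fst X = Phi F w" "\<And>e. e \<in> charts_at TQ (fst (Phi F w)) \<Longrightarrow>
      snd X (cchart TQ e) = pd CC (local_rep (T (slice_restr N c)) (cchart TQ e) (Phi F)) u (snd (T (slice_restr N c)) w)"
    and Y: "fst Y = Phi F w" "\<And>e. e \<in> charts_at TQ (fst (Phi F w)) \<Longrightarrow>
      snd Y (cchart TQ e) = pd CC (local_rep (T (slice_restr N c)) (cchart TQ e) (Phi F)) v (snd (T (slice_restr N c)) w)"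
  shows "omega TQ X Y = pd CC (\<lambda>y. pullback_form c F y \<bullet> u) v (snd (T (slice_restr N c)) w) -
    pd CC (\<lambda>y. pullback_form c F y \<bullet> v) u (snd (T (slice_restr N c)) w)"
proof -
  let ?c = "slice_restr N c"
  let ?r = "local_rep (T ?c) (cchart TQ (tchart Q c)) (Phi F)" and ?y = "snd (T ?c) w" and ?Y = "coords ?c W"
  have wT: "w \<in> carrier TM" using covfD(3)[OF F w(1)] .
  have wN: "fst w \<in> N" using wT by (simp add: carrier_TM)
  have ca: "?c \<in> charts_at M (fst w)" "c \<in> charts_at Q (fst w)"
    using slice_restr_charts[OF Q sub c] slice_chartsD(1)[OF c] w(2) wN by (auto simp: charts_at_charts)
  have wc: "w \<in> fst (T ?c)" using carrier_fst_T[OF wT ca(1)] by blast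
  have d: "tchart Q c \<in> charts_at TQ (fst (Phi F w))"
    unfolding fst_Phi[OF F w(1)] by (rule tchart_charts_at[OF Q]) (use ca incl_tangent[OF wT] in simp_all)
  note O = al_smooth(1)[OF F c]
  have y: "?y \<in> ?Y" using w wc by (auto simp: coords_def)
  have r: "?r z = (z, pullback_form c F z)" if "z \<in> ?Y" for z by (rule local_rep_Phi_al[OF F c that])
  have pd_r: "pd CC (\<lambda>z. fst (?r z)) a z = a" if z: "z \<in> ?Y" and a: "a \<in> span CC" for a z
  proof -
    have "pd CC (\<lambda>z. fst (?r z)) a z = pd CC (\<lambda>z. z) a z" by (rule pd_cong[OF O z]) (simp add: r)
    then show ?thesis using pd_bounded_linear[OF bounded_linear_ident opn_span[OF O z] a] by simp
  qed
  have *: "pd CC (\<lambda>y. snd (?r y) \<bullet> pd CC (\<lambda>z. fst (?r z)) a y) b ?y = pd CC (\<lambda>y. pullback_form c F y \<bullet> a) b ?y" if "a \<in> span CC" for a b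
    by (rule pd_cong[OF O y]) (simp add: r pd_r[OF _ that])
  have "omega TQ X Y = pd CC (\<lambda>y. snd (?r y) \<bullet> pd CC (\<lambda>z. fst (?r z)) u y) v ?y -
      pd CC (\<lambda>y. snd (?r y) \<bullet> pd CC (\<lambda>z. fst (?r z)) v y) u ?y"
    using omega_eq[OF TM TQ Phi_smooth[OF F] w(1) T_charts_at[OF wT ca(1)] d, of u v X Y] u v X Y by simp
  then show ?thesis unfolding *[OF u] *[OF v] .
qed

section \<open>Isotropy of the image and closedness of the pulled back form\<close>

text \<open>Corestricted to the image, \<open>Phi F\<close> stays smooth, so coordinate vectors of
  TN push forward to tangent vectors of the image. Isotropy evaluated on these is closedness, by
  \<open>omega_Phi\<close>.\<close>

lemma isotropic_closed:
  assumes F: "covector_field W F" and c: "c \<in> slice_charts Q C N" and iso: "isotropic_submanifold TQ (Phi F ` W)"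
    and y: "y \<in> coords (slice_restr N c) W" and u: "u \<in> span CC" and v: "v \<in> span CC"
  shows "pd CC (\<lambda>y. pullback_form c F y \<bullet> u) v y = pd CC (\<lambda>y. pullback_form c F y \<bullet> v) u y"
proof -
  let ?c = "slice_restr N c" and ?S = "Phi F ` W" and ?R = "cotangent_bundle TQ"
  obtain C2 where S: "submanifold ?R C2 ?S" and om: "\<forall>z\<in>?S. \<forall>X\<in>tangent_at (submfd ?R C2 ?S) z.
      \<forall>Y\<in>tangent_at (submfd ?R C2 ?S) z.
        omega TQ (tangent_map (submfd ?R C2 ?S) ?R id X) (tangent_map (submfd ?R C2 ?S) ?R id Y) = 0"
    using iso unfolding isotropic_submanifold_def Let_def by blast
  let ?S' = "submfd ?R C2 ?S"
  have S': "satlas ?S'" by (rule satlas_submfd[OF T'TQ S])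
  have Ps: "smooth_map TM W ?S' (Phi F)"
    by (rule smooth_map_into_submfd[OF TM T'TQ S Phi_smooth[OF F]]) simp
  have i: "smooth_map ?S' ?S ?R id" by (rule smooth_map_inclusion[OF T'TQ S])
  obtain w where w: "w \<in> fst (T ?c)" "w \<in> W" "y = snd (T ?c) w" using y by (rule coordsE)
  have c': "?c \<in> charts M" by (rule slice_restr_charts[OF Q sub c])
  have wT: "w \<in> carrier TM" and ca: "?c \<in> charts_at M (fst w)" using fst_T_carrier[OF c' w(1)] by auto
  have wc: "fst w \<in> fst c" using w(1) by (simp add: fst_tchart)
  let ?z = "Phi F w"
  have z: "?z \<in> ?S" using w by blast
  have Tc: "T ?c \<in> charts_at TM w" by (rule T_charts_at[OF wT ca])
  obtain s where s: "s \<in> charts_at ?S' ?z"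
    using carrier_charts_at[OF S', of ?z] z carrier_submfd[OF S] by auto
  define X where "X a = tangent_map TM ?S' (Phi F) (cvector TM (T ?c) w a)" for a
  have cv: "cvector TM (T ?c) w a \<in> tangent_at TM w" "snd (cvector TM (T ?c) w a) (T ?c) = a" if "a \<in> span CC" for a
    using cvector_tangent[OF TM Tc] snd_cvector[OF TM Tc] that by simp_all
  have X: "X a \<in> tangent_at ?S' ?z" "snd (X a) s = pd CC (local_rep (T ?c) s (Phi F)) a (snd (T ?c) w)" if "a \<in> span CC" for a
    using tangent_map_tangent[OF TM S' Ps w(2) cv(1)[OF that]]
      snd_tangent_map[OF TM S' Ps w(2) cv(1)[OF that] Tc s] cv(2)[OF that] by (simp_all add: X_def)
  \<comment> \<open>The inclusion after the corestriction is \<open>Phi F\<close> again, so the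
    chain rule gives the components that \<open>omega_Phi\<close> requires.\<close>
  have Ti: "snd (tangent_map ?S' ?R id (X a)) (cchart TQ e) = pd CC (local_rep (T ?c) (cchart TQ e) (Phi F)) a (snd (T ?c) w)"
    if a: "a \<in> span CC" and e: "e \<in> charts_at TQ (fst ?z)" for a e
  proof -
    have "?z \<in> cotangent_at TQ (fst ?z)" using Phi_cotangent[OF F w(2)] fst_Phi[OF F w(2)] by simp
    then have ce: "cchart TQ e \<in> charts_at ?R (id ?z)" using cchart_charts_at[OF TQ e] by simp
    have "snd (tangent_map ?S' ?R id (X a)) (cchart TQ e) = pd C2 (local_rep s (cchart TQ e) id) (snd (X a) s) (snd s ?z)"
      using snd_tangent_map[OF S' T'TQ i z X(1)[OF a] s ce] unfolding model_submfd .
    also have "\<dots> = pd CC (local_rep (T ?c) (cchart TQ e) (id \<circ> Phi F)) a (snd (T ?c) w)"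
      unfolding X(2)[OF a] using pd_local_rep_comp[OF TM S' T'TQ Ps i w(2) z Tc s, of "cchart TQ e" a] ce a by simp
    finally show ?thesis by simp
  qed
  have fX: "fst (tangent_map ?S' ?R id (X a)) = ?z" if "a \<in> span CC" for a
    using tangent_atD(1)[OF X(1)[OF that]] by simp
  have "omega TQ (tangent_map ?S' ?R id (X u)) (tangent_map ?S' ?R id (X v)) =
      pd CC (\<lambda>y. pullback_form c F y \<bullet> u) v (snd (T ?c) w) - pd CC (\<lambda>y. pullback_form c F y \<bullet> v) u (snd (T ?c) w)"
    by (rule omega_Phi[OF F c w(2) wc u v fX[OF u] Ti[OF u] fX[OF v] Ti[OF v]])
  moreover have "omega TQ (tangent_map ?S' ?R id (X u)) (tangent_map ?S' ?R id (X v)) = 0"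
    using om z X(1)[OF u] X(1)[OF v] by blast
  ultimately show ?thesis using w(3) by simp
qed

text \<open>Serves for the shear that subtracts the graph in the fibres, with the opposite shear as
  \<open>h'\<close>.\<close>

lemma bij_shift:
  assumes "\<And>z. z \<in> D \<Longrightarrow> h z \<in> D" "\<And>z. z \<in> D \<Longrightarrow> h' z \<in> D" "\<And>z. z \<in> D \<Longrightarrow> h (h' z) = z"
  shows "h ` D = D"
proof
  show "h ` D \<subseteq> D" using assms(1) by blast
  show "D \<subseteq> h ` D"
  proof
    fix z assume z: "z \<in> D"
    have "h (h' z) \<in> h ` D" by (rule imageI) (rule assms(2)[OF z])
    then show "z \<in> h ` D" by (simp add: assms(3)[OF z])
  qed
qed

text \<open>The image is a graph over an open subset of \<open>TN\<close>; subtracting it from the fibre coordinates gives a slice chart.\<close>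

lemma slice_chart_Phi:
  assumes F: "covector_field W F" and c: "c \<in> slice_charts Q C N" and W: "W \<subseteq> fst (T (slice_restr N c))"
  defines "C2 \<equiv> (\<lambda>b. (b, 0)) ` CC"
  shows "\<exists>s\<in>slice_charts (cotangent_bundle TQ) C2 (Phi F ` W). Phi F ` W \<subseteq> fst s \<and>
    (\<forall>w\<in>W. snd s (Phi F w) = (snd (T (slice_restr N c)) w, 0))"
proof -
  let ?c = "slice_restr N c" and ?R = "cotangent_bundle TQ" and ?Y = "coords (slice_restr N c) W"
  let ?D = "cchart TQ (tchart Q c)" and ?K = "bundle_model BB"
  have c': "?c \<in> charts M" "c \<in> charts Q" using slice_restr_charts[OF Q sub c] slice_chartsD(1)[OF c] by auto
  have tc: "tchart Q c \<in> charts TQ" by (rule tchart_charts[OF Q c'(2)])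
  have D: "?D \<in> charts ?R" by (rule cchart_charts[OF TQ tc])
  have K: "?K \<subseteq> Basis" using bundle_model_Basis[OF BB] .
  have DI: "snd ?D ` fst ?D = snd (tchart Q c) ` fst (tchart Q c) \<times> span BB"
    using cchart_image_full[OF TQ tc] by simp
  note DO = charts_opn[OF D, simplified]
  note Y = al_smooth[OF F c]
  \<comment> \<open>\<open>pullback_form\<close> depends on coordinates of TN only. The projection
    extends it to nearby points of TQ, constantly along the normal directions, before it is
    subtracted.\<close>
  define pr where "pr z = cproj CC (fst z)" for z :: "('e \<times> 'e) \<times> ('e \<times> 'e)"
  have prl: "bounded_linear pr"
    unfolding pr_def by (rule bounded_linear_compose[OF bounded_linear_cproj bounded_linear_fst])
  define U where "U = {z \<in> snd ?D ` fst ?D. pr z \<in> ?Y}"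
  have U: "opn ?K U" unfolding U_def
    by (rule openin_preimage_smooth[OF DO smooth_on_linear[OF prl DO K] _ Y(1)]) (simp add: pr_def cproj_span)
  have U1: "U \<subseteq> snd ?D ` fst ?D" by (auto simp: U_def)
  \<comment> \<open>Both shears fix the base part and hence the value of \<open>pr\<close>, which
    makes them inverse to each other.\<close>
  define h where "h z = (fst z, snd z - pullback_form c F (pr z))" for z
  define h' where "h' z = (fst z, snd z + pullback_form c F (pr z))" for z
  have as: "smooth_on ?K U (\<lambda>z. pullback_form c F (pr z))"
    by (rule smooth_on_compose[OF K CC U openin_imp_subset[OF Y(1)] Y(2) smooth_on_linear[OF prl U K]])
      (simp add: U_def)
  have hs: "smooth_on ?K U h" "smooth_on ?K U h'"
    unfolding h_def h'_def
    by (intro smooth_on_Pair[OF U] smooth_on_diff[OF U] smooth_on_add[OF U] as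
        smooth_on_linear[OF bounded_linear_fst U K] smooth_on_linear[OF bounded_linear_snd U K])+
  have mem: "h z \<in> U" "h' z \<in> U" if "z \<in> U" for z
    using that al_span[OF F c, of "pr z"] unfolding U_def DI h_def h'_def pr_def
    by (auto simp: mem_Times_iff intro: span_diff span_add)
  have hh: "h (h' z) = z" "h' (h z) = z" for z by (simp_all add: h_def h'_def pr_def)
  have hU: "h ` U = U" by (rule bij_shift[of U h h']) (use mem hh in auto)
  define s where "s = ({z \<in> fst ?D. snd ?D z \<in> U}, h \<circ> snd ?D)"
  have s: "s \<in> charts ?R"
    unfolding s_def by (rule charts_diffeo[where h' = h', OF T'TQ D]) (use U U1 hs hh(2) in \<open>simp_all add: hU\<close>)
  have PD: "Phi F w \<in> fst ?D \<and> snd ?D (Phi F w) = (snd (T ?c) w, pullback_form c F (snd (T ?c) w)) \<and> snd (T ?c) w \<in> ?Y \<and> snd (T ?c) w \<in> span CC" if w: "w \<in> W" for w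
  proof -
    have wT: "w \<in> fst (T ?c)" using W w by blast
    have y: "snd (T ?c) w \<in> ?Y" using w wT by (auto simp: coords_def)
    have "i_TN Q C N w \<in> tangent_at Q (fst w)" using incl_tangent[OF covfD(3)[OF F w]] .
    moreover have "fst w \<in> fst c" using wT by (simp add: fst_tchart)
    ultimately have "Phi F w \<in> fst ?D"
      using Phi_cotangent[OF F w] fst_Phi[OF F w] by (simp add: fst_cchart fst_tchart)
    moreover have "snd ?D (Phi F w) = (snd (T ?c) w, pullback_form c F (snd (T ?c) w))"
      using local_rep_Phi_al[OF F c y] by (simp only: charts_local_rep[OF T_charts[OF c'(1)] wT])
    ultimately show ?thesis using y opn_span[OF Y(1) y] by blast
  qed
  have sP: "Phi F w \<in> fst s \<and> snd s (Phi F w) = (snd (T ?c) w, 0)" if w: "w \<in> W" for w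
  proof -
    note P = PD[OF w]
    have pr: "pr (snd (T ?c) w, pullback_form c F (snd (T ?c) w)) = snd (T ?c) w"
      using P cproj_ident[OF CC] by (simp add: pr_def)
    have "snd ?D (Phi F w) \<in> U" using P pr unfolding U_def by (metis (no_types, lifting) imageI mem_Collect_eq)
    then show ?thesis using P pr unfolding s_def by (simp add: h_def)
  qed
  have spC2: "span C2 = (\<lambda>b. (b, 0)) ` span CC"
    unfolding C2_def using linear_span_image[OF bounded_linear.linear[OF bounded_linear_Pair_0(1)]] by metis
  have "snd s ` (fst s \<inter> Phi F ` W) = snd s ` fst s \<inter> span C2"
  proof
    show "snd s ` (fst s \<inter> Phi F ` W) \<subseteq> snd s ` fst s \<inter> span C2"
      using sP PD unfolding spC2 by auto
    \<comment> \<open>For a point of the slice, the normal base coordinates vanish, so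
      \<open>pr\<close> returns its base part, and the fibre part vanishes after the shear; hence
      the point lies on the graph.\<close>
    show "snd s ` fst s \<inter> span C2 \<subseteq> snd s ` (fst s \<inter> Phi F ` W)"
    proof
      fix \<xi> assume "\<xi> \<in> snd s ` fst s \<inter> span C2"
      then obtain z b where z: "z \<in> fst s" "\<xi> = snd s z" and b: "b \<in> span CC" "\<xi> = (b, 0)" unfolding spC2 by blast
      have zD: "z \<in> fst ?D" "snd ?D z \<in> U" using z by (auto simp: s_def)
      have "h (snd ?D z) = (b, 0)" using z b by (simp add: s_def)
      then have f: "fst (snd ?D z) = b" "snd (snd ?D z) = pullback_form c F (pr (snd ?D z))" by (simp_all add: h_def)
      have prb: "pr (snd ?D z) = b" using f(1) cproj_ident[OF CC b(1)] by (simp add: pr_def)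
      have "b \<in> ?Y" using zD(2) prb by (simp add: U_def)
      then obtain w where w: "w \<in> W" "b = snd (T ?c) w" by (rule coordsE)
      have "snd ?D z = snd ?D (Phi F w)" using PD[OF w(1)] f prb w(2) by (simp add: prod_eq_iff)
      then have "z = Phi F w" using inj_onD[OF charts_inj[OF D]] zD(1) PD[OF w(1)] by blast
      then show "\<xi> \<in> snd s ` (fst s \<inter> Phi F ` W)" using z w by blast
    qed
  qed
  then have "s \<in> slice_charts ?R C2 (Phi F ` W)" using s by (simp add: slice_charts_def)
  then show ?thesis using sP by blast
qed

text \<open>As \<open>W\<close> lies over a single slice chart, one chart of T*TQ straightens the
  whole image. In it every tangent vector of the image is the push-forward of a coordinate vector of
  TN, so closedness makes \<open>omega\<close> vanish on all pairs.\<close>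

lemma closed_isotropic:
  assumes F: "covector_field W F" and c: "c \<in> slice_charts Q C N" and W: "W \<subseteq> fst (T (slice_restr N c))"
    and closed: "\<And>y u v. y \<in> coords (slice_restr N c) W \<Longrightarrow> u \<in> span CC \<Longrightarrow> v \<in> span CC \<Longrightarrow>
      pd CC (\<lambda>y. pullback_form c F y \<bullet> u) v y = pd CC (\<lambda>y. pullback_form c F y \<bullet> v) u y"
  shows "isotropic_submanifold TQ (Phi F ` W)"
proof -
  let ?c = "slice_restr N c" and ?S = "Phi F ` W" and ?R = "cotangent_bundle TQ" and ?Y = "coords (slice_restr N c) W"
  define C2 :: "(('e \<times> 'e) \<times> ('e \<times> 'e)) set" where "C2 = (\<lambda>b. (b, 0)) ` CC"
  have c': "?c \<in> charts M" by (rule slice_restr_charts[OF Q sub c])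
  obtain s where s: "s \<in> slice_charts ?R C2 ?S" "?S \<subseteq> fst s" "\<And>w. w \<in> W \<Longrightarrow> snd s (Phi F w) = (snd (T ?c) w, 0)"
    using slice_chart_Phi[OF F c W] unfolding C2_def by blast
  have "CC \<subseteq> BB" using CB by (auto simp: bundle_model_def)
  then have C2: "C2 \<subseteq> bundle_model BB" by (auto simp: C2_def bundle_model_def[of BB])
  have "?S \<subseteq> carrier ?R" using smooth_map_carrier[OF Phi_smooth[OF F]] by blast
  then have S: "submanifold ?R C2 ?S" using C2 s by (auto simp: submanifold_def)
  let ?S' = "submfd ?R C2 ?S" and ?s = "slice_restr ?S s"
  have S': "satlas ?S'" by (rule satlas_submfd[OF T'TQ S])
  have i: "smooth_map ?S' ?S ?R id" by (rule smooth_map_inclusion[OF T'TQ S])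
  have s': "?s \<in> charts ?S'" by (rule slice_restr_charts[OF T'TQ S s(1)])
  have spC2: "span C2 = (\<lambda>b. (b, 0)) ` span CC"
    unfolding C2_def using linear_span_image[OF bounded_linear.linear[OF bounded_linear_Pair_0(1)]] by metis
  have bC2: "C2 \<subseteq> Basis" using satlas_Basis[OF S'] by simp
  note Y = al_smooth(1)[OF F c]
  \<comment> \<open>In the slice chart a tangent vector has components \<open>(u, 0)\<close>, and
    the image is parametrised by \<open>y\<close> as \<open>(y, 0)\<close>; the chain rule
    identifies the vector with the push-forward of \<open>u\<close>.\<close>
  have Ti: "\<exists>u\<in>span CC. \<forall>e\<in>charts_at TQ (fst (Phi F w)).
      snd (tangent_map ?S' ?R id X) (cchart TQ e) = pd CC (local_rep (T ?c) (cchart TQ e) (Phi F)) u (snd (T ?c) w)"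
    if w: "w \<in> W" and X: "X \<in> tangent_at ?S' (Phi F w)" for w X
  proof -
    let ?y = "snd (T ?c) w"
    have z: "Phi F w \<in> ?S" "Phi F w \<in> fst ?s" using w s(2) by auto
    have sz: "?s \<in> charts_at ?S' (Phi F w)" using s' z by (simp add: charts_at_charts)
    have "snd X ?s \<in> span C2" using tangent_atD(2)[OF X sz] by simp
    then obtain u where u: "u \<in> span CC" "snd X ?s = (u, 0)" unfolding spC2 by blast
    have wT: "w \<in> fst (T ?c)" using W w by blast
    have y: "?y \<in> ?Y" using w wT by (auto simp: coords_def)
    have "snd (tangent_map ?S' ?R id X) (cchart TQ e) = pd CC (local_rep (T ?c) (cchart TQ e) (Phi F)) u ?y"
      if e: "e \<in> charts_at TQ (fst (Phi F w))" for e
    proof -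
      have "Phi F w \<in> cotangent_at TQ (fst (Phi F w))" using Phi_cotangent[OF F w] fst_Phi[OF F w] by simp
      then have ce: "cchart TQ e \<in> charts_at ?R (id (Phi F w))" using cchart_charts_at[OF TQ e] by simp
      have Tisnd: "snd (tangent_map ?S' ?R id X) (cchart TQ e) = pd C2 (local_rep ?s (cchart TQ e) id) (u, 0) (snd s (Phi F w))"
        using snd_tangent_map[OF S' T'TQ i z(1) X sz ce] unfolding model_submfd u(2) snd_conv .
      have "pd CC (local_rep (T ?c) (cchart TQ e) (Phi F)) u ?y = pd CC (\<lambda>y. local_rep ?s (cchart TQ e) id (y, 0)) u ?y"
      proof (rule pd_cong[OF Y y])
        fix y' assume "y' \<in> ?Y"
        then obtain w' where w': "w' \<in> fst (T ?c)" "w' \<in> W" "y' = snd (T ?c) w'" by (rule coordsE)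
        have "Phi F w' \<in> fst ?s" using w'(2) s(2) by auto
        from charts_local_rep[OF s' this, of "cchart TQ e" id]
        have "local_rep ?s (cchart TQ e) id (y', 0) = snd (cchart TQ e) (Phi F w')" using s(3)[OF w'(2)] w'(3) by simp
        then show "local_rep (T ?c) (cchart TQ e) (Phi F) y' = local_rep ?s (cchart TQ e) id (y', 0)"
          by (simp only: w'(3) charts_local_rep[OF T_charts[OF c'] w'(1)])
      qed
      also have "\<dots> = pd C2 (local_rep ?s (cchart TQ e) id) (pd CC (\<lambda>y. (y, 0)) u ?y) (?y, 0)"
      proof (rule pd_compose[OF Y y _ _ _ u(1)])
        show "(y', 0) \<in> span C2" if "y' \<in> ?Y" for y' using opn_span[OF Y that] unfolding spC2 by blast
        show "(\<lambda>y. (y, 0::'e \<times> 'e)) differentiable at ?y within span CC"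
          by (rule bounded_linear_imp_differentiable[OF bounded_linear_Pair_0(1)])
        show "local_rep ?s (cchart TQ e) id differentiable at (?y, 0) within span C2"
          using local_rep_differentiable[OF S' T'TQ i z(1) sz ce] unfolding model_submfd snd_conv s(3)[OF w] .
      qed
      also have "pd CC (\<lambda>y. (y, 0::'e \<times> 'e)) u ?y = (u, 0)"
        by (rule pd_bounded_linear[OF bounded_linear_Pair_0(1) opn_span[OF Y y] u(1)])
      finally have E: "pd CC (local_rep (T ?c) (cchart TQ e) (Phi F)) u ?y = pd C2 (local_rep ?s (cchart TQ e) id) (u, 0) (?y, 0)" .
      show ?thesis unfolding Tisnd s(3)[OF w] by (rule E[symmetric])
    qed
    then show ?thesis using u(1) by blast
  qed
  have "omega TQ (tangent_map ?S' ?R id X) (tangent_map ?S' ?R id X') = 0"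
    if z: "z \<in> ?S" and X: "X \<in> tangent_at ?S' z" and X': "X' \<in> tangent_at ?S' z" for z X X'
  proof -
    obtain w where w: "w \<in> W" "z = Phi F w" using z by blast
    obtain u where u: "u \<in> span CC" "\<And>e. e \<in> charts_at TQ (fst (Phi F w)) \<Longrightarrow>
        snd (tangent_map ?S' ?R id X) (cchart TQ e) = pd CC (local_rep (T ?c) (cchart TQ e) (Phi F)) u (snd (T ?c) w)"
      using Ti[OF w(1) X[unfolded w(2)]] by blast
    obtain v where v: "v \<in> span CC" "\<And>e. e \<in> charts_at TQ (fst (Phi F w)) \<Longrightarrow>
        snd (tangent_map ?S' ?R id X') (cchart TQ e) = pd CC (local_rep (T ?c) (cchart TQ e) (Phi F)) v (snd (T ?c) w)"
      using Ti[OF w(1) X'[unfolded w(2)]] by blast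
    have f: "fst (tangent_map ?S' ?R id X) = Phi F w" "fst (tangent_map ?S' ?R id X') = Phi F w"
      using tangent_atD(1)[OF X] tangent_atD(1)[OF X'] w(2) by simp_all
    have wT: "w \<in> fst (T ?c)" using W w by blast
    have wc: "fst w \<in> fst c" using wT by (simp add: fst_tchart)
    have y: "snd (T ?c) w \<in> ?Y" using w wT by (auto simp: coords_def)
    show ?thesis
      using omega_Phi[OF F c w(1) wc u(1) v(1) f(1) u(2) f(2) v(2)] closed[OF y u(1) v(1)] by simp
  qed
  then show ?thesis unfolding isotropic_submanifold_def Let_def using S by blast
qed

section \<open>Isotropic images give Lagrangians\<close>

text \<open>The pullback to \<open>TN\<close> of the canonical one-form of \<open>T\<^sup>*TQ\<close> is \<open>dL\<close>.\<close>

definition Legendre :: "('a, 'e) chart \<Rightarrow> (('a, 'e) tvec \<Rightarrow> ('a, 'e) cvec) \<Rightarrow> ('e \<times> 'e \<Rightarrow> real) \<Rightarrow> 'e \<times> 'e \<Rightarrow> bool" where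
  "Legendre c F L y \<longleftrightarrow> (\<forall>j\<in>span C. \<forall>k\<in>span C.
     pd CC L (j, k) y = pd CC (fibM c F) (Gam c (tinv c y)) y \<bullet> j + fibM c F y \<bullet> k)"

text \<open>\<open>variational\<close> concerns every chart of \<open>N\<close>, slice or not. Both
  sides of \<open>Legendre\<close> change like a covector on TN: differentiating the rule for F_a
  along \<Gamma> gives a second derivative of the coordinate change, and the Jacobian of the charts
  of TN contains the same one.\<close>

lemma Legendre_transfer:
  assumes F: "covector_field W F" and c: "c \<in> charts M" and c1: "c1 \<in> charts M"
    and V: "opn CC V" "V \<subseteq> coords c W" and l: "smooth_on CC V l" and leg: "\<And>y. y \<in> V \<Longrightarrow> Legendre c F l y"
    and w: "w \<in> W" "w \<in> fst (T c)" "w \<in> fst (T c1)" "snd (T c) w \<in> V"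
  shows "Legendre c1 F ((\<lambda>w. l (snd (T c) w)) \<circ> tinv c1) (snd (T c1) w)"
  unfolding Legendre_def
proof (intro ballI)
  fix j k assume j: "j \<in> span C" and k: "k \<in> span C"
  let ?x = "fst w" and ?h = "local_rep c1 c id" and ?H = "local_rep (T c1) (T c) id" and ?y = "snd (T c1) w" and ?yo = "snd (T c) w"
  let ?L = "(\<lambda>w. l (snd (T c) w)) \<circ> tinv c1"
  have wT: "w \<in> carrier TM" and ca: "c \<in> charts_at M ?x" and ca1: "c1 \<in> charts_at M ?x"
    using fst_T_carrier[OF c w(2)] fst_T_carrier[OF c1 w(3)] by auto
  have xc: "?x \<in> fst c" "?x \<in> fst c1" using ca ca1 by (auto simp: charts_at_charts)
  have Tc: "T c \<in> charts_at TM w" and Tc1: "T c1 \<in> charts_at TM w" using T_charts_at[OF wT] ca ca1 by auto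
  have Hy: "?H ?y = ?yo" using charts_local_rep[OF T_charts[OF c1] w(3), of "T c" id] by simp
  let ?S = "snd (T c1) ` (fst (T c1) \<inter> fst (T c))"
  have S: "opn CC ?S" and Hs: "smooth_on CC ?S ?H"
    using charts_compatible[OF TM T_charts[OF c1] T_charts[OF c]] unfolding compatible_def by simp_all
  have yS: "?y \<in> ?S" using w by blast
  have HS: "?H z \<in> span CC" if "z \<in> ?S" for z
  proof -
    obtain w' where w': "w' \<in> fst (T c1)" "w' \<in> fst (T c)" "z = snd (T c1) w'" using \<open>z \<in> ?S\<close> by blast
    show ?thesis unfolding w'(3) charts_local_rep[OF T_charts[OF c1] w'(1)] using charts_span[OF T_charts[OF c] w'(2)] by simp
  qed
  let ?g = "Gam c1 w" and ?u = "snd w c1"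
  have g: "?g \<in> span CC" using gam_span[OF wT ca1] .
  have u: "?u \<in> span C" by (rule T_snd_span[OF wT ca1])
  have jk: "(j, k) \<in> span CC" using j k by (simp add: span_bundle_model)
  have dH: "?H differentiable at ?y within span CC" by (rule smooth_on_differentiable[OF Hs yS])
  have y_eq: "?y = (snd c1 ?x, ?u)" by (simp add: snd_tchart)
  have pdH: "pd CC ?H (j, k) ?y = (pd C ?h j (snd c1 ?x), pd C (pd C ?h j) ?u (snd c1 ?x) + pd C ?h k (snd c1 ?x))"
    using pd_tchart_transition[OF M ca1 ca, of ?u j k] u j k unfolding y_eq by simp
  have pdHg: "pd CC ?H ?g ?y = Gam c w"
    using tangent_atD(4)[OF Gamma_tangent[OF wT] Tc1 Tc] by (simp add: Gam_def)
  have hj: "pd C ?h j (snd c1 ?x) \<in> span C" "pd C ?h k (snd c1 ?x) \<in> span C"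
    using transition_span[OF M ca1 ca] j k by simp_all
  let ?Y = "coords c W" and ?Yo = "coords c1 W"
  have Y: "opn CC ?Y" "smooth_on CC ?Y (fibM c F)" and Y1: "opn CC ?Yo" "smooth_on CC ?Yo (fibM c1 F)"
    using fibM_smooth[OF F c] fibM_smooth[OF F c1] by (simp_all add: coords_def)
  have y0Y: "?yo \<in> ?Y" using w by (auto simp: coords_def)
  have fd: "fibM c F differentiable (at (?H ?y) within span CC)" and ld: "l differentiable (at (?H ?y) within span CC)"
    unfolding Hy by (rule smooth_on_differentiable[OF Y(2) y0Y], rule smooth_on_differentiable[OF l w(4)])
  define Z where "Z = ?S \<inter> ?Yo"
  have Z: "opn CC Z" unfolding Z_def using S Y1(1) by blast
  have yZ: "?y \<in> Z" using yS w by (auto simp: Z_def coords_def)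
  have Zw: "\<exists>w'. w' \<in> fst (T c1) \<and> w' \<in> fst (T c) \<and> w' \<in> W \<and> z = snd (T c1) w'" if z: "z \<in> Z" for z
  proof -
    obtain w1 where w1: "w1 \<in> fst (T c1)" "w1 \<in> fst (T c)" "z = snd (T c1) w1" using z by (auto simp: Z_def)
    have "z \<in> ?Yo" using z by (simp add: Z_def)
    then obtain w2 where w2: "w2 \<in> fst (T c1)" "w2 \<in> W" "z = snd (T c1) w2" by (rule coordsE)
    have "w1 = w2" using inj_onD[OF tchart_inj[OF M c1]] w1 w2 by metis
    then show ?thesis using w1 w2 by blast
  qed
  have HZ: "smooth_on CC Z ?H" by (rule smooth_on_subset[OF Hs]) (simp add: Z_def)
  have HZY: "?H z \<in> ?Y" if zZ: "z \<in> Z" for z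
  proof -
    obtain w' where w': "w' \<in> fst (T c1)" "w' \<in> fst (T c)" "w' \<in> W" "z = snd (T c1) w'" using Zw[OF zZ] by blast
    show ?thesis unfolding w'(4) charts_local_rep[OF T_charts[OF c1] w'(1)] using w' by (auto simp: coords_def)
  qed
  have PH: "smooth_on CC Z (\<lambda>z. fibM c F (?H z))"
    by (rule smooth_on_compose[OF CC CC Z openin_imp_subset[OF Y(1)] Y(2) HZ HZY])
  have comp: "opn C (snd c1 ` (fst c1 \<inter> fst c))" "smooth_on C (snd c1 ` (fst c1 \<inter> fst c)) ?h"
    using charts_compatible[OF M c1 c] unfolding compatible_def by simp_all
  have yK: "?y \<in> span CC" using opn_span[OF Z yZ] .
  have pdfst: "pd CC fst ?g ?y = ?u"
    using pd_bounded_linear[OF bounded_linear_fst yK g] fst_gam[OF wT ca1] by simp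
  have tr1: "fibM c1 F z \<bullet> a = fibM c F (?H z) \<bullet> pd C ?h a (fst z)" if zZ: "z \<in> Z" and a: "a \<in> span C" for z a
  proof -
    obtain w' where w': "w' \<in> fst (T c1)" "w' \<in> fst (T c)" "w' \<in> W" "z = snd (T c1) w'" using Zw[OF zZ] by blast
    have ch: "c \<in> charts_at M (fst w')" "c1 \<in> charts_at M (fst w')"
      using fst_T_carrier[OF c w'(2)] fst_T_carrier[OF c1 w'(1)] by auto
    have Hz: "?H z = snd (T c) w'" unfolding w'(4) charts_local_rep[OF T_charts[OF c1] w'(1)] by simp
    show ?thesis
      using ccomp_transform[OF M ch tr_cotangent[OF F w'(3)], of a] a
      unfolding Hz unfolding w'(4) fibM_T[OF c w'(2)] fibM_T[OF c1 w'(1)] fst_snd_T by simp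
  qed
  \<comment> \<open>The mechanism of the Tulczyjew coordinates once more, now between two charts of
    \<open>N\<close>: the rule \<open>tr1\<close> is differentiated along \<Gamma>.\<close>
  have "pd CC (fibM c1 F) ?g ?y \<bullet> j = pd CC (\<lambda>z. fibM c F (?H z)) ?g ?y \<bullet> pd C ?h j (fst ?y)
      + fibM c F (?H ?y) \<bullet> pd C (pd C ?h j) (pd CC fst ?g ?y) (fst ?y)"
  proof (rule pd_covector_transform[OF CC Z C comp(1) _ _ comp(2) PH _ _ yZ g j])
    show "smooth_on CC Z fst" by (rule smooth_on_linear[OF bounded_linear_fst Z CC])
    show "smooth_on CC Z (fibM c1 F)" by (rule smooth_on_subset[OF Y1(2)]) (simp add: Z_def)
    show "fst z \<in> snd c1 ` (fst c1 \<inter> fst c)" if zZ: "z \<in> Z" for z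
    proof -
      obtain w' where w': "w' \<in> fst (T c1)" "w' \<in> fst (T c)" "w' \<in> W" "z = snd (T c1) w'" using Zw[OF zZ] by blast
      then show ?thesis by (auto simp: fst_tchart fst_snd_T)
    qed
    show "fibM c1 F z \<bullet> j = fibM c F (?H z) \<bullet> pd C ?h j (fst z)" if "z \<in> Z" for z by (rule tr1[OF that j])
  qed
  also have "pd CC (\<lambda>z. fibM c F (?H z)) ?g ?y = pd CC (fibM c F) (pd CC ?H ?g ?y) (?H ?y)"
    by (rule pd_compose[OF S yS HS dH fd g])
  finally have d1: "pd CC (fibM c1 F) ?g ?y \<bullet> j = pd CC (fibM c F) (Gam c w) ?yo \<bullet> pd C ?h j (snd c1 ?x)
      + fibM c F ?yo \<bullet> pd C (pd C ?h j) ?u (snd c1 ?x)"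
    unfolding pdHg Hy pdfst fst_snd_T .
  have d2: "fibM c1 F ?y \<bullet> k = fibM c F ?yo \<bullet> pd C ?h k (snd c1 ?x)"
    using tr1[OF yZ k] unfolding Hy fst_snd_T .
  have sp2: "pd C (pd C ?h j) ?u (snd c1 ?x) + pd C ?h k (snd c1 ?x) \<in> span C"
  proof -
    have "pd CC ?H (j, k) ?y \<in> span CC" by (rule pd_in_span[OF S yS HS CC dH jk])
    then show ?thesis unfolding pdH by (simp add: span_bundle_model)
  qed
  have "?L = (\<lambda>y. l (?H y))" by (simp add: fun_eq_iff local_rep_def)
  then have "pd CC ?L (j, k) ?y = pd CC (\<lambda>y. l (?H y)) (j, k) ?y" by simp
  also have "\<dots> = pd CC l (pd CC ?H (j, k) ?y) (?H ?y)"
    by (rule pd_compose[OF S yS HS dH ld jk])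
  also have "\<dots> = pd CC (fibM c F) (Gam c w) ?yo \<bullet> pd C ?h j (snd c1 ?x)
      + fibM c F ?yo \<bullet> (pd C (pd C ?h j) ?u (snd c1 ?x) + pd C ?h k (snd c1 ?x))"
    using leg[OF w(4)] hj(1) sp2 unfolding Legendre_def pdH Hy tinv_T[OF c w(2)] by blast
  finally show "pd CC ?L (j, k) ?y = pd CC (fibM c1 F) (Gam c1 (tinv c1 ?y)) ?y \<bullet> j + fibM c1 F ?y \<bullet> k"
    unfolding tinv_T[OF c1 w(3)] d1 d2 by (simp add: inner_add_right)
qed

text \<open>By \<open>Legendre\<close>, dL/dq'^a is the component F_a of the transpose. Its vertical
  derivative is the Hessian, invertible by the kernel criterion \<open>inj_tr_iff\<close>. Its
  derivative along \<Gamma> is dL/dq^a, the reduced form of the equations in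
  \<open>Euler_Lagrange_iff\<close>.\<close>

lemma Legendre_Euler_Lagrange:
  assumes F: "covector_field W F" and c: "c \<in> charts M"
    and V: "opn CC V" "V \<subseteq> coords c W" and L: "smooth_on CC V L" and leg: "\<And>y. y \<in> V \<Longrightarrow> Legendre c F L y"
    and w: "w \<in> W" "w \<in> fst (T c)" "snd (T c) w \<in> V"
    and inj: "inj_on (tangent_map TM T'M (transp F)) (tangent_at TM w)"
  shows "invertible_on C (\<lambda>a b. dv C b (dv C a L) (snd (T c) w))"
    and "\<forall>A\<in>span C. \<forall>a\<in>C. (\<Sum>b\<in>C. dv C b (dv C a L) (snd (T c) w) * (A \<bullet> b - sode_coeff M \<Gamma> c w b)) =
      ddt C (dv C a L) (snd (T c) w) A - dq C a L (snd (T c) w)"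
proof -
  let ?y = "snd (T c) w" and ?g = "Gam c w"
  have wT: "w \<in> carrier TM" and ca: "c \<in> charts_at M (fst w)" using fst_T_carrier[OF c w(2)] by auto
  note Y = fibM_smooth[OF F c, folded coords_def]
  have yY: "?y \<in> coords c W" using w by (auto simp: coords_def)
  have g: "?g \<in> span CC" using gam_span[OF wT ca] .
  have yK: "?y \<in> span CC" using opn_span[OF V(1) w(3)] .
  have fd: "fibM c F differentiable at ?y within span CC" by (rule smooth_on_differentiable[OF Y(2) yY])
  have sp: "(0, b) \<in> span CC" "(b, 0) \<in> span CC" if "b \<in> C" for b
    using span_base[OF that] by (simp_all add: span_bundle_model span_zero)
  have dv_eq: "dv C a L y = fibM c F y \<bullet> a" if "y \<in> V" "a \<in> C" for y a
    using leg[OF that(1)] span_base[OF that(2)] span_zero[of C] unfolding Legendre_def dv_def by simp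
  have dq_eq: "dq C a L ?y = pd CC (fibM c F) ?g ?y \<bullet> a" if "a \<in> C" for a
    using leg[OF w(3)] span_base[OF that] span_zero[of C] unfolding Legendre_def dq_def tinv_T[OF c w(2)] by simp
  have pd_dv: "pd CC (dv C a L) v ?y = pd CC (fibM c F) v ?y \<bullet> a" if "a \<in> C" "v \<in> span CC" for a v
  proof -
    have "pd CC (dv C a L) v ?y = pd CC (\<lambda>y. fibM c F y \<bullet> a) v ?y"
      by (rule pd_cong[OF V(1) w(3)]) (rule dv_eq[OF _ that(1)])
    also have "\<dots> = pd CC (fibM c F) v ?y \<bullet> a"
      by (rule pd_linear_image[OF bounded_linear_inner_left fd yK that(2)])
    finally show ?thesis .
  qed
  have lin: "linear (\<lambda>k. pd CC (fibM c F) (0, k) ?y)"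
    using linear_compose[OF bounded_linear.linear[OF bounded_linear_Pair_0(2)] pd_linear[OF fd]] by (simp add: o_def)
  have "invertible_on C (\<lambda>a b. pd CC (fibM c F) (0, b) ?y \<bullet> a)"
  proof (rule invertible_onI[OF C lin])
    show "(\<lambda>k. pd CC (fibM c F) (0, k) ?y) ` span C \<subseteq> span C"
      using pd_fibM_span[OF F c yY[unfolded coords_def]] by (auto simp: span_bundle_model span_zero)
    show "u = 0" if "u \<in> span C" "pd CC (fibM c F) (0, u) ?y = 0" for u
      using inj_tr_iff[OF F w(1) ca] inj that by blast
  qed
  then show "invertible_on C (\<lambda>a b. dv C b (dv C a L) ?y)"
    unfolding invertible_on_def dv_def[of C _ "dv C _ L"] using pd_dv[OF _ sp(1)] by simp
  show "\<forall>A\<in>span C. \<forall>a\<in>C. (\<Sum>b\<in>C. dv C b (dv C a L) ?y * (A \<bullet> b - sode_coeff M \<Gamma> c w b)) =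
      ddt C (dv C a L) ?y A - dq C a L ?y"
  proof (intro ballI)
    fix A a assume A: "A \<in> span C" and a: "a \<in> C"
    \<comment> \<open>The second order condition: the direction used in
      \<open>Euler_Lagrange_iff\<close> consists of the velocity and the coefficients of \<Gamma>,
      which together are \<open>?g\<close>.\<close>
    have gg: "(snd ?y, snd ?g) = ?g" using fst_gam[OF wT ca] by (simp add: fst_snd_T prod_eq_iff)
    have sg: "snd ?g \<in> span C" using g by (auto simp: span_bundle_model)
    have "dq C a L ?y = pd CC (dv C a L) (snd ?y, snd ?g) ?y" unfolding gg dq_eq[OF a] pd_dv[OF a g] ..
    then have "(\<Sum>b\<in>C. dv C b (dv C a L) ?y * (A \<bullet> b - snd ?g \<bullet> b)) = ddt C (dv C a L) ?y A - dq C a L ?y"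
      using Euler_Lagrange_iff[OF C V(1) L w(3) sg a] A by blast
    then show "(\<Sum>b\<in>C. dv C b (dv C a L) ?y * (A \<bullet> b - sode_coeff M \<Gamma> c w b)) = ddt C (dv C a L) ?y A - dq C a L ?y"
      by (simp add: sode_coeff_def Gam_def)
  qed
qed

text \<open>On a neighbourhood, the components of \<open>F\<close> and of its transpose have the
  same inner products with \<open>span C\<close>, so their derivatives along \<Gamma> do as
  well.\<close>

lemma al_Legendre:
  assumes F: "covector_field W F" and c: "c \<in> slice_charts Q C N" and y: "y \<in> coords (slice_restr N c) W"
    and j: "j \<in> span C" and k: "k \<in> span C"
  shows "pullback_form c F y \<bullet> (j, k) =
    pd CC (fibM (slice_restr N c) F) (Gam (slice_restr N c) (tinv (slice_restr N c) y)) y \<bullet> j + fibM (slice_restr N c) F y \<bullet> k"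
proof -
  let ?c = "slice_restr N c"
  have c': "?c \<in> charts M" "c \<in> charts Q" using slice_restr_charts[OF Q sub c] slice_chartsD(1)[OF c] by auto
  note Y = al_smooth(1)[OF F c]
  obtain w where w: "w \<in> fst (T ?c)" "w \<in> W" "y = snd (T ?c) w" using y by (rule coordsE)
  let ?g = "Gam ?c (tinv ?c y)"
  have g: "?g \<in> span CC"
    unfolding w(3) tinv_T[OF c'(1) w(1)] using gam_span fst_T_carrier[OF c'(1) w(1)] by blast
  have eq: "fib ?c c F z \<bullet> a = fibM ?c F z \<bullet> a" if z: "z \<in> coords ?c W" and a: "a \<in> span C" for z a
  proof -
    obtain w where w: "w \<in> fst (T ?c)" "w \<in> W" "z = snd (T ?c) w" using z by (rule coordsE)
    have "fst w \<in> fst c" using w(1) by (simp add: fst_tchart)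
    from slice_ccomp_tr[OF F w(2) c this a] show ?thesis
      unfolding w(3) fib_T[OF c'(1) w(1)] fibM_T[OF c'(1) w(1)] by simp
  qed
  have yK: "y \<in> span CC" using opn_span[OF Y y] .
  have d: "fib ?c c F differentiable at y within span CC" "fibM ?c F differentiable at y within span CC"
    using smooth_on_differentiable[OF dom_smooth(3)[OF F c'], of y] smooth_on_differentiable[OF fibM_smooth(2)[OF F c'(1)], of y] y
    by (simp_all add: coords_dom[OF c] coords_def)
  have "pd CC (fib ?c c F) ?g y \<bullet> j = pd CC (\<lambda>z. fib ?c c F z \<bullet> j) ?g y"
    by (rule pd_linear_image[OF bounded_linear_inner_left d(1) yK g, symmetric])
  also have "\<dots> = pd CC (\<lambda>z. fibM ?c F z \<bullet> j) ?g y" by (rule pd_cong[OF Y y]) (rule eq[OF _ j])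
  also have "\<dots> = pd CC (fibM ?c F) ?g y \<bullet> j"
    by (rule pd_linear_image[OF bounded_linear_inner_left d(2) yK g])
  finally show ?thesis using eq[OF y k] by (simp add: pullback_form_def)
qed

lemma variational_along_imp_variational:
  assumes "variational_along Q C N \<Gamma>"
  shows "variational M \<Gamma>"
  unfolding variational_def Let_def model_submfd
proof
  fix v assume v: "v \<in> carrier TM"
  obtain W F where W: "openin (mtop TM) W" "v \<in> W" and Fs: "smooth_map TM W T'Q F" "\<forall>w\<in>W. fst (F w) = fst w"
    and imm: "immersion TM W T'M (transp F)"
    and iso: "isotropic_submanifold TQ ((tulczyjew Q \<circ> tangent_map TM T'Q F \<circ> \<Gamma>) ` W)"
    using assms v unfolding variational_along_def Let_def by blast
  have F: "covector_field W F" using Fs by (simp add: covector_field_def)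
  have "(tulczyjew Q \<circ> tangent_map TM T'Q F \<circ> \<Gamma>) ` W = Phi F ` W" by (simp add: Phi_def image_def)
  then have iso: "isotropic_submanifold TQ (Phi F ` W)" using iso by simp
  have inj: "inj_on (tangent_map TM T'M (transp F)) (tangent_at TM w)" if "w \<in> W" for w
    using imm that by (simp add: immersion_def)
  have vN: "fst v \<in> N" using v by (simp add: carrier_TM)
  obtain c where c: "c \<in> slice_charts Q C N" "fst v \<in> fst c" using submanifoldE[OF sub vN] by metis
  let ?c = "slice_restr N c"
  have c': "?c \<in> charts M" by (rule slice_restr_charts[OF Q sub c(1)])
  have vc: "v \<in> fst (T ?c)" using v c(2) vN by (simp add: fst_tchart carrier_TM)
  have y0: "snd (T ?c) v \<in> coords ?c W" using vc W by (auto simp: coords_def)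
  obtain V l where V: "opn CC V" "snd (T ?c) v \<in> V" "V \<subseteq> coords ?c W" and l: "smooth_on CC V l"
    and lal: "\<forall>y\<in>V. \<forall>u\<in>span CC. pd CC l u y = pullback_form c F y \<bullet> u"
    using Poincare_lemma[OF CC al_smooth(1)[OF F c(1)] y0 al_smooth(2)[OF F c(1)] isotropic_closed[OF F c(1) iso]] by blast
  have leg: "Legendre ?c F l y" if "y \<in> V" for y
    unfolding Legendre_def
  proof (intro ballI)
    fix j k assume jk: "j \<in> span C" "k \<in> span C"
    then have "(j, k) \<in> span CC" by (simp add: span_bundle_model)
    then have "pd CC l (j, k) y = pullback_form c F y \<bullet> (j, k)" using lal that by blast
    then show "pd CC l (j, k) y = pd CC (fibM ?c F) (Gam ?c (tinv ?c y)) y \<bullet> j + fibM ?c F y \<bullet> k"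
      using al_Legendre[OF F c(1) subsetD[OF V(3) that] jk] by simp
  qed
  \<comment> \<open>The part of TN on which the primitive from the Poincare lemma lives; injectivity
    of the chart keeps it inside \<open>W\<close>.\<close>
  define W' where "W' = {w \<in> fst (T ?c). snd (T ?c) w \<in> V}"
  have W'W: "W' \<subseteq> W"
  proof
    fix w assume w: "w \<in> W'"
    then have "snd (T ?c) w \<in> coords ?c W" using V(3) by (auto simp: W'_def)
    then obtain w2 where w2: "w2 \<in> fst (T ?c)" "w2 \<in> W" "snd (T ?c) w = snd (T ?c) w2" by (rule coordsE)
    have "w = w2" using inj_onD[OF tchart_inj[OF M c']] w w2 by (simp add: W'_def)
    then show "w \<in> W" using w2 by simp
  qed
  have imV: "snd (T ?c) ` W' = V"
    using V(3) unfolding W'_def coords_def by blast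
  have W'T: "W' \<subseteq> fst (T ?c)" by (auto simp: W'_def)
  have W'o: "openin (mtop TM) W'"
    by (rule openin_mtop_chart[OF TM T_charts[OF c'] W'T]) (simp add: imV V(1))
  \<comment> \<open>The primitive as a function on TN itself, so that one Lagrangian serves every
    chart of \<open>N\<close>.\<close>
  define lf where "lf w = l (snd (T ?c) w)" for w
  have lfs: "smooth_fun TM W' lf"
    unfolding smooth_fun_def
  proof
    fix x assume x: "x \<in> W'"
    have "(fst (T ?c) \<inter> W', snd (T ?c)) \<in> charts TM" by (rule charts_restrict[OF TM T_charts[OF c'] W'o])
    then have ch: "(W', snd (T ?c)) \<in> charts TM" using W'T by (simp add: Int_absorb1)
    have "smooth_on CC V (lf \<circ> inv_into W' (snd (T ?c)))"
      by (rule smooth_on_congI[OF V(1) l]) (simp add: lf_def imV[symmetric] f_inv_into_f)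
    then show "\<exists>c\<in>charts_at TM x. fst c \<subseteq> W' \<and> smooth_on (model TM) (snd c ` fst c) (lf \<circ> inv_into (fst c) (snd c))"
      using ch x by (intro bexI[of _ "(W', snd (T ?c))"]) (simp_all add: imV charts_at_charts)
  qed
  \<comment> \<open>For any chart at \<open>w\<close>, \<open>Legendre\<close> is transferred at
    every point of the overlap with \<open>W'\<close>, not only at \<open>w\<close>, because the
    Hessian and the equations differentiate it.\<close>
  have main: "invertible_on C (\<lambda>a b. dv C b (dv C a (lf \<circ> tinv c1)) (snd (T c1) w)) \<and>
      (\<forall>A\<in>span C. \<forall>a\<in>C. (\<Sum>b\<in>C. dv C b (dv C a (lf \<circ> tinv c1)) (snd (T c1) w) * (A \<bullet> b - sode_coeff M \<Gamma> c1 w b)) =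
        ddt C (dv C a (lf \<circ> tinv c1)) (snd (T c1) w) A - dq C a (lf \<circ> tinv c1) (snd (T c1) w))"
    if w: "w \<in> W'" and c1: "c1 \<in> charts_at M (fst w)" for w c1
  proof -
    have wT: "w \<in> carrier TM" using fst_T_carrier[OF c'] w W'T by blast
    have c1': "c1 \<in> charts M" "w \<in> fst (T c1)" using carrier_fst_T[OF wT c1] by auto
    note L = smooth_funD[OF TM lfs T_charts[OF c1'(1)]]
    let ?V = "snd (T c1) ` (fst (T c1) \<inter> W')"
    have V1: "opn CC ?V" "?V \<subseteq> coords c1 W" "smooth_on CC ?V (lf \<circ> tinv c1)"
      using L W'W by (auto simp: coords_def)
    have leg1: "Legendre c1 F (lf \<circ> tinv c1) y" if yV: "y \<in> ?V" for y
    proof -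
      obtain w' where w': "w' \<in> fst (T c1)" "w' \<in> W'" "y = snd (T c1) w'" using yV by blast
      have "w' \<in> W" "w' \<in> fst (T ?c)" "snd (T ?c) w' \<in> V" using w'(2) W'W by (auto simp: W'_def)
      from Legendre_transfer[OF F c' c1'(1) V(1,3) l leg this(1,2) w'(1) this(3)]
      show ?thesis unfolding w'(3) lf_def .
    qed
    have ww: "w \<in> W" "snd (T c1) w \<in> ?V" using w W'W c1'(2) by auto
    show ?thesis
      using Legendre_Euler_Lagrange[OF F c1'(1) V1 leg1 ww(1) c1'(2) ww(2) inj[OF ww(1)]] by blast
  qed
  have "v \<in> W'" using vc V(2) by (simp add: W'_def)
  then show "\<exists>W l. openin (mtop TM) W \<and> v \<in> W \<and> smooth_fun TM W l \<and>
        (\<forall>w\<in>W. \<forall>c\<in>charts_at M (fst w).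
           invertible_on C (\<lambda>a b. dv C b (dv C a (l \<circ> tinv c)) (snd (T c) w)) \<and>
           (\<forall>A\<in>span C. \<forall>a\<in>C.
              (\<Sum>b\<in>C. dv C b (dv C a (l \<circ> tinv c)) (snd (T c) w) * (A \<bullet> b - sode_coeff M \<Gamma> c w b)) =
              ddt C (dv C a (l \<circ> tinv c)) (snd (T c) w) A - dq C a (l \<circ> tinv c) (snd (T c) w)))"
    using W'o lfs main by blast
qed

section \<open>Lagrangians give isotropic images\<close>

lemma variational_imp_variational_along:
  assumes var: "variational M \<Gamma>"
  shows "variational_along Q C N \<Gamma>"
  unfolding variational_along_def Let_def
proof
  fix v assume v: "v \<in> carrier TM"
  obtain W0 l where W0: "openin (mtop TM) W0" "v \<in> W0" and l: "smooth_fun TM W0 l"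
    and EL: "\<And>w c. w \<in> W0 \<Longrightarrow> c \<in> charts_at M (fst w) \<Longrightarrow>
           invertible_on C (\<lambda>a b. dv C b (dv C a (l \<circ> tinv c)) (snd (T c) w)) \<and>
           (\<forall>A\<in>span C. \<forall>a\<in>C.
              (\<Sum>b\<in>C. dv C b (dv C a (l \<circ> tinv c)) (snd (T c) w) * (A \<bullet> b - sode_coeff M \<Gamma> c w b)) =
              ddt C (dv C a (l \<circ> tinv c)) (snd (T c) w) A - dq C a (l \<circ> tinv c) (snd (T c) w))"
    using bspec[OF var[unfolded variational_def Let_def model_submfd] v] by blast
  have vN: "fst v \<in> N" using v by (simp add: carrier_TM)
  obtain c where c: "c \<in> slice_charts Q C N" "fst v \<in> fst c" using submanifoldE[OF sub vN] by metis
  let ?c = "slice_restr N c"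
  have c': "?c \<in> charts M" "c \<in> charts Q" using slice_restr_charts[OF Q sub c(1)] slice_chartsD(1)[OF c(1)] by auto
  have vc: "v \<in> fst (T ?c)" using v c(2) vN by (simp add: fst_tchart carrier_TM)
  \<comment> \<open>Inside one slice chart \<open>F\<close> can be prescribed by its components, and
    the hypothesis of \<open>closed_isotropic\<close> on \<open>W\<close> is met.\<close>
  define W where "W = W0 \<inter> fst (T ?c)"
  define L where "L = l \<circ> tinv ?c"
  define Y where "Y = coords ?c W"
  have WT: "W \<subseteq> fst (T ?c)" and WW: "W \<subseteq> W0" by (auto simp: W_def)
  have Yeq: "Y = snd (T ?c) ` (fst (T ?c) \<inter> W0)" by (auto simp: Y_def coords_def W_def)
  have Y: "opn CC Y" and L: "smooth_on CC Y L"
    using smooth_funD[OF TM l T_charts[OF c'(1)]] by (simp_all add: Yeq L_def)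
  have Wo: "openin (mtop TM) W"
    unfolding W_def using W0(1) openin_mtop_domain[OF TM T_charts[OF c'(1)]] by blast
  have vW: "v \<in> W" using W0 vc by (simp add: W_def)
  have sp: "(0, b) \<in> span CC" "(b, 0) \<in> span CC" if "b \<in> C" for b
    using span_base[OF that] by (simp_all add: span_bundle_model span_zero)
  \<comment> \<open>The momenta dL/dq'^a. As a vector of \<open>span C\<close> it has no normal
    coordinates when it is read in \<open>span B\<close>, which is the choice F_\<alpha> =
    0.\<close>
  define P where "P y = (\<Sum>a\<in>C. dv C a L y *\<^sub>R a)" for y
  have Psp: "P y \<in> span C" for y unfolding P_def by (rule sum_Basis_in_span)
  have Pa: "P y \<bullet> a = dv C a L y" if "a \<in> C" for y a unfolding P_def by (rule inner_sum_Basis[OF C that])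
  have dvs: "smooth_on CC Y (dv C a L)" if "a \<in> C" for a
    unfolding dv_def by (rule smooth_on_pd[OF Y CC L sp(1)[OF that]])
  have Ps: "smooth_on CC Y P"
    unfolding P_def by (intro smooth_on_sum[OF Y CC] smooth_on_scaleR[OF Y] smooth_on_const[OF Y CC] dvs)
  define F where "F w = cov Q c (fst w) (P (snd (T ?c) w))" for w
  have ch: "?c \<in> charts_at M (fst w) \<and> c \<in> charts_at Q (fst w) \<and> w \<in> fst (T ?c) \<and> w \<in> carrier TM \<and> snd (T ?c) w \<in> Y \<and> w \<in> W0" if w: "w \<in> W" for w
  proof -
    have wT: "w \<in> fst (T ?c)" using w WT by blast
    then have "fst w \<in> fst c" by (simp add: fst_tchart)
    then show ?thesis using fst_T_carrier[OF c'(1) wT] c' wT w WW by (auto simp: charts_at_charts Y_def coords_def)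
  qed
  have cF: "ccomp Q c (F w) = P (snd (T ?c) w)" if "w \<in> W" for w
    unfolding F_def by (rule ccomp_cov[OF Q]) (use ch[OF that] Psp span_CB in auto)
  have F: "covector_field W F"
    unfolding covector_field_def
  proof
    show "\<forall>w\<in>W. fst (F w) = fst w" by (simp add: F_def)
    have imW: "snd (T ?c) ` W = Y" using WT by (auto simp: Y_def coords_def)
    have "smooth_on CC Y (\<lambda>y. (fst y, P y))"
      by (intro smooth_on_Pair[OF Y] Ps smooth_on_linear[OF bounded_linear_fst Y CC])
    then have "smooth_on CC Y (local_rep (T ?c) (cchart Q c) F)"
    proof (rule smooth_on_congI[OF Y])
      fix y assume "y \<in> Y"
      then obtain w where w: "w \<in> fst (T ?c)" "w \<in> W" "y = snd (T ?c) w" unfolding Y_def by (rule coordsE)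
      show "(fst y, P y) = local_rep (T ?c) (cchart Q c) F y"
        unfolding w(3) charts_local_rep[OF T_charts[OF c'(1)] w(1)] snd_cchart cF[OF w(2)] fst_snd_T
        by (simp add: F_def)
    qed
    moreover have "F ` W \<subseteq> fst (cchart Q c)"
    proof
      fix p assume "p \<in> F ` W"
      then obtain w where w: "w \<in> W" "p = F w" by blast
      show "p \<in> fst (cchart Q c)"
        using ch[OF w(1)] cov_cotangent[OF Q, of c "fst w" "P (snd (T ?c) w)"] unfolding w(2) fst_cchart F_def
        by (simp add: charts_at_charts)
    qed
    ultimately show "smooth_map TM W T'Q F"
      using WT T_charts[OF c'(1)] cchart_charts[OF Q c'(2)] Y imW
      by (intro smooth_mapI[OF TM] bexI[of _ "T ?c"] bexI[of _ "cchart Q c"] exI[of _ W]) auto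
  qed
  have fibP: "fib ?c c F y = P y" if "y \<in> Y" for y
  proof -
    obtain w where w: "w \<in> fst (T ?c)" "w \<in> W" "y = snd (T ?c) w" using \<open>y \<in> Y\<close> unfolding Y_def by (rule coordsE)
    show ?thesis unfolding w(3) fib_T[OF c'(1) w(1)] by (rule cF[OF w(2)])
  qed
  have fibMP: "fibM ?c F y = P y" if "y \<in> Y" for y
  proof (rule span_eqI[OF C fibM_span Psp])
    obtain w where w: "w \<in> fst (T ?c)" "w \<in> W" "y = snd (T ?c) w" using \<open>y \<in> Y\<close> unfolding Y_def by (rule coordsE)
    have wc: "fst w \<in> fst c" using w(1) by (simp add: fst_tchart)
    fix b assume "b \<in> C"
    from slice_ccomp_tr[OF F w(2) c(1) wc span_base[OF this]]
    show "fibM ?c F y \<bullet> b = P y \<bullet> b" unfolding w(3) fibM_T[OF c'(1) w(1)] cF[OF w(2)] .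
  qed
  \<comment> \<open>The form is dL: its velocity part by the choice of \<open>P\<close>, its base
    part by the Euler-Lagrange equations along \<Gamma>.\<close>
  have al_L: "pullback_form c F y \<bullet> u = pd CC L u y" if y: "y \<in> Y" and u: "u \<in> span CC" for y u
  proof -
    obtain w where w: "w \<in> fst (T ?c)" "w \<in> W" "y = snd (T ?c) w" using y unfolding Y_def by (rule coordsE)
    have wT: "w \<in> carrier TM" and ca: "?c \<in> charts_at M (fst w)" using ch[OF w(2)] by auto
    let ?g = "Gam ?c w"
    have g: "?g \<in> span CC" by (rule gam_span[OF wT ca])
    have sg: "snd ?g \<in> span C" using g by (auto simp: span_bundle_model)
    have yK: "y \<in> span CC" using opn_span[OF Y y] .
    have gg: "(snd y, snd ?g) = ?g" using fst_gam[OF wT ca] w(3) by (simp add: fst_snd_T prod_eq_iff)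
    have dP: "P differentiable at y within span CC" by (rule smooth_on_differentiable[OF Ps y])
    have dqP: "dq C a L y = pd CC P ?g y \<bullet> a" if a: "a \<in> C" for a
    proof -
      have "\<forall>A\<in>span C. (\<Sum>b\<in>C. dv C b (dv C a L) y * (A \<bullet> b - snd ?g \<bullet> b)) = ddt C (dv C a L) y A - dq C a L y"
        using EL[OF _ ca] ch[OF w(2)] a unfolding L_def w(3) sode_coeff_def Gam_def by blast
      then have "dq C a L y = pd CC (dv C a L) ?g y" using Euler_Lagrange_iff[OF C Y L y sg a] unfolding gg by blast
      also have "\<dots> = pd CC (\<lambda>y. P y \<bullet> a) ?g y" by (rule pd_cong[OF Y y]) (simp add: Pa[OF a])
      also have "\<dots> = pd CC P ?g y \<bullet> a" by (rule pd_linear_image[OF bounded_linear_inner_left dP yK g])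
      finally show ?thesis .
    qed
    have pullback_form: "pullback_form c F y = (pd CC P ?g y, P y)"
      unfolding pullback_form_def fibP[OF y] using pd_cong[OF Y y fibP, where u = ?g] w(3) tinv_T[OF c'(1) w(1)] by simp
    obtain j k where jk: "u = (j, k)" "j \<in> span C" "k \<in> span C" using u by (auto simp: span_bundle_model)
    have "pd CC L u y = (\<Sum>b\<in>C. (j \<bullet> b) * dq C b L y + (k \<bullet> b) * dv C b L y)"
      unfolding jk(1) using pd_bundle_expand[OF smooth_on_differentiable[OF L y] C jk(2,3)] by (simp add: dq_def dv_def)
    also have "\<dots> = (\<Sum>b\<in>C. (pd CC P ?g y \<bullet> b) * (j \<bullet> b)) + (\<Sum>b\<in>C. (P y \<bullet> b) * (k \<bullet> b))"
      unfolding sum.distrib[symmetric] by (rule sum.cong) (simp_all add: dqP Pa mult.commute)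
    also have "\<dots> = pullback_form c F y \<bullet> u"
      unfolding pullback_form jk(1) inner_Pair inner_span_expand[OF C jk(2), of "pd CC P ?g y"] inner_span_expand[OF C jk(3), of "P y"] ..
    finally show ?thesis by simp
  qed
  have iso: "isotropic_submanifold TQ (Phi F ` W)"
  proof (rule closed_isotropic[OF F c(1) WT])
    fix y u v assume y: "y \<in> coords ?c W" and u: "u \<in> span CC" and v: "v \<in> span CC"
    have yY: "y \<in> Y" using y by (simp add: Y_def)
    \<comment> \<open>Since the form is exact, closedness becomes the symmetry of the second
      derivatives of \<open>L\<close>.\<close>
    have e: "pd CC (\<lambda>y. pullback_form c F y \<bullet> a) b y = pd CC (pd CC L a) b y" if "a \<in> span CC" for a b
      by (rule pd_cong[OF Y yY]) (rule al_L[OF _ that])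
    show "pd CC (\<lambda>y. pullback_form c F y \<bullet> u) v y = pd CC (\<lambda>y. pullback_form c F y \<bullet> v) u y"
      unfolding e[OF u] e[OF v] by (rule pd_symmetric_real[OF Y CC L yY u v])
  qed
  have imm: "immersion TM W T'M (transp F)"
    unfolding immersion_def
  proof (intro conjI ballI tr_smooth[OF F])
    fix w assume w: "w \<in> W"
    have ca: "?c \<in> charts_at M (fst w)" and y: "snd (T ?c) w \<in> Y" using ch[OF w] by auto
    let ?y = "snd (T ?c) w"
    have yK: "?y \<in> span CC" using opn_span[OF Y y] .
    have dP: "P differentiable at ?y within span CC" by (rule smooth_on_differentiable[OF Ps y])
    have lin: "linear (\<lambda>k. pd CC P (0, k) ?y)"
      using linear_compose[OF bounded_linear.linear[OF bounded_linear_Pair_0(2)] pd_linear[OF dP]] by (simp add: o_def)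
    \<comment> \<open>The Hessian of \<open>L\<close> is the matrix of the vertical derivative of
      \<open>P\<close>, so regularity excludes a kernel, as \<open>inj_tr_iff\<close>
      demands.\<close>
    have hess: "dv C b (dv C a L) ?y = pd CC P (0, b) ?y \<bullet> a" if a: "a \<in> C" and b: "b \<in> C" for a b
    proof -
      have "dv C b (dv C a L) ?y = pd CC (\<lambda>y. P y \<bullet> a) (0, b) ?y"
        unfolding dv_def[of C b] by (rule pd_cong[OF Y y]) (simp add: Pa[OF a])
      also have "\<dots> = pd CC P (0, b) ?y \<bullet> a" by (rule pd_linear_image[OF bounded_linear_inner_left dP yK sp(1)[OF b]])
      finally show ?thesis .
    qed
    have "invertible_on C (\<lambda>a b. dv C b (dv C a L) ?y)" using EL[OF _ ca] ch[OF w] unfolding L_def by blast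
    then have "invertible_on C (\<lambda>a b. pd CC P (0, b) ?y \<bullet> a)"
      unfolding invertible_on_def by (simp add: hess)
    note inv = invertible_onD[OF C lin this]
    show "inj_on (tangent_map TM T'M (transp F)) (tangent_at TM w)"
      unfolding inj_tr_iff[OF F w ca]
    proof (intro ballI impI)
      fix k assume k: "k \<in> span C" "pd CC (fibM ?c F) (0, k) ?y = 0"
      have "pd CC P (0, k) ?y = 0" using k(2) pd_cong[OF Y y fibMP, where u = "(0, k)"] by simp
      then show "k = 0" by (rule inv[OF k(1)])
    qed
  qed
  have im: "(tulczyjew Q \<circ> tangent_map TM T'Q F \<circ> \<Gamma>) ` W = Phi F ` W" by (simp add: Phi_def image_def)
  show "\<exists>W F. openin (mtop TM) W \<and> v \<in> W \<and> smooth_map TM W T'Q F \<and> (\<forall>w\<in>W. fst (F w) = fst w) \<and>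
        immersion TM W T'M (transp F) \<and>
        isotropic_submanifold TQ ((tulczyjew Q \<circ> tangent_map TM T'Q F \<circ> \<Gamma>) ` W)"
    by (rule exI[of _ W], rule exI[of _ F], unfold im) (use Wo vW F imm iso in \<open>unfold covector_field_def, blast\<close>)
qed

end

theorem theorem6p2:
  fixes Q :: "('a, 'e::euclidean_space) mfd"
    and C :: "'e set" and N :: "'a set"
    and \<Gamma> :: "('a, 'e) tvec \<Rightarrow> (('a, 'e) tvec, 'e \<times> 'e) tvec"
  assumes "smooth_manifold Q"
    and "submanifold Q C N"
    and "sode (submfd Q C N) \<Gamma>"
  shows "variational (submfd Q C N) \<Gamma> \<longleftrightarrow> variational_along Q C N \<Gamma>"
proof -
  interpret sode_along Q C N \<Gamma>
    using assms by unfold_locales (simp_all add: smooth_manifold_def)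
  show ?thesis
    using variational_imp_variational_along variational_along_imp_variational by blast
qed

end
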